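(* Let $K$ be a perfect $A$-field, let $0\to M_1\to M\to M_2\to0$ be an exact sequence of dual $\mathbf t$-motives over $K$, and let $N$ be a dual $\mathbf t$-motive. Then: (i) there is an exact sequence of $\mathbb F_q[t]$-modules $$0\to\operatorname{Hom}_{\mathcal M_t^\vee}(N,M_1)\to\operatorname{Hom}_{\mathcal M_t^\vee}(N,M)\to\operatorname{Hom}_{\mathcal M_t^\vee}(N,M_2)\to\operatorname{Ext}^1_{\mathcal M_t^\vee}(N,M_1)\to\operatorname{Ext}^1_{\mathcal M_t^\vee}(N,M)\to\operatorname{Ext}^1_{\mathcal M_t^\vee}(N,M_2)\to0;$$ (ii) there is an exact sequence of $\mathbb F_q[t]$-modules $$0\to\operatorname{Hom}_{\mathcal M_t^\vee}(M_2,N)\to\operatorname{Hom}_{\mathcal M_t^\vee}(M,N)\to\operatorname{Hom}_{\mathcal M_t^\vee}(M_1,N)\to\operatorname{Ext}^1_{\mathcal M_t^\vee}(M_2,N)\to\operatorname{Ext}^1_{\mathcal M_t^\vee}(M,N)\to\operatorname{Ext}^1_{\mathcal M_t^\vee}(M_1,N)\to0.$$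
   Context: $A=\mathbb F_q[t]$; $K$ a perfect field of characteristic $p$ with $\mathbb F_q$-algebra map $\iota:A\to K$, $\theta=\iota(t)$. $K\{\sigma\}$: twisted polynomials with $\sigma x=x^{q^{-1}}\sigma$. $K[t,\sigma]$ is the ring generated by $K$, $t$, $\sigma$ with $tc=ct$, $t\sigma=\sigma t$, $\sigma c=c^{q^{-1}}\sigma$ ($c\in K$). A dual $\mathbf t$-motive is a left $K[t,\sigma]$-module that is free and finitely generated over $K\{\sigma\}$ and such that $(t-\theta)^l(H/\sigma H)=0$ for some $l\in\mathbb N$; morphisms are $K[t,\sigma]$-module homomorphisms, and $\operatorname{Hom}_{\mathcal M_t^\vee}$ denotes the $\mathbb F_q[t]$-module of morphisms. A sequence of dual $\mathbf t$-motives is exact if it is exact as a sequence of $\mathbb F_q[t]$-modules. $\operatorname{Ext}^1_{\mathcal M_t^\vee}(M_2,M_1)$ is the set of (equivalence classes of) short exact sequences $0\to M_1\to M\to M_2\to0$ of dual $\mathbf t$-motives, an $\mathbb F_q[t]$-module under Baer sum with multiplication by $a$ given by pushout along multiplication by $a$ on $M_1$. *)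

theory Defs
  imports "HOL-Library.FuncSet" "HOL-Computational_Algebra.Polynomial"
begin

(* Base data: F_q is a finite field type 'q, q = CARD('q); K is a field type 'k;
   e : F_q -> K is the structure map (K is an F_q-algebra), theta = iota(t) in K.
   iota : F_q[t] -> K is then a \<mapsto> poly (map_poly e a) theta. *)

definition frinv :: "nat \<Rightarrow> 'k::field \<Rightarrow> 'k" where
  "frinv q c = inv (\<lambda>x::'k. x ^ q) c"

definition perfect_field :: "'k::field itself \<Rightarrow> bool" where
  "perfect_field _ \<longleftrightarrow> surj (\<lambda>x::'k. x ^ CHAR('k))"

definition is_ring_hom_fun :: "('q::field \<Rightarrow> 'k::field) \<Rightarrow> bool" where
  "is_ring_hom_fun e \<longleftrightarrow> e 1 = 1 \<and> (\<forall>x y. e (x + y) = e x + e y) \<and> (\<forall>x y. e (x * y) = e x * e y)"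

(* A left K[t,sigma]-module: a K-vector space with K-linear t-action T and
   sigma-action S satisfying S (c x) = c^(q^-1) S x, and T S = S T. *)
record ('k,'a) tmod =
  tcar :: "'a set"
  tadd :: "'a \<Rightarrow> 'a \<Rightarrow> 'a"
  tzero :: "'a"
  tsmul :: "'k \<Rightarrow> 'a \<Rightarrow> 'a"
  tT :: "'a \<Rightarrow> 'a"
  tS :: "'a \<Rightarrow> 'a"

definition is_ktsmod :: "nat \<Rightarrow> ('k::field,'a) tmod \<Rightarrow> bool" where
  "is_ktsmod q H \<longleftrightarrow>
     (let C = tcar H in
      tzero H \<in> C \<and>
      (\<forall>x\<in>C. \<forall>y\<in>C. tadd H x y \<in> C) \<and>
      (\<forall>x\<in>C. \<forall>y\<in>C. \<forall>z\<in>C. tadd H (tadd H x y) z = tadd H x (tadd H y z)) \<and>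
      (\<forall>x\<in>C. \<forall>y\<in>C. tadd H x y = tadd H y x) \<and>
      (\<forall>x\<in>C. tadd H (tzero H) x = x) \<and>
      (\<forall>x\<in>C. \<exists>y\<in>C. tadd H x y = tzero H) \<and>
      (\<forall>c. \<forall>x\<in>C. tsmul H c x \<in> C) \<and>
      (\<forall>c. \<forall>x\<in>C. \<forall>y\<in>C. tsmul H c (tadd H x y) = tadd H (tsmul H c x) (tsmul H c y)) \<and>
      (\<forall>c d. \<forall>x\<in>C. tsmul H (c + d) x = tadd H (tsmul H c x) (tsmul H d x)) \<and>
      (\<forall>c d. \<forall>x\<in>C. tsmul H (c * d) x = tsmul H c (tsmul H d x)) \<and>
      (\<forall>x\<in>C. tsmul H 1 x = x) \<and>
      (\<forall>x\<in>C. tT H x \<in> C) \<and>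
      (\<forall>x\<in>C. \<forall>y\<in>C. tT H (tadd H x y) = tadd H (tT H x) (tT H y)) \<and>
      (\<forall>c. \<forall>x\<in>C. tT H (tsmul H c x) = tsmul H c (tT H x)) \<and>
      (\<forall>x\<in>C. tS H x \<in> C) \<and>
      (\<forall>x\<in>C. \<forall>y\<in>C. tS H (tadd H x y) = tadd H (tS H x) (tS H y)) \<and>
      (\<forall>c. \<forall>x\<in>C. tS H (tsmul H c x) = tsmul H (frinv q c) (tS H x)) \<and>
      (\<forall>x\<in>C. tT H (tS H x) = tS H (tT H x)))"

definition msum :: "('k,'a) tmod \<Rightarrow> ('i \<Rightarrow> 'a) \<Rightarrow> 'i list \<Rightarrow> 'a" where
  "msum H f xs = foldr (\<lambda>x acc. tadd H (f x) acc) xs (tzero H)"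

(* sum_{i<r} sum_{j<d} c i j sigma^j b_i : a K{sigma}-linear combination of b_0..b_(r-1) *)
definition kslc :: "('k,'a) tmod \<Rightarrow> (nat \<Rightarrow> 'a) \<Rightarrow> nat \<Rightarrow> nat \<Rightarrow> (nat \<Rightarrow> nat \<Rightarrow> 'k) \<Rightarrow> 'a" where
  "kslc H b r d c = msum H (\<lambda>(i,j). tsmul H (c i j) ((tS H ^^ j) (b i))) (List.product [0..<r] [0..<d])"

definition free_fg_Ksigma :: "('k::field,'a) tmod \<Rightarrow> bool" where
  "free_fg_Ksigma H \<longleftrightarrow> (\<exists>r b. (\<forall>i<r. b i \<in> tcar H) \<and>
       (\<forall>x\<in>tcar H. \<exists>d c. kslc H b r d c = x) \<and>
       (\<forall>d c. kslc H b r d c = tzero H \<longrightarrow> (\<forall>i<r. \<forall>j<d. c i j = 0)))"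

definition dual_tmotive :: "nat \<Rightarrow> 'k::field \<Rightarrow> ('k,'a) tmod \<Rightarrow> bool" where
  "dual_tmotive q \<theta> H \<longleftrightarrow> is_ktsmod q H \<and> free_fg_Ksigma H \<and>
     (\<exists>l::nat. \<forall>x\<in>tcar H. ((\<lambda>y. tadd H (tT H y) (tsmul H (- \<theta>) y)) ^^ l) x \<in> tS H ` tcar H)"

definition tmor :: "('k,'a) tmod \<Rightarrow> ('k,'b) tmod \<Rightarrow> ('a \<Rightarrow> 'b) \<Rightarrow> bool" where
  "tmor H H' f \<longleftrightarrow> (\<forall>x\<in>tcar H. f x \<in> tcar H') \<and>
     (\<forall>x\<in>tcar H. \<forall>y\<in>tcar H. f (tadd H x y) = tadd H' (f x) (f y)) \<and>
     (\<forall>c. \<forall>x\<in>tcar H. f (tsmul H c x) = tsmul H' c (f x)) \<and>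
     (\<forall>x\<in>tcar H. f (tT H x) = tT H' (f x)) \<and>
     (\<forall>x\<in>tcar H. f (tS H x) = tS H' (f x))"

definition tHom :: "('k,'a) tmod \<Rightarrow> ('k,'b) tmod \<Rightarrow> ('a \<Rightarrow> 'b) set" where
  "tHom H H' = {f. tmor H H' f \<and> f \<in> extensional (tcar H)}"

(* 0 -> A --i--> E --p--> C -> 0 exact (exactness as F_q[t]-modules = as groups) *)
definition short_exact :: "('k,'a) tmod \<Rightarrow> ('k,'e) tmod \<Rightarrow> ('k,'c) tmod \<Rightarrow> ('a \<Rightarrow> 'e) \<Rightarrow> ('e \<Rightarrow> 'c) \<Rightarrow> bool" where
  "short_exact A E C i p \<longleftrightarrow> tmor A E i \<and> tmor E C p \<and> inj_on i (tcar A) \<and>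
     p ` tcar E = tcar C \<and> i ` tcar A = {x\<in>tcar E. p x = tzero C}"

definition polyact :: "('q::field \<Rightarrow> 'k) \<Rightarrow> ('k,'a) tmod \<Rightarrow> 'q poly \<Rightarrow> 'a \<Rightarrow> 'a" where
  "polyact e H a x = msum H (\<lambda>k. tsmul H (e (coeff a k)) ((tT H ^^ k) x)) [0..<Suc (degree a)]"

record ('r,'x) amod =
  acar :: "'x set"
  aadd :: "'x \<Rightarrow> 'x \<Rightarrow> 'x"
  azero :: "'x"
  ascal :: "'r \<Rightarrow> 'x \<Rightarrow> 'x"

definition is_amod :: "('q::field poly,'x) amod \<Rightarrow> bool" where
  "is_amod X \<longleftrightarrow> (let C = acar X in
      azero X \<in> C \<and>
      (\<forall>x\<in>C. \<forall>y\<in>C. aadd X x y \<in> C) \<and>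
      (\<forall>x\<in>C. \<forall>y\<in>C. \<forall>z\<in>C. aadd X (aadd X x y) z = aadd X x (aadd X y z)) \<and>
      (\<forall>x\<in>C. \<forall>y\<in>C. aadd X x y = aadd X y x) \<and>
      (\<forall>x\<in>C. aadd X (azero X) x = x) \<and>
      (\<forall>x\<in>C. \<exists>y\<in>C. aadd X x y = azero X) \<and>
      (\<forall>a. \<forall>x\<in>C. ascal X a x \<in> C) \<and>
      (\<forall>a. \<forall>x\<in>C. \<forall>y\<in>C. ascal X a (aadd X x y) = aadd X (ascal X a x) (ascal X a y)) \<and>
      (\<forall>a b. \<forall>x\<in>C. ascal X (a + b) x = aadd X (ascal X a x) (ascal X b x)) \<and>
      (\<forall>a b. \<forall>x\<in>C. ascal X (a * b) x = ascal X a (ascal X b x)) \<and>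
      (\<forall>x\<in>C. ascal X 1 x = x))"

definition amod_lin :: "('q::field poly,'x) amod \<Rightarrow> ('q poly,'y) amod \<Rightarrow> ('x \<Rightarrow> 'y) \<Rightarrow> bool" where
  "amod_lin X Y f \<longleftrightarrow> (\<forall>x\<in>acar X. f x \<in> acar Y) \<and>
     (\<forall>x\<in>acar X. \<forall>y\<in>acar X. f (aadd X x y) = aadd Y (f x) (f y)) \<and>
     (\<forall>a. \<forall>x\<in>acar X. f (ascal X a x) = ascal Y a (f x))"

definition exact6 ::
  "('q::field poly,'x1) amod \<Rightarrow> ('q poly,'x2) amod \<Rightarrow> ('q poly,'x3) amod \<Rightarrow> ('q poly,'x4) amod \<Rightarrow> ('q poly,'x5) amod \<Rightarrow> ('q poly,'x6) amod \<Rightarrow>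
   ('x1 \<Rightarrow> 'x2) \<Rightarrow> ('x2 \<Rightarrow> 'x3) \<Rightarrow> ('x3 \<Rightarrow> 'x4) \<Rightarrow> ('x4 \<Rightarrow> 'x5) \<Rightarrow> ('x5 \<Rightarrow> 'x6) \<Rightarrow> bool" where
  "exact6 X1 X2 X3 X4 X5 X6 f1 f2 f3 f4 f5 \<longleftrightarrow>
     is_amod X1 \<and> is_amod X2 \<and> is_amod X3 \<and> is_amod X4 \<and> is_amod X5 \<and> is_amod X6 \<and>
     amod_lin X1 X2 f1 \<and> amod_lin X2 X3 f2 \<and> amod_lin X3 X4 f3 \<and> amod_lin X4 X5 f4 \<and> amod_lin X5 X6 f5 \<and>
     inj_on f1 (acar X1) \<and>
     f1 ` acar X1 = {y\<in>acar X2. f2 y = azero X3} \<and>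
     f2 ` acar X2 = {y\<in>acar X3. f3 y = azero X4} \<and>
     f3 ` acar X3 = {y\<in>acar X4. f4 y = azero X5} \<and>
     f4 ` acar X4 = {y\<in>acar X5. f5 y = azero X6} \<and>
     f5 ` acar X5 = acar X6"

definition homM :: "('q::field \<Rightarrow> 'k) \<Rightarrow> ('k,'a) tmod \<Rightarrow> ('k,'b) tmod \<Rightarrow> ('q poly, 'a \<Rightarrow> 'b) amod" where
  "homM e H H' = \<lparr> acar = tHom H H',
     aadd = (\<lambda>f g. restrict (\<lambda>x. tadd H' (f x) (g x)) (tcar H)),
     azero = restrict (\<lambda>x. tzero H') (tcar H),
     ascal = (\<lambda>a f. restrict (\<lambda>x. polyact e H' a (f x)) (tcar H)) \<rparr>"

(* Extensions 0 -> A -> E -> C -> 0 of dual t-motives.  Every such extension is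
   isomorphic to one whose underlying set lies in the product type 'a \<times> 'c
   (transport along a set bijection E = A \<times> C), so we take middle terms there. *)
type_synonym ('k,'a,'c) ext = "('k, 'a \<times> 'c) tmod \<times> ('a \<Rightarrow> 'a \<times> 'c) \<times> ('a \<times> 'c \<Rightarrow> 'c)"

definition exts :: "nat \<Rightarrow> 'k::field \<Rightarrow> ('k,'c) tmod \<Rightarrow> ('k,'a) tmod \<Rightarrow> ('k,'a,'c) ext set" where
  "exts q \<theta> C A = {(E,i,p). dual_tmotive q \<theta> E \<and> short_exact A E C i p}"

definition ext_rel :: "nat \<Rightarrow> 'k::field \<Rightarrow> ('k,'c) tmod \<Rightarrow> ('k,'a) tmod \<Rightarrow> (('k,'a,'c) ext \<times> ('k,'a,'c) ext) set" where
  "ext_rel q \<theta> C A = {((E,i,p),(E',i',p')). (E,i,p) \<in> exts q \<theta> C A \<and> (E',i',p') \<in> exts q \<theta> C A \<and>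
      (\<exists>\<phi>. tmor E E' \<phi> \<and> (\<forall>x\<in>tcar A. \<phi> (i x) = i' x) \<and> (\<forall>y\<in>tcar E. p' (\<phi> y) = p y))}"

definition Ext1 :: "nat \<Rightarrow> 'k::field \<Rightarrow> ('k,'c) tmod \<Rightarrow> ('k,'a) tmod \<Rightarrow> ('k,'a,'c) ext set set" where
  "Ext1 q \<theta> C A = exts q \<theta> C A // ext_rel q \<theta> C A"

(* X' is the pushout of the extension X (of C by A) along g : A -> A' *)
definition ext_po :: "('k,'a) tmod \<Rightarrow> ('a \<Rightarrow> 'a2) \<Rightarrow>
    ('k,'e) tmod \<times> ('a \<Rightarrow> 'e) \<times> ('e \<Rightarrow> 'c) \<Rightarrow> ('k,'e2) tmod \<times> ('a2 \<Rightarrow> 'e2) \<times> ('e2 \<Rightarrow> 'c) \<Rightarrow> bool" where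
  "ext_po A g X X' = (case X of (E,i,p) \<Rightarrow> case X' of (E',i',p') \<Rightarrow>
     (\<exists>\<psi>. tmor E E' \<psi> \<and> (\<forall>x\<in>tcar A. \<psi> (i x) = i' (g x)) \<and> (\<forall>y\<in>tcar E. p' (\<psi> y) = p y)))"

(* X' (extension of C' by A) is the pullback of X (extension of C by A) along h : C' -> C *)
definition ext_pb :: "('k,'a) tmod \<Rightarrow> ('c2 \<Rightarrow> 'c) \<Rightarrow>
    ('k,'e) tmod \<times> ('a \<Rightarrow> 'e) \<times> ('e \<Rightarrow> 'c) \<Rightarrow> ('k,'e2) tmod \<times> ('a \<Rightarrow> 'e2) \<times> ('e2 \<Rightarrow> 'c2) \<Rightarrow> bool" where
  "ext_pb A h X X' = (case X of (E,i,p) \<Rightarrow> case X' of (E',i',p') \<Rightarrow>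
     (\<exists>\<psi>. tmor E' E \<psi> \<and> (\<forall>x\<in>tcar A. \<psi> (i' x) = i x) \<and> (\<forall>y\<in>tcar E'. p (\<psi> y) = h (p' y))))"

definition pbmod :: "('k,'e1) tmod \<Rightarrow> ('e1 \<Rightarrow> 'c) \<Rightarrow> ('k,'e2) tmod \<Rightarrow> ('e2 \<Rightarrow> 'c) \<Rightarrow> ('k,'e1 \<times> 'e2) tmod" where
  "pbmod E1 p1 E2 p2 = \<lparr> tcar = {(x,y). x \<in> tcar E1 \<and> y \<in> tcar E2 \<and> p1 x = p2 y},
     tadd = (\<lambda>(x,y) (x',y'). (tadd E1 x x', tadd E2 y y')),
     tzero = (tzero E1, tzero E2),
     tsmul = (\<lambda>c (x,y). (tsmul E1 c x, tsmul E2 c y)),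
     tT = map_prod (tT E1) (tT E2),
     tS = map_prod (tS E1) (tS E2) \<rparr>"

(* X3 is (isomorphic to) the Baer sum of X1 and X2: the map from the fibre product
   factors through the quotient by {(i1 x, -i2 x)} *)
definition ext_baer :: "('k,'a) tmod \<Rightarrow> ('k,'a,'c) ext \<Rightarrow> ('k,'a,'c) ext \<Rightarrow> ('k,'a,'c) ext \<Rightarrow> bool" where
  "ext_baer A X1 X2 X3 = (case X1 of (E1,i1,p1) \<Rightarrow> case X2 of (E2,i2,p2) \<Rightarrow> case X3 of (E3,i3,p3) \<Rightarrow>
     (\<exists>\<psi>. tmor (pbmod E1 p1 E2 p2) E3 \<psi> \<and>
        (\<forall>x\<in>tcar A. \<forall>y\<in>tcar A. \<psi> (i1 x, i2 y) = i3 (tadd A x y)) \<and>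
        (\<forall>z\<in>tcar (pbmod E1 p1 E2 p2). p3 (\<psi> z) = p1 (fst z))))"

definition ext_split :: "('k,'c) tmod \<Rightarrow> ('k,'a,'c) ext \<Rightarrow> bool" where
  "ext_split C X = (case X of (E,i,p) \<Rightarrow> (\<exists>s. tmor C E s \<and> (\<forall>y\<in>tcar C. p (s y) = y)))"

definition extM :: "nat \<Rightarrow> 'k::field \<Rightarrow> ('q::field \<Rightarrow> 'k) \<Rightarrow> ('k,'c) tmod \<Rightarrow> ('k,'a) tmod \<Rightarrow> ('q poly, ('k,'a,'c) ext set) amod" where
  "extM q \<theta> e C A = \<lparr> acar = Ext1 q \<theta> C A,
     aadd = (\<lambda>c1 c2. THE c. c \<in> Ext1 q \<theta> C A \<and> (\<exists>X1\<in>c1. \<exists>X2\<in>c2. \<exists>X3\<in>c. ext_baer A X1 X2 X3)),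
     azero = (THE c. c \<in> Ext1 q \<theta> C A \<and> (\<exists>X\<in>c. ext_split C X)),
     ascal = (\<lambda>a c1. THE c. c \<in> Ext1 q \<theta> C A \<and> (\<exists>X\<in>c1. \<exists>X'\<in>c. ext_po A (polyact e A a) X X')) \<rparr>"

definition ext_push :: "nat \<Rightarrow> 'k::field \<Rightarrow> ('k,'c) tmod \<Rightarrow> ('k,'a) tmod \<Rightarrow> ('k,'a2) tmod \<Rightarrow> ('a \<Rightarrow> 'a2) \<Rightarrow>
    ('k,'a,'c) ext set \<Rightarrow> ('k,'a2,'c) ext set" where
  "ext_push q \<theta> C A A' g c = (THE c'. c' \<in> Ext1 q \<theta> C A' \<and> (\<exists>X\<in>c. \<exists>X'\<in>c'. ext_po A g X X'))"

definition ext_pull :: "nat \<Rightarrow> 'k::field \<Rightarrow> ('k,'c2) tmod \<Rightarrow> ('k,'a) tmod \<Rightarrow> ('c2 \<Rightarrow> 'c) \<Rightarrow>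
    ('k,'a,'c) ext set \<Rightarrow> ('k,'a,'c2) ext set" where
  "ext_pull q \<theta> C' A h c = (THE c'. c' \<in> Ext1 q \<theta> C' A \<and> (\<exists>X\<in>c. \<exists>X'\<in>c'. ext_pb A h X X'))"

definition delta_cov :: "nat \<Rightarrow> 'k::field \<Rightarrow> ('k,'n) tmod \<Rightarrow> ('k,'a) tmod \<Rightarrow>
    ('k,'m) tmod \<times> ('a \<Rightarrow> 'm) \<times> ('m \<Rightarrow> 'b) \<Rightarrow> ('n \<Rightarrow> 'b) \<Rightarrow> ('k,'a,'n) ext set" where
  "delta_cov q \<theta> N A X f = (THE c. c \<in> Ext1 q \<theta> N A \<and> (\<exists>X'\<in>c. ext_pb A f X X'))"

definition delta_con :: "nat \<Rightarrow> 'k::field \<Rightarrow> ('k,'b) tmod \<Rightarrow> ('k,'a) tmod \<Rightarrow> ('k,'n) tmod \<Rightarrow>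
    ('k,'m) tmod \<times> ('a \<Rightarrow> 'm) \<times> ('m \<Rightarrow> 'b) \<Rightarrow> ('a \<Rightarrow> 'n) \<Rightarrow> ('k,'n,'b) ext set" where
  "delta_con q \<theta> C A N X f = (THE c. c \<in> Ext1 q \<theta> C N \<and> (\<exists>X'\<in>c. ext_po A f X X'))"

end

theory Submission
  imports Defs
begin

text \<open>
  A dual \<open>t\<close>-motive \<open>C\<close> is free over \<open>K{\<sigma>}\<close>, so every extension of \<open>C\<close> by \<open>A\<close> splits over
  \<open>K{\<sigma>}\<close> and is \<open>A \<times> C\<close> with \<open>t (a, c) = (t a + f c, t c)\<close> for a \<open>K{\<sigma>}\<close>-linear
  map \<open>f : C \<rightarrow> A\<close>; conversely every such \<open>f\<close> defines a dual \<open>t\<close>-motive. Hence on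
  \<open>L(C, A) = Hom\<^bsub>K{\<sigma>}\<^esub>(C, A)\<close> the endomorphism \<open>D k = t k - k t\<close> has kernel \<open>Hom(C, A)\<close> and
  cokernel \<open>Ext\<^sup>1(C, A)\<close>. A short exact sequence of dual \<open>t\<close>-motives splits over \<open>K{\<sigma>}\<close>, so it
  stays exact under \<open>L(N, -)\<close> and \<open>L(-, N)\<close>, and both six-term sequences are the
  kernel-cokernel sequences of the snake lemma for \<open>D\<close>.
\<close>

section \<open>The Frobenius of the ground field\<close>

text \<open>The obstacle is that everything about \<open>Ext1\<close> is given by existence:
  equivalence, pushout, pullback and Baer sum ask for some morphism of extensions, and the
  operations are definite descriptions of classes. Normal forms turn this into linear algebra. A
  morphism between twisted sums \<open>dext A C f\<close> with prescribed outer maps has one free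
  entry, a \<open>K{\<sigma>}\<close>-linear map \<open>k\<close> out of \<open>C\<close>, and
  compatibility with \<open>t\<close> is one equation, saying that two cocycles differ by
  \<open>t k - k t\<close>. Hence pushout and pullback compose cocycles, the Baer sum adds them, and
  the split extensions are the coboundaries.

  The Frobenius enters in two ways. Its root fixes \<open>F_q\<close>, so \<open>F_q[t]\<close> is
  central and acts by endomorphisms; and \<open>c \<sigma> = \<sigma> c^q\<close>, so
  \<open>t - \<theta>\<close> preserves \<open>\<sigma> H\<close>, which keeps twisted sums inside
  the category. The final zeros of both sequences express that cokernels are right exact.\<close>

lemma power_card_UNIV_eq_self: "(x::'q::{finite,field}) ^ card (UNIV :: 'q set) = x"
proof (cases "x = 0")
  case True
  then show ?thesis
    using finite_UNIV_card_ge_0[where 'a = 'q] by simp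
next
  case False
  let ?P = "\<Prod>y\<in>UNIV - {0::'q}. y"
  \<comment> \<open>Multiplication by \<open>x\<close> permutes the nonzero elements, so it does not
    change their product.\<close>
  have "?P = (\<Prod>y\<in>UNIV - {0}. x * y)"
    using False
    by (intro prod.reindex_bij_witness[of _ "\<lambda>y. x * y" "\<lambda>y. y / x"]) auto
  also have "\<dots> = x ^ (card (UNIV :: 'q set) - 1) * ?P"
    by (simp add: prod.distrib)
  finally have "x ^ (card (UNIV :: 'q set) - 1) = 1"
    by simp
  moreover have "Suc (card (UNIV :: 'q set) - 1) = card (UNIV :: 'q set)"
    using finite_UNIV_card_ge_0[where 'a = 'q] by simp
  ultimately show ?thesis
    by (metis mult.right_neutral power_Suc)
qed

locale motive_base =
  fixes e :: "'q::{finite,field} \<Rightarrow> 'k::field" and \<theta> :: 'k and q :: nat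
  assumes hom: "is_ring_hom_fun e" and q_eq: "q = card (UNIV :: 'q set)"
begin

lemma rh_one: "e 1 = 1" and rh_add: "e (x + y) = e x + e y" and rh_mult: "e (x * y) = e x * e y"
  using hom by (auto simp: is_ring_hom_fun_def)

lemma rh_zero: "e 0 = 0"
  using rh_add[of 0 0] by (metis add_0 add_cancel_right_left)

lemma rh_uminus: "e (- x) = - e x"
  using rh_add[of x "- x"] by (simp add: rh_zero eq_neg_iff_add_eq_0 add.commute)

lemma rh_inj: "inj e"
proof (rule injI)
  fix x y assume "e x = e y"
  then have 0: "e (x - y) = 0"
    using rh_add[of x "- y"] by (simp add: rh_uminus)
  show "x = y"
  proof (rule ccontr)
    assume "x \<noteq> y"
    then have "e ((x - y) * inverse (x - y)) = 1"
      by (simp add: rh_one)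
    then show False
      using 0 by (simp add: rh_mult)
  qed
qed

lemma rh_power: "e (x ^ n) = e x ^ n"
  by (induction n) (auto simp: rh_one rh_mult)

text \<open>The monic polynomials \<open>(X + 1)\<^sup>q\<close> and \<open>X\<^sup>q + 1\<close> of degree \<open>q\<close> agree on the \<open>q\<close>
  elements of the image of \<open>e\<close>, so they are equal.\<close>
lemma power_card_add_one: "(u + 1) ^ card (UNIV :: 'q set) = (u :: 'k) ^ card (UNIV :: 'q set) + 1"
proof -
  let ?q = "card (UNIV :: 'q set)"
  have q: "?q > 0"
    using finite_UNIV_card_ge_0[where 'a = 'q] by simp
  have deg: "degree ([:1::'k, 1:] ^ ?q) = ?q"
    by (simp add: degree_power_eq)
  have "[:1::'k, 1:] ^ ?q = monom 1 ?q + 1"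
  proof (rule poly_eqI_degree_lead_coeff[where n = ?q and A = "range e"])
    have "coeff ([:1::'k, 1:] ^ ?q) ?q = 1"
      using deg lead_coeff_power[of "[:1::'k, 1:]" ?q] by simp
    then show "coeff ([:1::'k, 1:] ^ ?q) ?q = coeff (monom 1 ?q + 1) ?q"
      using q by (auto simp: coeff_1)
    show "?q \<le> card (range e)"
      by (simp add: card_image rh_inj)
    show "degree ([:1::'k, 1:] ^ ?q) \<le> ?q"
      using deg by simp
    show "degree (monom 1 ?q + 1 :: 'k poly) \<le> ?q"
      by (rule degree_add_le) (auto simp: degree_monom_eq)
    fix z assume "z \<in> range e"
    then obtain a where z: "z = e a" by auto
    have "(e a + 1) ^ ?q = e ((a + 1) ^ ?q)"
      by (simp only: rh_power rh_add rh_one)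
    also have "\<dots> = e a ^ ?q + 1"
      by (simp add: power_card_UNIV_eq_self rh_add rh_one flip: rh_power)
    finally show "poly ([:1, 1:] ^ ?q) z = poly (monom 1 ?q + 1) z"
      by (simp add: z poly_monom add.commute)
  qed
  then have "poly ([:1::'k, 1:] ^ ?q) u = poly (monom 1 ?q + 1) u"
    by simp
  then show ?thesis
    by (simp add: poly_monom add.commute)
qed

text \<open>The additivity at hand is that of adding \<open>1\<close>. Dividing by
  \<open>y ^ q\<close> reduces to this case: \<open>(x / y - 1) ^ q + 1 = 1\<close>. Injectivity is
  what makes the choice function \<open>inv\<close> in \<open>frinv\<close> a left inverse of the
  power map.\<close>

lemma inj_power_card: "inj (\<lambda>x::'k. x ^ card (UNIV :: 'q set))"
proof (rule injI)
  fix x y :: 'k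
  let ?q = "card (UNIV :: 'q set)"
  have q: "?q > 0"
    using finite_UNIV_card_ge_0[where 'a = 'q] by simp
  assume eq: "x ^ ?q = y ^ ?q"
  show "x = y"
  proof (cases "y = 0")
    case True
    then show ?thesis using eq q by (simp add: power_0_left)
  next
    case False
    then have "(x / y) ^ ?q = 1"
      using eq by (simp add: power_divide)
    then have "(x / y - 1) ^ ?q = 0"
      using power_card_add_one[of "x / y - 1"] by simp
    then show ?thesis
      using False by simp
  qed
qed

lemma frinv_power: "frinv q ((c::'k) ^ q) = c"
  unfolding frinv_def q_eq using inv_f_f[OF inj_power_card] by simp

text \<open>The twist fixes \<open>F_q\<close>. Scalars from \<open>F_q\<close>, among them the
  signs, therefore commute with \<sigma>.\<close>

lemma frinv_rh: "frinv q (e a) = e a"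
  using frinv_power[of "e a"] by (simp add: q_eq power_card_UNIV_eq_self flip: rh_power)

end

section \<open>Abelian groups on a carrier\<close>

text \<open>Both record types keep their operations as fields over a carrier. One locale supplies
  the group calculus for \<open>tmod\<close> and for \<open>amod\<close>, each time with the action
  of \<open>- 1\<close> as negation.\<close>

locale abgroup =
  fixes G :: "'a set" and plus :: "'a \<Rightarrow> 'a \<Rightarrow> 'a" (infixl "\<oplus>" 65)
    and zero :: 'a ("\<zero>") and neg :: "'a \<Rightarrow> 'a"
  assumes add_closed [simp, intro]: "\<lbrakk>x \<in> G; y \<in> G\<rbrakk> \<Longrightarrow> x \<oplus> y \<in> G"
    and zero_closed [simp, intro]: "\<zero> \<in> G"
    and neg_closed [simp, intro]: "x \<in> G \<Longrightarrow> neg x \<in> G"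
    and assoc: "\<lbrakk>x \<in> G; y \<in> G; z \<in> G\<rbrakk> \<Longrightarrow> x \<oplus> y \<oplus> z = x \<oplus> (y \<oplus> z)"
    and comm: "\<lbrakk>x \<in> G; y \<in> G\<rbrakk> \<Longrightarrow> x \<oplus> y = y \<oplus> x"
    and lzero [simp]: "x \<in> G \<Longrightarrow> \<zero> \<oplus> x = x"
    and rneg [simp]: "x \<in> G \<Longrightarrow> x \<oplus> neg x = \<zero>"
begin

lemma rzero [simp]: "x \<in> G \<Longrightarrow> x \<oplus> \<zero> = x"
  by (metis comm lzero zero_closed)

lemma lneg [simp]: "x \<in> G \<Longrightarrow> neg x \<oplus> x = \<zero>"
  by (metis comm rneg neg_closed)

lemma lcomm: "\<lbrakk>x \<in> G; y \<in> G; z \<in> G\<rbrakk> \<Longrightarrow> x \<oplus> (y \<oplus> z) = y \<oplus> (x \<oplus> z)"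
  by (metis assoc comm)

lemmas ac = assoc comm lcomm

lemma rneg_assoc [simp]: "\<lbrakk>x \<in> G; y \<in> G\<rbrakk> \<Longrightarrow> x \<oplus> (neg x \<oplus> y) = y"
  by (metis assoc lzero neg_closed rneg)

lemma lneg_assoc [simp]: "\<lbrakk>x \<in> G; y \<in> G\<rbrakk> \<Longrightarrow> neg x \<oplus> (x \<oplus> y) = y"
  by (metis assoc lzero neg_closed lneg)

lemma lcancel [simp]: "\<lbrakk>x \<in> G; y \<in> G; z \<in> G\<rbrakk> \<Longrightarrow> x \<oplus> y = x \<oplus> z \<longleftrightarrow> y = z"
  by (metis lneg_assoc)

lemma exch: "\<lbrakk>a \<in> G; b \<in> G; c \<in> G; d \<in> G\<rbrakk> \<Longrightarrow> (a \<oplus> b) \<oplus> (c \<oplus> d) = (a \<oplus> c) \<oplus> (b \<oplus> d)"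
  by (simp add: ac)

lemma neg_eqI: "\<lbrakk>x \<in> G; y \<in> G; x \<oplus> y = \<zero>\<rbrakk> \<Longrightarrow> neg x = y"
  by (metis lneg_assoc neg_closed rzero)

lemma neg_zero [simp]: "neg \<zero> = \<zero>"
  by (rule neg_eqI) auto

lemma neg_neg [simp]: "x \<in> G \<Longrightarrow> neg (neg x) = x"
  by (rule neg_eqI) auto

lemma neg_add: "\<lbrakk>x \<in> G; y \<in> G\<rbrakk> \<Longrightarrow> neg (x \<oplus> y) = neg x \<oplus> neg y"
  by (rule neg_eqI) (simp_all add: exch[of x y])

lemma diff_eq: "\<lbrakk>x \<in> G; y \<in> G; z \<in> G\<rbrakk> \<Longrightarrow> x \<oplus> neg y = z \<longleftrightarrow> x = z \<oplus> y"
  by (metis assoc lneg neg_closed rneg rzero)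

lemma eq_diff: "\<lbrakk>x \<in> G; y \<in> G; z \<in> G\<rbrakk> \<Longrightarrow> z = x \<oplus> neg y \<longleftrightarrow> z \<oplus> y = x"
  by (metis diff_eq)

lemma idem_zero: "\<lbrakk>x \<in> G; x \<oplus> x = x\<rbrakk> \<Longrightarrow> x = \<zero>"
  by (metis lcancel rzero zero_closed)

end

text \<open>The records assert only that some inverse exists, while \<open>neg\<close> is going to
  be multiplication by \<open>- 1\<close>. The element \<open>x + (- 1) x = 0 x\<close> is
  idempotent, and an idempotent of a group is zero; \<open>idem\<close> asks for just this.\<close>

lemma abgroupI:
  fixes plus (infixl "\<oplus>" 65)
  assumes add_closed: "\<And>x y. \<lbrakk>x \<in> G; y \<in> G\<rbrakk> \<Longrightarrow> x \<oplus> y \<in> G" and zero_closed: "zero \<in> G"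
    and neg_closed: "\<And>x. x \<in> G \<Longrightarrow> neg x \<in> G"
    and assoc: "\<And>x y z. \<lbrakk>x \<in> G; y \<in> G; z \<in> G\<rbrakk> \<Longrightarrow> x \<oplus> y \<oplus> z = x \<oplus> (y \<oplus> z)"
    and comm: "\<And>x y. \<lbrakk>x \<in> G; y \<in> G\<rbrakk> \<Longrightarrow> x \<oplus> y = y \<oplus> x"
    and lzero: "\<And>x. x \<in> G \<Longrightarrow> zero \<oplus> x = x"
    and inverse: "\<And>x. x \<in> G \<Longrightarrow> \<exists>y\<in>G. x \<oplus> y = zero"
    and idem: "\<And>x. x \<in> G \<Longrightarrow> (x \<oplus> neg x) \<oplus> (x \<oplus> neg x) = x \<oplus> neg x"
  shows "abgroup G plus zero neg"
proof
  fix x assume x: "x \<in> G"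
  then obtain y where y: "y \<in> G" "(x \<oplus> neg x) \<oplus> y = zero"
    using inverse[of "x \<oplus> neg x"] add_closed neg_closed by blast
  have xx: "x \<oplus> neg x \<in> G"
    using x add_closed neg_closed by simp
  have "x \<oplus> neg x = (x \<oplus> neg x) \<oplus> ((x \<oplus> neg x) \<oplus> y)"
    using y(2) xx comm[OF xx zero_closed] lzero[OF xx] by simp
  also have "\<dots> = zero"
    using assoc[OF xx xx y(1)] idem[OF x] y(2) by simp
  finally show "x \<oplus> neg x = zero" .
qed (use assms in auto)

section \<open>Modules over \<open>K[t, \<sigma>]\<close>\<close>

locale ktsmod =
  fixes q :: nat and H :: "('k::field, 'a) tmod"
  assumes ktsmod: "is_ktsmod q H"
begin

lemma smul_closed [simp, intro]: "x \<in> tcar H \<Longrightarrow> tsmul H c x \<in> tcar H"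
  and T_closed [simp, intro]: "x \<in> tcar H \<Longrightarrow> tT H x \<in> tcar H"
  and S_closed [simp, intro]: "x \<in> tcar H \<Longrightarrow> tS H x \<in> tcar H"
  and smul_add: "\<lbrakk>x \<in> tcar H; y \<in> tcar H\<rbrakk> \<Longrightarrow> tsmul H c (tadd H x y) = tadd H (tsmul H c x) (tsmul H c y)"
  and add_smul: "x \<in> tcar H \<Longrightarrow> tsmul H (c + d) x = tadd H (tsmul H c x) (tsmul H d x)"
  and smul_smul: "x \<in> tcar H \<Longrightarrow> tsmul H c (tsmul H d x) = tsmul H (c * d) x"
  and smul_one [simp]: "x \<in> tcar H \<Longrightarrow> tsmul H 1 x = x"
  and T_add: "\<lbrakk>x \<in> tcar H; y \<in> tcar H\<rbrakk> \<Longrightarrow> tT H (tadd H x y) = tadd H (tT H x) (tT H y)"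
  and T_smul: "x \<in> tcar H \<Longrightarrow> tT H (tsmul H c x) = tsmul H c (tT H x)"
  and S_add: "\<lbrakk>x \<in> tcar H; y \<in> tcar H\<rbrakk> \<Longrightarrow> tS H (tadd H x y) = tadd H (tS H x) (tS H y)"
  and S_smul: "x \<in> tcar H \<Longrightarrow> tS H (tsmul H c x) = tsmul H (frinv q c) (tS H x)"
  and T_S: "x \<in> tcar H \<Longrightarrow> tT H (tS H x) = tS H (tT H x)"
  using ktsmod unfolding is_ktsmod_def Let_def by auto

sublocale abgroup "tcar H" "tadd H" "tzero H" "tsmul H (- 1)"
proof (rule abgroupI)
  fix x assume x: "x \<in> tcar H"
  have "tadd H x (tsmul H (- 1) x) = tsmul H 0 x"
    using add_smul[OF x, of 1 "- 1"] x by simp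
  then show "tadd H (tadd H x (tsmul H (- 1) x)) (tadd H x (tsmul H (- 1) x)) = tadd H x (tsmul H (- 1) x)"
    using add_smul[OF x, of 0 0] by simp
qed (use ktsmod in \<open>auto simp: is_ktsmod_def Let_def\<close>)

lemma smul_zero_scalar [simp]: "x \<in> tcar H \<Longrightarrow> tsmul H 0 x = tzero H"
  using add_smul[of x 1 "- 1"] by simp

lemma smul_zero [simp]: "tsmul H c (tzero H) = tzero H"
  by (rule idem_zero) (auto simp flip: smul_add)

lemma T_zero [simp]: "tT H (tzero H) = tzero H"
  by (rule idem_zero) (auto simp flip: T_add)

lemma S_zero [simp]: "tS H (tzero H) = tzero H"
  by (rule idem_zero) (auto simp flip: S_add)

lemma S_pow_closed [simp, intro]: "x \<in> tcar H \<Longrightarrow> (tS H ^^ n) x \<in> tcar H"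
  by (induction n) auto

lemma T_pow_closed [simp, intro]: "x \<in> tcar H \<Longrightarrow> (tT H ^^ n) x \<in> tcar H"
  by (induction n) auto

end

section \<open>Linear maps over \<open>K{\<sigma>}\<close>\<close>

definition kslin :: "('k,'a) tmod \<Rightarrow> ('k,'b) tmod \<Rightarrow> ('a \<Rightarrow> 'b) \<Rightarrow> bool" where
  "kslin H H' f \<longleftrightarrow> (\<forall>x\<in>tcar H. f x \<in> tcar H') \<and>
     (\<forall>x\<in>tcar H. \<forall>y\<in>tcar H. f (tadd H x y) = tadd H' (f x) (f y)) \<and>
     (\<forall>c. \<forall>x\<in>tcar H. f (tsmul H c x) = tsmul H' c (f x)) \<and>
     (\<forall>x\<in>tcar H. f (tS H x) = tS H' (f x))"

lemma kslinD:
  assumes "kslin H H' f"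
  shows "x \<in> tcar H \<Longrightarrow> f x \<in> tcar H'"
    and "\<lbrakk>x \<in> tcar H; y \<in> tcar H\<rbrakk> \<Longrightarrow> f (tadd H x y) = tadd H' (f x) (f y)"
    and "x \<in> tcar H \<Longrightarrow> f (tsmul H c x) = tsmul H' c (f x)"
    and "x \<in> tcar H \<Longrightarrow> f (tS H x) = tS H' (f x)"
  using assms by (auto simp: kslin_def)

lemma tmor_iff_kslin: "tmor H H' f \<longleftrightarrow> kslin H H' f \<and> (\<forall>x\<in>tcar H. f (tT H x) = tT H' (f x))"
  by (auto simp: tmor_def kslin_def)

lemma tmor_kslin: "tmor H H' f \<Longrightarrow> kslin H H' f"
  by (simp add: tmor_iff_kslin)

lemma tmor_T: "\<lbrakk>tmor H H' f; x \<in> tcar H\<rbrakk> \<Longrightarrow> f (tT H x) = tT H' (f x)"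
  by (simp add: tmor_iff_kslin)

lemma kslin_comp: "\<lbrakk>kslin H H' f; kslin H' H'' g\<rbrakk> \<Longrightarrow> kslin H H'' (\<lambda>x. g (f x))"
  by (auto simp: kslin_def)

lemma tmor_comp: "\<lbrakk>tmor H H' f; tmor H' H'' g\<rbrakk> \<Longrightarrow> tmor H H'' (\<lambda>x. g (f x))"
  by (auto simp: tmor_def)

lemma tmor_id: "tmor H H (\<lambda>x. x)"
  by (auto simp: tmor_def)

lemma kslin_zero: "\<lbrakk>ktsmod q H; ktsmod q' H'; kslin H H' f\<rbrakk> \<Longrightarrow> f (tzero H) = tzero H'"
proof -
  assume H: "ktsmod q H" and H': "ktsmod q' H'" and f: "kslin H H' f"
  interpret H: ktsmod q H by fact
  interpret H': ktsmod q' H' by fact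
  have "f (tadd H (tzero H) (tzero H)) = tadd H' (f (tzero H)) (f (tzero H))"
    by (rule kslinD(2)[OF f]) auto
  then show ?thesis
    by (intro H'.idem_zero) (simp_all add: kslinD(1)[OF f])
qed

section \<open>Finite sums and \<open>K{\<sigma>}\<close>-linear combinations\<close>

lemma msum_Nil [simp]: "msum H f [] = tzero H"
  and msum_Cons [simp]: "msum H f (x # xs) = tadd H (f x) (msum H f xs)"
  by (simp_all add: msum_def)

lemma msum_map: "msum H f (map g xs) = msum H (\<lambda>x. f (g x)) xs"
  by (induction xs) auto

lemma msum_cong: "(\<And>x. x \<in> set xs \<Longrightarrow> f x = g x) \<Longrightarrow> msum H f xs = msum H g xs"
  by (induction xs) auto

context ktsmod
begin

lemma msum_closed: "(\<And>x. x \<in> set xs \<Longrightarrow> f x \<in> tcar H) \<Longrightarrow> msum H f xs \<in> tcar H"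
  by (induction xs) auto

lemma msum_zero: "(\<And>x. x \<in> set xs \<Longrightarrow> f x = tzero H) \<Longrightarrow> msum H f xs = tzero H"
  by (induction xs) auto

lemma msum_append:
  assumes "\<And>x. x \<in> set xs \<union> set ys \<Longrightarrow> f x \<in> tcar H"
  shows "msum H f (xs @ ys) = tadd H (msum H f xs) (msum H f ys)"
  using assms by (induction xs) (simp_all add: msum_closed assoc)

lemma msum_add:
  assumes "\<And>x. x \<in> set xs \<Longrightarrow> f x \<in> tcar H" "\<And>x. x \<in> set xs \<Longrightarrow> g x \<in> tcar H"
  shows "msum H (\<lambda>x. tadd H (f x) (g x)) xs = tadd H (msum H f xs) (msum H g xs)"
  using assms by (induction xs) (simp_all add: msum_closed exch)

lemma msum_product:
  assumes "\<And>i j. \<lbrakk>i \<in> set xs; j \<in> set ys\<rbrakk> \<Longrightarrow> f i j \<in> tcar H"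
  shows "msum H (\<lambda>(i,j). f i j) (List.product xs ys) = msum H (\<lambda>i. msum H (f i) ys) xs"
  using assms
proof (induction xs)
  case (Cons x xs)
  then have "msum H (\<lambda>(i,j). f i j) (map (Pair x) ys @ List.product xs ys)
      = tadd H (msum H (\<lambda>(i,j). f i j) (map (Pair x) ys)) (msum H (\<lambda>(i,j). f i j) (List.product xs ys))"
    by (intro msum_append) auto
  then show ?case
    using Cons by (simp add: msum_map)
qed simp

text \<open>With the double sum nested, scalars, powers of \<sigma> and padding can be treated one
  basis vector at a time.\<close>

lemma kslc_eq:
  assumes "\<forall>i<r. b i \<in> tcar H"
  shows "kslc H b r d c = msum H (\<lambda>i. msum H (\<lambda>j. tsmul H (c i j) ((tS H ^^ j) (b i))) [0..<d]) [0..<r]"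
  unfolding kslc_def using assms by (subst msum_product) auto

lemma kslc_closed:
  assumes "\<And>i. i < r \<Longrightarrow> b i \<in> tcar H"
  shows "kslc H b r d c \<in> tcar H"
  using assms by (auto simp: kslc_eq intro!: msum_closed)

lemma kslc_add:
  assumes b: "\<And>i. i < r \<Longrightarrow> b i \<in> tcar H"
  shows "kslc H b r d (\<lambda>i j. c i j + c' i j) = tadd H (kslc H b r d c) (kslc H b r d c')"
proof -
  have "kslc H b r d (\<lambda>i j. c i j + c' i j) = msum H (\<lambda>i. tadd H
      (msum H (\<lambda>j. tsmul H (c i j) ((tS H ^^ j) (b i))) [0..<d])
      (msum H (\<lambda>j. tsmul H (c' i j) ((tS H ^^ j) (b i))) [0..<d])) [0..<r]"
    using b by (auto simp: kslc_eq add_smul intro!: msum_cong msum_add)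
  also have "\<dots> = tadd H (kslc H b r d c) (kslc H b r d c')"
    using b by (auto simp: kslc_eq intro!: msum_add msum_closed)
  finally show ?thesis .
qed

text \<open>The length \<open>d\<close> of a combination is not canonical. Padding by zero
  coefficients brings two combinations to a common length, where they can be added or
  compared.\<close>

lemma kslc_pad:
  assumes b: "\<And>i. i < r \<Longrightarrow> b i \<in> tcar H" and "d \<le> D"
  shows "kslc H b r D (\<lambda>i j. if j < d then c i j else 0) = kslc H b r d c"
proof -
  have D: "[0..<D] = [0..<d] @ [d..<D]"
    using \<open>d \<le> D\<close> by (metis le_Suc_ex upt_add_eq_append zero_le)
  have "msum H (\<lambda>j. tsmul H (if j < d then c i j else 0) ((tS H ^^ j) (b i))) [0..<D]
      = msum H (\<lambda>j. tsmul H (c i j) ((tS H ^^ j) (b i))) [0..<d]" if "i < r" for i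
  proof -
    have "msum H (\<lambda>j. tsmul H (if j < d then c i j else 0) ((tS H ^^ j) (b i))) [d..<D] = tzero H"
      using that b by (intro msum_zero) auto
    moreover have "msum H (\<lambda>j. tsmul H (if j < d then c i j else 0) ((tS H ^^ j) (b i))) [0..<d]
        = msum H (\<lambda>j. tsmul H (c i j) ((tS H ^^ j) (b i))) [0..<d]"
      by (intro msum_cong) auto
    ultimately show ?thesis
      unfolding D using that b by (subst msum_append) (auto intro!: msum_closed rzero)
  qed
  then show ?thesis
    using b by (auto simp: kslc_eq intro!: msum_cong)
qed

end

lemma msum_hom:
  assumes "ktsmod q H" "f (tzero H) = tzero H'"
    and "\<And>x y. \<lbrakk>x \<in> tcar H; y \<in> tcar H\<rbrakk> \<Longrightarrow> f (tadd H x y) = tadd H' (f x) (f y)"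
    and "\<And>x. x \<in> set xs \<Longrightarrow> g x \<in> tcar H"
  shows "f (msum H g xs) = msum H' (\<lambda>x. f (g x)) xs"
proof -
  interpret ktsmod q H by fact
  show ?thesis
    using assms(4) by (induction xs) (auto simp: assms(2,3) msum_closed)
qed

lemma (in ktsmod) kslc_smul:
  assumes b: "\<And>i. i < r \<Longrightarrow> b i \<in> tcar H"
  shows "kslc H b r d (\<lambda>i j. a * c i j) = tsmul H a (kslc H b r d c)"
proof -
  have ball: "\<forall>i<r. b i \<in> tcar H"
    using b by auto
  have "tsmul H a (kslc H b r d c) = msum H (\<lambda>i. tsmul H a
      (msum H (\<lambda>j. tsmul H (c i j) ((tS H ^^ j) (b i))) [0..<d])) [0..<r]"
    unfolding kslc_eq[OF ball] by (rule msum_hom[where f = "tsmul H a", OF ktsmod_axioms]) (auto simp: b smul_add intro!: msum_closed)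
  also have "\<dots> = kslc H b r d (\<lambda>i j. a * c i j)"
    unfolding kslc_eq[OF ball]
  proof (rule msum_cong)
    fix i assume "i \<in> set [0..<r]"
    then have i: "b i \<in> tcar H" using b by simp
    have "tsmul H a (msum H (\<lambda>j. tsmul H (c i j) ((tS H ^^ j) (b i))) [0..<d])
      = msum H (\<lambda>j. tsmul H a (tsmul H (c i j) ((tS H ^^ j) (b i)))) [0..<d]"
      by (rule msum_hom[where f = "tsmul H a", OF ktsmod_axioms]) (auto simp: i smul_add)
    then show "tsmul H a (msum H (\<lambda>j. tsmul H (c i j) ((tS H ^^ j) (b i))) [0..<d])
      = msum H (\<lambda>j. tsmul H (a * c i j) ((tS H ^^ j) (b i))) [0..<d]"
      by (simp add: smul_smul i)
  qed
  finally show ?thesis ..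
qed

text \<open>Moving \<sigma> past a coefficient twists it and raises the exponent by one. The length
  grows by one accordingly, and the new constant term is zero.\<close>

lemma (in ktsmod) kslc_S:
  assumes b: "\<And>i. i < r \<Longrightarrow> b i \<in> tcar H"
  shows "kslc H b r (Suc d) (\<lambda>i j. case j of 0 \<Rightarrow> 0 | Suc j \<Rightarrow> frinv q (c i j)) = tS H (kslc H b r d c)"
proof -
  have ball: "\<forall>i<r. b i \<in> tcar H"
    using b by auto
  have "tS H (kslc H b r d c) = msum H (\<lambda>i. tS H
      (msum H (\<lambda>j. tsmul H (c i j) ((tS H ^^ j) (b i))) [0..<d])) [0..<r]"
    unfolding kslc_eq[OF ball] by (rule msum_hom[where f = "tS H", OF ktsmod_axioms]) (auto simp: b S_add intro!: msum_closed)
  also have "\<dots> = kslc H b r (Suc d) (\<lambda>i j. case j of 0 \<Rightarrow> 0 | Suc j \<Rightarrow> frinv q (c i j))"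
    unfolding kslc_eq[OF ball]
  proof (rule msum_cong)
    fix i assume "i \<in> set [0..<r]"
    then have i: "b i \<in> tcar H" using b by simp
    have "tS H (msum H (\<lambda>j. tsmul H (c i j) ((tS H ^^ j) (b i))) [0..<d])
      = msum H (\<lambda>j. tS H (tsmul H (c i j) ((tS H ^^ j) (b i)))) [0..<d]"
      by (rule msum_hom[where f = "tS H", OF ktsmod_axioms]) (auto simp: i S_add)
    moreover have "[0..<Suc d] = 0 # map Suc [0..<d]"
      by (simp add: upt_conv_Cons map_Suc_upt del: upt_Suc)
    ultimately show "tS H (msum H (\<lambda>j. tsmul H (c i j) ((tS H ^^ j) (b i))) [0..<d])
      = msum H (\<lambda>j. tsmul H (case j of 0 \<Rightarrow> 0 | Suc j \<Rightarrow> frinv q (c i j)) ((tS H ^^ j) (b i))) [0..<Suc d]"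
      by (simp add: msum_map S_smul i msum_closed del: upt_Suc)
  qed
  finally show ?thesis ..
qed

lemma kslin_S_pow: "\<lbrakk>ktsmod q H; kslin H H' f; x \<in> tcar H\<rbrakk> \<Longrightarrow> f ((tS H ^^ n) x) = (tS H' ^^ n) (f x)"
proof -
  assume "ktsmod q H" and f: "kslin H H' f" and x: "x \<in> tcar H"
  interpret ktsmod q H by fact
  show ?thesis
    by (induction n) (auto simp: kslinD(4)[OF f] x)
qed

lemma kslin_kslc:
  assumes H: "ktsmod q H" and H': "ktsmod q' H'" and f: "kslin H H' f"
    and b: "\<And>i. i < r \<Longrightarrow> b i \<in> tcar H"
  shows "f (kslc H b r d c) = kslc H' (\<lambda>i. f (b i)) r d c"
proof -
  interpret H: ktsmod q H by fact
  interpret H': ktsmod q' H' by fact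
  note z = kslin_zero[OF H H' f] and fD = kslinD[OF f]
  have ball: "\<forall>i<r. b i \<in> tcar H"
    using b by auto
  have b': "\<forall>i<r. f (b i) \<in> tcar H'"
    using b fD(1) by auto
  have "f (kslc H b r d c) = msum H' (\<lambda>i. f
      (msum H (\<lambda>j. tsmul H (c i j) ((tS H ^^ j) (b i))) [0..<d])) [0..<r]"
    unfolding H.kslc_eq[OF ball]
    by (rule msum_hom[where f = f, OF H z]) (auto simp: b fD intro!: H.msum_closed)
  also have "\<dots> = kslc H' (\<lambda>i. f (b i)) r d c"
    unfolding H'.kslc_eq[OF b']
  proof (rule msum_cong)
    fix i assume "i \<in> set [0..<r]"
    then have i: "b i \<in> tcar H" using b by simp
    have "f (msum H (\<lambda>j. tsmul H (c i j) ((tS H ^^ j) (b i))) [0..<d])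
      = msum H' (\<lambda>j. f (tsmul H (c i j) ((tS H ^^ j) (b i)))) [0..<d]"
      by (rule msum_hom[where f = f, OF H z]) (auto simp: i fD)
    then show "f (msum H (\<lambda>j. tsmul H (c i j) ((tS H ^^ j) (b i))) [0..<d])
      = msum H' (\<lambda>j. tsmul H' (c i j) ((tS H' ^^ j) (f (b i)))) [0..<d]"
      by (simp add: fD i kslin_S_pow[OF H f])
  qed
  finally show ?thesis .
qed

text \<open>This is the well-definedness of the linear map with \<open>b i |-> a i\<close>. The
  difference of two representations of one element, padded to a common length, is a relation among
  the \<open>b i\<close>, so the coefficients agree up to padding.\<close>

lemma kslc_transport:
  assumes C: "ktsmod q C" and E: "ktsmod q E"
    and b: "\<And>i. i < r \<Longrightarrow> b i \<in> tcar C" and a: "\<And>i. i < r \<Longrightarrow> a i \<in> tcar E"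
    and indep: "\<And>d c. kslc C b r d c = tzero C \<Longrightarrow> \<forall>i<r. \<forall>j<d. c i j = 0"
    and eq: "kslc C b r d c = kslc C b r d' c'"
  shows "kslc E a r d c = kslc E a r d' c'"
proof -
  interpret C: ktsmod q C by fact
  interpret E: ktsmod q E by fact
  have aall: "\<forall>i<r. a i \<in> tcar E"
    using a by auto
  let ?D = "max d d'"
  let ?c = "\<lambda>i j. if j < d then c i j else 0" and ?c' = "\<lambda>i j. if j < d' then c' i j else 0"
  let ?e = "\<lambda>i j. ?c i j + (- 1) * ?c' i j"
  have "kslc C b r ?D ?e = tadd C (kslc C b r d c) (tsmul C (- 1) (kslc C b r d' c'))"
    by (simp only: C.kslc_add C.kslc_smul C.kslc_pad b max.cobounded1 max.cobounded2)
  also have "\<dots> = tzero C"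
    by (simp add: eq C.kslc_closed b)
  finally have 0: "\<forall>i<r. \<forall>j<?D. ?e i j = 0"
    by (rule indep)
  have "kslc E a r d c = kslc E a r ?D ?c"
    by (rule E.kslc_pad[symmetric]) (auto simp: a)
  also have "\<dots> = kslc E a r ?D ?c'"
    unfolding E.kslc_eq[OF aall] using 0 by (intro msum_cong) auto
  also have "\<dots> = kslc E a r d' c'"
    by (rule E.kslc_pad) (auto simp: a)
  finally show ?thesis .
qed

text \<open>Freeness acts as projectivity: each basis vector is sent to a chosen preimage under
  \<open>p\<close> and the map is extended \<open>K{\<sigma>}\<close>-linearly. Nothing forces the
  section to commute with \<open>t\<close>; that defect becomes the cocycle of an extension.\<close>

lemma free_section:
  assumes C: "ktsmod q C" and E: "ktsmod q E" and free: "free_fg_Ksigma C"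
    and p: "kslin E C p" and surj: "p ` tcar E = tcar C"
  obtains s where "kslin C E s" "\<And>y. y \<in> tcar C \<Longrightarrow> p (s y) = y"
proof -
  interpret C: ktsmod q C by fact
  interpret E: ktsmod q E by fact
  obtain r b where basis: "(\<forall>i<r. b i \<in> tcar C) \<and> (\<forall>x\<in>tcar C. \<exists>d c. kslc C b r d c = x) \<and>
       (\<forall>d c. kslc C b r d c = tzero C \<longrightarrow> (\<forall>i<r. \<forall>j<d. c i j = 0))"
    using free unfolding free_fg_Ksigma_def by (elim exE)
  have b: "b i \<in> tcar C" if "i < r" for i
    using basis that by simp
  have span: "\<exists>d c. kslc C b r d c = x" if "x \<in> tcar C" for x
    using basis that by simp
  have indep: "\<forall>i<r. \<forall>j<d. c i j = 0" if "kslc C b r d c = tzero C" for d c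
    by (rule conjunct2[OF conjunct2[OF basis], THEN spec, THEN spec, THEN mp, OF that])
  define a where "a = (\<lambda>i. SOME y. y \<in> tcar E \<and> p y = b i)"
  have a: "a i \<in> tcar E \<and> p (a i) = b i" if "i < r" for i
  proof -
    have "b i \<in> p ` tcar E"
      using b[OF that] surj by simp
    then have "\<exists>y. y \<in> tcar E \<and> p y = b i"
      by (elim imageE) auto
    then show ?thesis
      unfolding a_def by (rule someI_ex)
  qed
  have aE: "a i \<in> tcar E" and pa: "p (a i) = b i" if "i < r" for i
    using a[OF that] by simp_all
  \<comment> \<open>The value is read off from an arbitrary representation of \<open>x\<close>; by
    \<open>kslc_transport\<close> all of them give the same result.\<close>
  define s where "s = (\<lambda>x. SOME y. \<exists>d c. kslc C b r d c = x \<and> y = kslc E a r d c)"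
  have s: "s (kslc C b r d c) = kslc E a r d c" for d c
  proof -
    have "\<exists>d' c'. kslc C b r d' c' = kslc C b r d c \<and> s (kslc C b r d c) = kslc E a r d' c'"
      unfolding s_def by (rule someI_ex) blast
    then obtain d' c' where "kslc C b r d' c' = kslc C b r d c"
      and eq: "s (kslc C b r d c) = kslc E a r d' c'"
      by (elim exE conjE)
    then have "kslc E a r d' c' = kslc E a r d c"
      by (intro kslc_transport[OF C E _ _ indep]) (auto simp: b aE)
    then show ?thesis
      using eq by simp
  qed
  have sp: "\<exists>d c. x = kslc C b r d c \<and> s x = kslc E a r d c" if "x \<in> tcar C" for x
    using span[OF that] s by metis
  have cong: "s x = y" if "x = kslc C b r d c" "kslc E a r d c = y" for x y d c
    using that s by simp
  have "kslin C E s"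
    unfolding kslin_def
  proof (intro conjI ballI allI)
    fix x assume x: "x \<in> tcar C"
    obtain d c where dc: "x = kslc C b r d c" "s x = kslc E a r d c"
      using sp[OF x] by blast
    show "s x \<in> tcar E"
      unfolding dc(2) by (rule E.kslc_closed) (rule aE)
    show "s (tS C x) = tS E (s x)"
      unfolding dc(2) unfolding dc(1)
      by (rule cong[OF C.kslc_S[symmetric] E.kslc_S]) (auto simp: b aE)
    show "s (tsmul C k x) = tsmul E k (s x)" for k
      unfolding dc(2) unfolding dc(1)
      by (rule cong[OF C.kslc_smul[symmetric] E.kslc_smul]) (auto simp: b aE)
    fix y assume y: "y \<in> tcar C"
    obtain d' c' where dc': "y = kslc C b r d' c'" "s y = kslc E a r d' c'"
      using sp[OF y] by blast
    let ?D = "max d d'"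
    let ?c = "\<lambda>i j. if j < d then c i j else 0" and ?c' = "\<lambda>i j. if j < d' then c' i j else 0"
    \<comment> \<open>Both elements are rewritten with a common length, where addition is
      coefficientwise.\<close>
    have "x = kslc C b r ?D ?c" "y = kslc C b r ?D ?c'" "s x = kslc E a r ?D ?c" "s y = kslc E a r ?D ?c'"
      using dc dc' by (auto simp: C.kslc_pad E.kslc_pad b aE)
    then show "s (tadd C x y) = tadd E (s x) (s y)"
      by (intro cong[where c = "\<lambda>i j. ?c i j + ?c' i j" and d = ?D]) (simp_all only: C.kslc_add E.kslc_add b aE)
  qed
  moreover have "p (s y) = y" if y: "y \<in> tcar C" for y
  proof -
    obtain d c where dc: "y = kslc C b r d c" "s y = kslc E a r d c"
      using sp[OF y] by blast
    have "p (s y) = kslc C (\<lambda>i. p (a i)) r d c"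
      unfolding dc(2) by (rule kslin_kslc[OF E C p]) (rule aE)
    also have "\<dots> = y"
      unfolding dc(1) using pa b C.kslc_eq[of r "\<lambda>i. p (a i)"] C.kslc_eq[of r b] by (auto intro!: msum_cong)
    finally show ?thesis .
  qed
  ultimately show ?thesis
    using that by blast
qed

section \<open>The action of \<open>\<bbbF>\<^sub>q[t]\<close>\<close>

context motive_base
begin

lemma polyact_0: "ktsmod q H \<Longrightarrow> x \<in> tcar H \<Longrightarrow> polyact e H 0 x = tzero H"
proof -
  assume "ktsmod q H" and x: "x \<in> tcar H"
  interpret ktsmod q H by fact
  show ?thesis using x by (simp add: polyact_def rh_zero)
qed

lemma polyact_closed: "ktsmod q H \<Longrightarrow> x \<in> tcar H \<Longrightarrow> polyact e H a x \<in> tcar H"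
proof -
  assume "ktsmod q H" and x: "x \<in> tcar H"
  interpret ktsmod q H by fact
  show ?thesis unfolding polyact_def using x by (intro msum_closed) auto
qed

text \<open>A Horner rule. It replaces the sum up to \<open>degree a\<close> by a recursion, so that
  the laws of the action follow by induction on the polynomial.\<close>

lemma polyact_pCons:
  assumes H: "ktsmod q H" and x: "x \<in> tcar H"
  shows "polyact e H (pCons c a) x = tadd H (tsmul H (e c) x) (tT H (polyact e H a x))"
proof -
  interpret ktsmod q H by fact
  show ?thesis
  proof (cases "a = 0")
    \<comment> \<open>Here \<open>degree (pCons c 0)\<close> is \<open>0\<close> and not
      \<open>Suc (degree 0)\<close>, so the shift of the index range used below does not
      apply.\<close>
    case True
    then show ?thesis
      using x by (simp add: polyact_0[OF H x]) (simp add: polyact_def)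
  next
    case False
    have "[0..<Suc (Suc (degree a))] = 0 # map Suc [0..<Suc (degree a)]"
      by (simp add: upt_conv_Cons map_Suc_upt del: upt_Suc)
    moreover have "tT H (polyact e H a x)
        = msum H (\<lambda>k. tT H (tsmul H (e (coeff a k)) ((tT H ^^ k) x))) [0..<Suc (degree a)]"
      unfolding polyact_def
      by (rule msum_hom[where f = "tT H", OF H]) (auto simp: x T_add)
    ultimately show ?thesis
      using False x by (simp add: polyact_def msum_map T_smul del: upt_Suc)
  qed
qed

lemma polyact_tmor:
  assumes H: "ktsmod q H" and f: "tmor H H' f" and H': "ktsmod q H'" and x: "x \<in> tcar H"
  shows "f (polyact e H a x) = polyact e H' a (f x)"
proof -
  interpret H: ktsmod q H by fact
  have fx: "f x \<in> tcar H'"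
    using f x by (auto simp: tmor_def)
  note fD = kslinD[OF tmor_kslin[OF f]] tmor_T[OF f]
  show ?thesis
    by (induction a)
      (auto simp: polyact_0[OF H x] polyact_0[OF H' fx] polyact_pCons[OF H x] polyact_pCons[OF H' fx]
        kslin_zero[OF H H' tmor_kslin[OF f]] fD polyact_closed[OF H x] x)
qed

text \<open>\<open>F_q[t]\<close> is central in \<open>K[t, \<sigma>]\<close>, because the twist
  fixes its coefficients. So \<open>a\<close> acts by an endomorphism, and pushout along it makes
  sense.\<close>

lemma tmor_polyact:
  assumes "ktsmod q H"
  shows "tmor H H (polyact e H a)"
proof -
  interpret H: ktsmod q H by fact
  note [simp] = polyact_0[OF assms] polyact_closed[OF assms] polyact_pCons[OF assms]
  have add: "polyact e H a (tadd H x y) = tadd H (polyact e H a x) (polyact e H a y)"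
    if "x \<in> tcar H" "y \<in> tcar H" for x y
    using that by (induction a) (auto simp: H.smul_add H.T_add H.exch)
  have smul: "polyact e H a (tsmul H c x) = tsmul H c (polyact e H a x)" if "x \<in> tcar H" for c x
    using that by (induction a) (auto simp: H.smul_add H.smul_smul H.T_smul mult.commute)
  have T: "polyact e H a (tT H x) = tT H (polyact e H a x)" if "x \<in> tcar H" for x
    using that by (induction a) (auto simp: H.T_add H.T_smul)
  have S: "polyact e H a (tS H x) = tS H (polyact e H a x)" if "x \<in> tcar H" for x
    using that by (induction a) (auto simp: H.S_add H.S_smul frinv_rh H.T_S)
  show ?thesis
    by (auto simp: tmor_def add smul T S)
qed

lemma polyact_add:
  assumes H: "ktsmod q H" and x: "x \<in> tcar H"
  shows "polyact e H (a + b) x = tadd H (polyact e H a x) (polyact e H b x)"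
proof -
  interpret H: ktsmod q H by fact
  show ?thesis
    by (induction a b rule: poly_induct2)
      (auto simp: polyact_0[OF H x] polyact_closed[OF H x] polyact_pCons[OF H x] x rh_add H.add_smul H.T_add H.exch)
qed

lemma polyact_mult:
  assumes H: "ktsmod q H" and x: "x \<in> tcar H"
  shows "polyact e H (a * b) x = polyact e H a (polyact e H b x)"
proof -
  interpret H: ktsmod q H by fact
  have smult: "polyact e H (smult c b) x = tsmul H (e c) (polyact e H b x)" for c b
    by (induction b)
      (auto simp: polyact_0[OF H x] polyact_closed[OF H x] polyact_pCons[OF H x] x rh_mult
        H.smul_add H.smul_smul H.T_smul)
  show ?thesis
    by (induction a)
      (auto simp: polyact_0[OF H] polyact_closed[OF H] polyact_pCons[OF H] polyact_add[OF H] x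
        smult rh_zero)
qed

lemma polyact_one: "ktsmod q H \<Longrightarrow> x \<in> tcar H \<Longrightarrow> polyact e H 1 x = x"
proof -
  assume H: "ktsmod q H" and x: "x \<in> tcar H"
  interpret ktsmod q H by fact
  show ?thesis
    using x by (simp add: one_pCons polyact_pCons[OF H x] polyact_0[OF H x] rh_one)
qed

end

section \<open>The commutator with \<open>t\<close> on \<open>K{\<sigma>}\<close>-linear
  maps\<close>

definition linM :: "('q::field \<Rightarrow> 'k) \<Rightarrow> ('k,'a) tmod \<Rightarrow> ('k,'b) tmod \<Rightarrow> ('q poly, 'a \<Rightarrow> 'b) amod" where
  "linM e H H' = (homM e H H')\<lparr>acar := {f. kslin H H' f \<and> f \<in> extensional (tcar H)}\<rparr>"

text \<open>Up to the sign \<open>w\<close>, which is chosen so that both connecting homomorphisms come out without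
  one, this is \<open>f \<mapsto> t f - f t\<close>; its kernel is \<open>Hom\<close> and its cokernel is \<open>Ext\<^sup>1\<close>.\<close>
definition Dop :: "'k \<Rightarrow> ('k::field,'a) tmod \<Rightarrow> ('k,'b) tmod \<Rightarrow> ('a \<Rightarrow> 'b) \<Rightarrow> 'a \<Rightarrow> 'b" where
  "Dop w H H' f =
     (\<lambda>x\<in>tcar H. tsmul H' w (tadd H' (tT H' (f x)) (tsmul H' (- 1) (f (tT H x)))))"

lemma linM_simps:
  "f \<in> acar (linM e H H') \<longleftrightarrow> kslin H H' f \<and> f \<in> extensional (tcar H)"
  "aadd (linM e H H') f g = (\<lambda>x\<in>tcar H. tadd H' (f x) (g x))"
  "azero (linM e H H') = (\<lambda>x\<in>tcar H. tzero H')"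
  "ascal (linM e H H') a f = (\<lambda>x\<in>tcar H. polyact e H' a (f x))"
  by (simp_all add: linM_def homM_def)

lemma kslin_restrict:
  assumes "ktsmod q H" "kslin H H' f"
  shows "kslin H H' (restrict f (tcar H))"
proof -
  interpret ktsmod q H by fact
  show ?thesis using assms(2) by (simp add: kslin_def)
qed

lemma kslin_add:
  assumes "ktsmod q H" "ktsmod q H'" and f: "kslin H H' f" and g: "kslin H H' g"
  shows "kslin H H' (\<lambda>x. tadd H' (f x) (g x))"
proof -
  interpret H: ktsmod q H by fact
  interpret H': ktsmod q H' by fact
  show ?thesis
    unfolding kslin_def
    by (auto simp: kslinD[OF f] kslinD[OF g] H'.exch H'.smul_add H'.S_add)
qed

lemma kslin_const_zero:
  assumes "ktsmod q H'"
  shows "kslin H H' (\<lambda>x. tzero H')"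
proof -
  interpret H': ktsmod q H' by fact
  show ?thesis
    unfolding kslin_def by auto
qed

text \<open>Scaling by \<open>w\<close> commutes with \<sigma> when the twist fixes
  \<open>w\<close>. It is applied to the signs \<open>1\<close> and \<open>- 1\<close>.\<close>

lemma kslin_smul_sign:
  assumes H': "ktsmod q H'" and f: "kslin H H' f"
  assumes w: "frinv q w = w"
  shows "kslin H H' (\<lambda>x. tsmul H' w (f x))"
proof -
  interpret H': ktsmod q H' by fact
  show ?thesis
    unfolding kslin_def
    by (auto simp: kslinD[OF f] H'.smul_add H'.smul_smul mult.commute H'.S_smul w)
qed

lemma kslin_T:
  assumes "ktsmod q H"
  shows "kslin H H (tT H)"
proof -
  interpret ktsmod q H by fact
  show ?thesis by (auto simp: kslin_def T_add T_smul T_S)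
qed

context motive_base
begin

lemma frinv_sign: "frinv q (- 1) = (- 1 :: 'k)" "frinv q 1 = (1 :: 'k)"
  using frinv_rh[of "- 1"] frinv_rh[of 1] by (simp_all add: rh_uminus rh_one)

lemma kslin_neg: "\<lbrakk>ktsmod q (H' :: ('k, 'b) tmod); kslin H H' f\<rbrakk> \<Longrightarrow> kslin H H' (\<lambda>x. tsmul H' (- 1) (f x))"
  by (rule kslin_smul_sign) (auto simp: frinv_sign)

lemma is_amod_linM:
  assumes H: "ktsmod q H" and H': "ktsmod q H'"
  shows "is_amod (linM e H H')"
proof -
  interpret H: ktsmod q H by fact
  interpret H': ktsmod q H' by fact
  have neg: "\<exists>g\<in>acar (linM e H H'). aadd (linM e H H') f g = azero (linM e H H')"
    if f: "f \<in> acar (linM e H H')" for f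
  proof (intro bexI)
    let ?g = "\<lambda>x\<in>tcar H. tsmul H' (- 1) (f x)"
    show "?g \<in> acar (linM e H H')"
      using f kslin_restrict[OF H kslin_neg[OF H']] by (auto simp: linM_simps)
    show "aadd (linM e H H') f ?g = azero (linM e H H')"
      using f by (auto simp: linM_simps kslinD fun_eq_iff)
  qed
  show ?thesis
    unfolding is_amod_def Let_def
    using neg
    by (auto simp: linM_simps kslinD fun_eq_iff extensional_def H'.ac
        polyact_add[OF H'] polyact_mult[OF H'] polyact_one[OF H'] polyact_closed[OF H']
        kslinD(2)[OF tmor_kslin[OF tmor_polyact[OF H']]]
        intro!: kslin_restrict[OF H] kslin_add[OF H H'] kslin_const_zero[OF H']
          kslin_comp[OF _ tmor_kslin[OF tmor_polyact[OF H']]])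
qed

lemma kslin_commutator:
  assumes H: "ktsmod q H" and H': "ktsmod q H'" and f: "kslin H H' f"
    and w: "frinv q w = (w :: 'k)"
  shows "kslin H H' (\<lambda>x. tsmul H' w (tadd H' (tT H' (f x)) (tsmul H' (- 1) (f (tT H x)))))"
  by (rule kslin_smul_sign[OF H'] kslin_add[OF H H'] kslin_neg[OF H'] kslin_comp[OF f kslin_T[OF H']]
      kslin_comp[OF kslin_T[OF H] f] w)+

text \<open>Linearity rests on centrality again: the action of a polynomial commutes with
  \<open>t\<close> on the target.\<close>

lemma amod_lin_Dop:
  assumes H: "ktsmod q H" and H': "ktsmod q H'" and w: "frinv q w = w"
  shows "amod_lin (linM e H H') (linM e H H') (Dop w H H')"
proof -
  interpret H: ktsmod q H by fact
  interpret H': ktsmod q H' by fact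
  note pa = kslinD[OF tmor_kslin[OF tmor_polyact[OF H']]] tmor_T[OF tmor_polyact[OF H']]
  have 1: "tsmul H' w (tadd H' (tadd H' a b) (tsmul H' (- 1) (tadd H' c d)))
     = tadd H' (tsmul H' w (tadd H' a (tsmul H' (- 1) c))) (tsmul H' w (tadd H' b (tsmul H' (- 1) d)))"
    if "a \<in> tcar H'" "b \<in> tcar H'" "c \<in> tcar H'" "d \<in> tcar H'" for a b c d
    using that by (simp add: H'.exch[of a b] H'.smul_add)
  show ?thesis
    unfolding amod_lin_def
    by (auto simp: linM_simps Dop_def kslinD fun_eq_iff H'.T_add 1 pa polyact_closed[OF H']
        intro!: kslin_restrict[OF H] kslin_commutator[OF H H' _ w])
qed

lemma Dop_eq_zero_iff:
  assumes H: "ktsmod q H" and H': "ktsmod q H'" and w: "w \<noteq> 0" and f: "f \<in> acar (linM e H H')"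
  shows "Dop w H H' f = azero (linM e H H') \<longleftrightarrow> tmor H H' f"
proof -
  interpret H: ktsmod q H by fact
  interpret H': ktsmod q H' by fact
  have f': "kslin H H' f"
    using f by (simp add: linM_simps)
  have 0: "tsmul H' w y = tzero H' \<longleftrightarrow> y = tzero H'" if "y \<in> tcar H'" for y
  proof
    assume "tsmul H' w y = tzero H'"
    then have "tsmul H' (inverse w) (tsmul H' w y) = tzero H'"
      by simp
    then show "y = tzero H'"
      using that w by (simp add: H'.smul_smul)
  qed simp
  have "Dop w H H' f = azero (linM e H H') \<longleftrightarrow>
     (\<forall>x\<in>tcar H. tadd H' (tT H' (f x)) (tsmul H' (- 1) (f (tT H x))) = tzero H')"
    unfolding Dop_def linM_simps fun_eq_iff
    by (auto simp: restrict_def 0 kslinD[OF f'] H'.add_closed H'.neg_closed)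
  also have "\<dots> \<longleftrightarrow> (\<forall>x\<in>tcar H. tT H' (f x) = f (tT H x))"
    by (intro ball_cong refl, subst H'.diff_eq) (auto simp: kslinD[OF f'])
  also have "\<dots> \<longleftrightarrow> tmor H H' f"
    using f' by (auto simp: tmor_iff_kslin)
  finally show ?thesis .
qed

text \<open>\<open>linM\<close> enlarges only the carrier of \<open>homM\<close>, so shrinking it to
  the kernel gives back the same record. Exactness statements about kernels thus transfer to
  \<open>homM\<close> by rewriting.\<close>

lemma homM_eq_ker:
  assumes "ktsmod q H" "ktsmod q H'" "w \<noteq> 0"
  shows "homM e H H' = (linM e H H')\<lparr>acar := {f\<in>acar (linM e H H'). Dop w H H' f = azero (linM e H H')}\<rparr>"
proof -
  have "tHom H H' = {f\<in>acar (linM e H H'). Dop w H H' f = azero (linM e H H')}"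
    using Dop_eq_zero_iff[OF assms] tmor_kslin by (auto simp: tHom_def linM_simps)
  then show ?thesis
    by (simp add: homM_def linM_def)
qed

end

section \<open>Extensions and cocycles\<close>

text \<open>Besides the section \<open>s\<close> this yields the matching retraction
  \<open>r\<close>. Both are needed later: one gives lifts and the other gives preimages or
  extensions of \<open>K{\<sigma>}\<close>-linear maps.\<close>

lemma short_exact_split:
  assumes A: "ktsmod q A" and E: "ktsmod q E" and C: "ktsmod q C" and free: "free_fg_Ksigma C"
    and ses: "short_exact A E C i p" and neg: "frinv q (- 1) = (- 1 :: 'k::field)"
  obtains s :: "'c \<Rightarrow> 'e" and r :: "'e \<Rightarrow> 'a"
  where "kslin C E s" "kslin (E :: ('k,'e) tmod) A r" "\<And>y. y \<in> tcar C \<Longrightarrow> p (s y) = y"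
    "\<And>x. x \<in> tcar A \<Longrightarrow> r (i x) = x" "\<And>y. y \<in> tcar C \<Longrightarrow> r (s y) = tzero A"
    "\<And>x. x \<in> tcar E \<Longrightarrow> tadd E (i (r x)) (s (p x)) = x"
proof -
  interpret A: ktsmod q A by fact
  interpret E: ktsmod q E by fact
  interpret C: ktsmod q C by fact
  have i: "kslin A E i" and p: "kslin E C p" and inj: "inj_on i (tcar A)"
    and surj: "p ` tcar E = tcar C" and im: "i ` tcar A = {x\<in>tcar E. p x = tzero C}"
    using ses by (simp_all add: short_exact_def tmor_kslin)
  obtain s where s: "kslin C E s" and ps: "\<And>y. y \<in> tcar C \<Longrightarrow> p (s y) = y"
    using free_section[OF C E free p surj] by metis
  note iD = kslinD[OF i] and pD = kslinD[OF p] and sD = kslinD[OF s]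
  have z: "i (tzero A) = tzero E" "p (tzero E) = tzero C"
    using kslin_zero[OF A E i] kslin_zero[OF E C p] by auto
  \<comment> \<open>This is \<open>id - s p\<close>, the projection onto the kernel of
    \<open>p\<close>. The kernel is the image of \<open>i\<close>, on which \<open>i\<close> can be
    inverted.\<close>
  define u where "u = (\<lambda>x. tadd E x (tsmul E (- 1) (s (p x))))"
  have "kslin E E u"
    unfolding u_def kslin_def
    by (auto simp: sD pD E.exch E.smul_add E.S_add E.smul_smul mult.commute E.S_smul neg)
  note uD = kslinD[OF this]
  define r where "r = (\<lambda>x. the_inv_into (tcar A) i (u x))"
  have "u x \<in> i ` tcar A" if "x \<in> tcar E" for x
    using that unfolding im u_def by (auto simp: pD sD ps)
  then have ir: "i (r x) = u x" and r_closed: "r x \<in> tcar A" if "x \<in> tcar E" for x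
    using that inj the_inv_into_into[OF inj _ subset_refl]
    unfolding r_def by (auto simp: f_the_inv_into_f[OF inj])
  \<comment> \<open>Values of \<open>r\<close> are identified through the injectivity of
    \<open>i\<close>, so every law for \<open>r\<close> reduces to one for \<open>u\<close>.\<close>
  have r_eq: "r x = a" if "x \<in> tcar E" "a \<in> tcar A" "u x = i a" for x a
    using that ir r_closed inj by (metis inj_onD)
  have "kslin E A r"
    unfolding kslin_def by (auto intro!: r_eq r_closed simp: uD iD ir r_closed)
  moreover have "r (i x) = x" if x: "x \<in> tcar A" for x
  proof (rule r_eq)
    have "p (i x) = tzero C"
      using im x by auto
    then show "u (i x) = i x"
      using x unfolding u_def by (simp add: iD kslin_zero[OF C E s])
  qed (use x iD in auto)
  moreover have "r (s y) = tzero A" if "y \<in> tcar C" for y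
    by (rule r_eq) (use that in \<open>auto simp: u_def sD ps z\<close>)
  moreover have "tadd E (i (r x)) (s (p x)) = x" if x: "x \<in> tcar E" for x
    using x by (simp add: ir u_def E.assoc sD pD)
  ultimately show ?thesis
    using that s ps by blast
qed

text \<open>The relation \<open>f - g = t k - k t\<close>, with the negative terms moved to the
  other side. The map \<open>k\<close> is the corner entry of the equivalence
  \<open>(a, c) |-> (a + k c, c)\<close> between the extensions of \<open>f\<close> and
  \<open>g\<close>.\<close>

definition coh :: "('k,'c) tmod \<Rightarrow> ('k,'a) tmod \<Rightarrow> ('c \<Rightarrow> 'a) \<Rightarrow> ('c \<Rightarrow> 'a) \<Rightarrow> bool" where
  "coh C A f g \<longleftrightarrow> (\<exists>k. kslin C A k \<and>
     (\<forall>x\<in>tcar C. tadd A (f x) (k (tT C x)) = tadd A (tT A (k x)) (g x)))"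

lemma coh_cong:
  assumes "ktsmod q C" "\<And>x. x \<in> tcar C \<Longrightarrow> f x = f' x" "\<And>x. x \<in> tcar C \<Longrightarrow> g x = g' x"
  shows "coh C A f g \<longleftrightarrow> coh C A f' g'"
  using assms by (simp add: coh_def)

lemma coh_refl:
  assumes A: "ktsmod q A" and "\<And>x. x \<in> tcar C \<Longrightarrow> f x \<in> tcar A"
  shows "coh C A f f"
proof -
  interpret A: ktsmod q A by fact
  show ?thesis
    unfolding coh_def using assms(2)
    by (intro exI[of _ "\<lambda>x. tzero A"] conjI kslin_const_zero[OF A]) auto
qed

text \<open>The direct sum as a module over \<open>K{\<sigma>}\<close>, on which \<open>t\<close>
  acts by an upper triangular matrix with corner entry \<open>f\<close>.\<close>

definition dext :: "('k,'a) tmod \<Rightarrow> ('k,'c) tmod \<Rightarrow> ('c \<Rightarrow> 'a) \<Rightarrow> ('k, 'a \<times> 'c) tmod" where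
  "dext A C f = \<lparr> tcar = tcar A \<times> tcar C,
     tadd = (\<lambda>(x,y) (x',y'). (tadd A x x', tadd C y y')),
     tzero = (tzero A, tzero C),
     tsmul = (\<lambda>c (x,y). (tsmul A c x, tsmul C c y)),
     tT = (\<lambda>(x,y). (tadd A (tT A x) (f y), tT C y)),
     tS = map_prod (tS A) (tS C) \<rparr>"

lemma dext_simps [simp]:
  "tcar (dext A C f) = tcar A \<times> tcar C"
  "tadd (dext A C f) (x,y) (x',y') = (tadd A x x', tadd C y y')"
  "tzero (dext A C f) = (tzero A, tzero C)"
  "tsmul (dext A C f) c (x,y) = (tsmul A c x, tsmul C c y)"
  "tT (dext A C f) (x,y) = (tadd A (tT A x) (f y), tT C y)"
  "tS (dext A C f) (x,y) = (tS A x, tS C y)"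
  by (simp_all add: dext_def)

definition dX :: "('k,'a) tmod \<Rightarrow> ('k,'c) tmod \<Rightarrow> ('c \<Rightarrow> 'a) \<Rightarrow> ('k,'a,'c) ext" where
  "dX A C f = (dext A C f, \<lambda>x. (x, tzero C), snd)"

text \<open>The triangular \<open>t\<close> must be \<open>K\<close>-linear and commute with
  \<sigma>. For the corner entry this is \<open>K{\<sigma>}\<close>-linearity of \<open>f\<close>;
  no further cocycle condition arises.\<close>

lemma dext_ktsmod:
  assumes A: "ktsmod q A" and C: "ktsmod q C" and f: "kslin C A f"
  shows "ktsmod q (dext A C f)"
proof -
  interpret A: ktsmod q A by fact
  interpret C: ktsmod q C by fact
  have neg: "\<exists>y\<in>tcar A \<times> tcar C. tadd (dext A C f) x y = (tzero A, tzero C)"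
    if "x \<in> tcar A \<times> tcar C" for x
    using that by (intro bexI[of _ "(tsmul A (- 1) (fst x), tsmul C (- 1) (snd x))"]) auto
  show ?thesis
    using neg
    by unfold_locales
      (auto simp: is_ktsmod_def Let_def A.ac C.ac A.smul_add C.smul_add A.add_smul C.add_smul
        A.smul_smul C.smul_smul A.T_add C.T_add A.T_smul C.T_smul A.S_add C.S_add A.S_smul C.S_smul
        A.T_S C.T_S kslinD[OF f])
qed

lemma short_exact_dext:
  assumes A: "ktsmod q A" and C: "ktsmod q C" and f: "kslin C A f"
  shows "short_exact A (dext A C f) C (\<lambda>x. (x, tzero C)) snd"
proof -
  interpret A: ktsmod q A by fact
  interpret C: ktsmod q C by fact
  have "snd ` tcar (dext A C f) = tcar C"
    by (auto simp: image_iff)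
  then show ?thesis
    unfolding short_exact_def
    by (auto simp: tmor_def inj_on_def kslin_zero[OF C A f])
qed

section \<open>Freeness and the nilpotence condition for twisted sums\<close>

lemma kslc_append:
  assumes H: "ktsmod q H" and b: "\<And>i. i < m \<Longrightarrow> b i \<in> tcar H" "\<And>i. i < n \<Longrightarrow> b' i \<in> tcar H"
  shows "kslc H (\<lambda>i. if i < m then b i else b' (i - m)) (m + n) d c
    = tadd H (kslc H b m d c) (kslc H b' n d (\<lambda>i. c (i + m)))"
proof -
  interpret ktsmod q H by fact
  let ?F = "\<lambda>i. msum H (\<lambda>j. tsmul H (c i j) ((tS H ^^ j) (if i < m then b i else b' (i - m)))) [0..<d]"
  have l: "[0..<m + n] = [0..<m] @ map (\<lambda>i. i + m) [0..<n]"
    using upt_add_eq_append[of 0 m n] by (simp add: map_add_upt add.commute[of n])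
  have "kslc H (\<lambda>i. if i < m then b i else b' (i - m)) (m + n) d c = msum H ?F [0..<m + n]"
    using b by (subst kslc_eq) auto
  also have "\<dots> = tadd H (msum H ?F [0..<m]) (msum H (\<lambda>i. ?F (i + m)) [0..<n])"
    unfolding l by (subst msum_append) (auto simp: msum_map b intro!: msum_closed)
  also have "msum H ?F [0..<m] = kslc H b m d c"
    using b by (subst kslc_eq) (auto intro!: msum_cong)
  also have "msum H (\<lambda>i. ?F (i + m)) [0..<n] = kslc H b' n d (\<lambda>i. c (i + m))"
    using b by (subst kslc_eq) (auto intro!: msum_cong)
  finally show ?thesis .
qed

text \<open>Combinations over \<open>K{\<sigma>}\<close> do not see \<open>t\<close>, so the twist
  by \<open>f\<close> is invisible and the bases of \<open>A\<close> and \<open>C\<close> can be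
  concatenated.\<close>

lemma free_dext:
  assumes A: "ktsmod q A" and C: "ktsmod q C" and f: "kslin C A f"
    and fA: "free_fg_Ksigma A" and fC: "free_fg_Ksigma C"
  shows "free_fg_Ksigma (dext A C f)"
proof -
  let ?E = "dext A C f"
  interpret A: ktsmod q A by fact
  interpret C: ktsmod q C by fact
  have E: "ktsmod q ?E"
    by (rule dext_ktsmod[OF A C f])
  interpret E: ktsmod q ?E by fact
  obtain m a where a: "(\<forall>i<m. a i \<in> tcar A) \<and> (\<forall>x\<in>tcar A. \<exists>d c. kslc A a m d c = x) \<and>
       (\<forall>d c. kslc A a m d c = tzero A \<longrightarrow> (\<forall>i<m. \<forall>j<d. c i j = 0))"
    using fA unfolding free_fg_Ksigma_def by (elim exE)
  obtain n b where b: "(\<forall>i<n. b i \<in> tcar C) \<and> (\<forall>x\<in>tcar C. \<exists>d c. kslc C b n d c = x) \<and>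
       (\<forall>d c. kslc C b n d c = tzero C \<longrightarrow> (\<forall>i<n. \<forall>j<d. c i j = 0))"
    using fC unfolding free_fg_Ksigma_def by (elim exE)
  have ac: "a i \<in> tcar A" if "i < m" for i using a that by simp
  have bc: "b i \<in> tcar C" if "i < n" for i using b that by simp
  define g where "g = (\<lambda>i. if i < m then (a i, tzero C) else (tzero A, b (i - m)))"
  have g: "g i \<in> tcar ?E" if "i < m + n" for i
    using that ac bc by (auto simp: g_def)
  have inA: "kslin A ?E (\<lambda>x. (x, tzero C))" and inC: "kslin C ?E (\<lambda>y. (tzero A, y))"
    by (auto simp: kslin_def)
  have eq: "kslc ?E g (m + n) d c = (kslc A a m d c, kslc C b n d (\<lambda>i. c (i + m)))" for d c
  proof -
    have "kslc ?E g (m + n) d c = tadd ?E (kslc ?E (\<lambda>i. (a i, tzero C)) m d c)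
        (kslc ?E (\<lambda>i. (tzero A, b i)) n d (\<lambda>i. c (i + m)))"
      unfolding g_def by (rule kslc_append[OF E]) (auto simp: ac bc)
    also have "kslc ?E (\<lambda>i. (a i, tzero C)) m d c = (kslc A a m d c, tzero C)"
      by (rule kslin_kslc[OF A E inA ac, symmetric])
    also have "kslc ?E (\<lambda>i. (tzero A, b i)) n d (\<lambda>i. c (i + m)) = (tzero A, kslc C b n d (\<lambda>i. c (i + m)))"
      by (rule kslin_kslc[OF C E inC bc, symmetric])
    finally show ?thesis
      by (simp add: A.kslc_closed ac C.kslc_closed bc)
  qed
  show ?thesis
    unfolding free_fg_Ksigma_def
  proof (rule exI[of _ "m + n"], rule exI[of _ g], intro conjI allI impI ballI)
    show "g i \<in> tcar ?E" if "i < m + n" for i by (rule g[OF that])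
    fix x assume "x \<in> tcar ?E"
    then obtain y z where x: "x = (y, z)" "y \<in> tcar A" "z \<in> tcar C" by auto
    obtain d c where 1: "kslc A a m d c = y" using a x(2) by meson
    obtain d' c' where 2: "kslc C b n d' c' = z" using b x(3) by meson
    let ?D = "max d d'"
    \<comment> \<open>Indices below \<open>m\<close> belong to the basis of \<open>A\<close>, the
      others to that of \<open>C\<close>; both coefficient families are padded to the length
      \<open>?D\<close>.\<close>
    let ?c = "\<lambda>i j. if i < m then (if j < d then c i j else 0) else (if j < d' then c' (i - m) j else 0)"
    have "kslc A a m ?D ?c = kslc A a m ?D (\<lambda>i j. if j < d then c i j else 0)"
      using ac by (auto simp: A.kslc_eq intro!: msum_cong)
    also have "\<dots> = y"
      using 1 by (simp add: A.kslc_pad ac)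
    finally have "kslc ?E g (m + n) ?D ?c = x"
      unfolding eq x using 2 by (simp add: C.kslc_pad bc)
    then show "\<exists>d c. kslc ?E g (m + n) d c = x" by blast
  next
    fix d c i j
    assume 0: "kslc ?E g (m + n) d c = tzero ?E" and i: "i < m + n" and j: "j < d"
    have A0: "\<forall>i<m. \<forall>j<d. c i j = 0"
      by (rule conjunct2[OF conjunct2[OF a], THEN spec, THEN spec, THEN mp]) (use 0 eq in simp)
    have C0: "\<forall>i<n. \<forall>j<d. c (i + m) j = 0"
      by (rule conjunct2[OF conjunct2[OF b], THEN spec, THEN spec, THEN mp]) (use 0 eq in simp)
    show "c i j = 0"
    proof (cases "i < m")
      case False
      then have "c (i - m + m) j = 0"
        using C0 i j by (metis less_diff_conv2 add.commute linorder_not_less)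
      then show ?thesis using False by simp
    qed (use A0 j in simp)
  qed
qed

text \<open>With \<open>u = - \<theta>\<close> this carries the nilpotence condition along the
  inclusion and the projection of an extension.\<close>

lemma tmor_iterate_shift:
  assumes H: "ktsmod q H" and f: "tmor H H' f" and x: "x \<in> tcar H"
  shows "((\<lambda>y. tadd H (tT H y) (tsmul H u y)) ^^ l) x \<in> tcar H"
    and "f (((\<lambda>y. tadd H (tT H y) (tsmul H u y)) ^^ l) x)
      = ((\<lambda>y. tadd H' (tT H' y) (tsmul H' u y)) ^^ l) (f x)"
proof -
  interpret ktsmod q H by fact
  note fD = kslinD[OF tmor_kslin[OF f]] tmor_T[OF f]
  have *: "((\<lambda>y. tadd H (tT H y) (tsmul H u y)) ^^ l) x \<in> tcar H" for l
    using x by (induction l) auto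
  then show "((\<lambda>y. tadd H (tT H y) (tsmul H u y)) ^^ l) x \<in> tcar H" .
  show "f (((\<lambda>y. tadd H (tT H y) (tsmul H u y)) ^^ l) x)
      = ((\<lambda>y. tadd H' (tT H' y) (tsmul H' u y)) ^^ l) (f x)"
    by (induction l) (use * in \<open>auto simp: fD\<close>)
qed

text \<open>The exponents add. After \<open>m\<close> steps the component in \<open>C\<close> lies
  in \<open>\<sigma> C\<close>, so the element lies in \<open>A + \<sigma> E\<close>. After
  \<open>l\<close> more steps the part from \<open>A\<close> lies in \<open>\<sigma> A\<close>,
  while \<open>t - \<theta>\<close> preserves \<open>\<sigma> E\<close> throughout.\<close>

lemma (in motive_base) dual_tmotive_dext:
  assumes mA: "dual_tmotive q \<theta> A" and mC: "dual_tmotive q \<theta> C" and f: "kslin C A f"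
  shows "dual_tmotive q \<theta> (dext A C f)"
proof -
  let ?E = "dext A C f"
  have A: "ktsmod q A" and C: "ktsmod q C"
    using mA mC by (auto simp: dual_tmotive_def ktsmod_def)
  interpret A: ktsmod q A by fact
  interpret C: ktsmod q C by fact
  have E: "ktsmod q ?E"
    by (rule dext_ktsmod[OF A C f])
  interpret E: ktsmod q ?E by fact
  define NA where "NA = (\<lambda>y. tadd A (tT A y) (tsmul A (- \<theta>) y))"
  define NC where "NC = (\<lambda>y. tadd C (tT C y) (tsmul C (- \<theta>) y))"
  define NE where "NE = (\<lambda>y. tadd ?E (tT ?E y) (tsmul ?E (- \<theta>) y))"
  obtain l where l: "\<And>x. x \<in> tcar A \<Longrightarrow> (NA ^^ l) x \<in> tS A ` tcar A"
    using mA unfolding dual_tmotive_def NA_def by auto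
  obtain m where m: "\<And>x. x \<in> tcar C \<Longrightarrow> (NC ^^ m) x \<in> tS C ` tcar C"
    using mC unfolding dual_tmotive_def NC_def by auto
  have i: "tmor A ?E (\<lambda>x. (x, tzero C))" and p: "tmor ?E C snd"
    using short_exact_dext[OF A C f] by (auto simp: short_exact_def)
  have NE_closed: "(NE ^^ n) x \<in> tcar ?E" if "x \<in> tcar ?E" for x n
    unfolding NE_def using that by (rule tmor_iterate_shift[OF E tmor_id])
  have NE_add: "(NE ^^ n) (tadd ?E x y) = tadd ?E ((NE ^^ n) x) ((NE ^^ n) y)"
    if "x \<in> tcar ?E" "y \<in> tcar ?E" for x y n
  proof (induction n)
    case (Suc n)
    have "NE (tadd ?E x y) = tadd ?E (NE x) (NE y)" if "x \<in> tcar ?E" "y \<in> tcar ?E" for x y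
      unfolding NE_def using that by (simp add: E.T_add E.smul_add E.exch[of "tT ?E x" "tT ?E y"] del: dext_simps)
    then show ?case
      using Suc NE_closed[OF that(1)] NE_closed[OF that(2)] by simp
  qed (use that in simp)
  have NE_S: "(NE ^^ n) (tS ?E x) \<in> tS ?E ` tcar ?E" if "x \<in> tcar ?E" for x n
  proof (induction n)
    case (Suc n)
    then obtain y where y: "y \<in> tcar ?E" "(NE ^^ n) (tS ?E x) = tS ?E y" by auto
    \<comment> \<open>By \<open>frinv_power\<close> the scalar \<open>- \<theta>\<close> is the
      twist of its \<open>q\<close>-th power, so it can be moved to the right of \<sigma>.\<close>
    have "NE (tS ?E y) = tS ?E (tadd ?E (tT ?E y) (tsmul ?E ((- \<theta>) ^ q) y))"
      unfolding NE_def using y by (simp only: E.S_add E.S_smul E.T_S E.T_closed E.smul_closed frinv_power)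
    then show ?case
      using y by (simp del: dext_simps)
  qed (use that in auto)
  have "(NE ^^ (l + m)) x \<in> tS ?E ` tcar ?E" if x: "x \<in> tcar ?E" for x
  proof -
    have "snd ((NE ^^ m) x) = (NC ^^ m) (snd x)"
      unfolding NE_def NC_def by (rule tmor_iterate_shift[OF E p x])
    moreover have "(NC ^^ m) (snd x) \<in> tS C ` tcar C"
      using x by (intro m) auto
    ultimately obtain y where y: "y \<in> tcar C" "snd ((NE ^^ m) x) = tS C y"
      by auto
    define w where "w = fst ((NE ^^ m) x)"
    have w: "w \<in> tcar A"
      using NE_closed[OF x, of m] by (auto simp: w_def)
    \<comment> \<open>The element \<open>(0, y)\<close> lifts \<open>y\<close> to \<open>E\<close>,
      so the second summand lies in \<open>\<sigma> E\<close> and the first in the image of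
      \<open>A\<close>.\<close>
    have "(NE ^^ m) x = tadd ?E (w, tzero C) (tS ?E (tzero A, y))"
      using y w by (simp add: w_def prod_eq_iff)
    then have "(NE ^^ (l + m)) x = (NE ^^ l) (tadd ?E (w, tzero C) (tS ?E (tzero A, y)))"
      by (simp only: funpow_add comp_apply)
    also have "\<dots> = tadd ?E ((NE ^^ l) (w, tzero C)) ((NE ^^ l) (tS ?E (tzero A, y)))"
      using w y by (intro NE_add) auto
    finally have eq: "(NE ^^ (l + m)) x =
        tadd ?E ((NE ^^ l) (w, tzero C)) ((NE ^^ l) (tS ?E (tzero A, y)))" .
    have "(NE ^^ l) (w, tzero C) = ((NA ^^ l) w, tzero C)"
      unfolding NE_def NA_def by (rule tmor_iterate_shift(2)[OF A i w, symmetric])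
    moreover obtain v where "v \<in> tcar A" "(NA ^^ l) w = tS A v"
      using l[OF w] by auto
    ultimately have v: "(v, tzero C) \<in> tcar ?E" "(NE ^^ l) (w, tzero C) = tS ?E (v, tzero C)"
      by auto
    obtain v' where v': "v' \<in> tcar ?E" "(NE ^^ l) (tS ?E (tzero A, y)) = tS ?E v'"
      using NE_S[of "(tzero A, y)" l] y by auto
    show ?thesis
      unfolding eq v(2) v'(2) using v(1) v'(1)
      by (intro image_eqI[of _ _ "tadd ?E (v, tzero C) v'"]) (simp_all only: E.S_add E.add_closed)
  qed
  then show ?thesis
    unfolding dual_tmotive_def NE_def
    using E free_dext[OF A C f] mA mC by (auto simp: dual_tmotive_def ktsmod_def)
qed

text \<open>A morphism of extensions over \<open>g\<close> and \<open>h\<close>, the common form of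
  equivalence, pushout and pullback. For a pullback the arrow runs from the new extension to the old
  one.\<close>

definition emor :: "('k,'a) tmod \<Rightarrow> ('a \<Rightarrow> 'a2) \<Rightarrow> ('c \<Rightarrow> 'c2) \<Rightarrow>
    ('k,'e) tmod \<times> ('a \<Rightarrow> 'e) \<times> ('e \<Rightarrow> 'c) \<Rightarrow> ('k,'e2) tmod \<times> ('a2 \<Rightarrow> 'e2) \<times> ('e2 \<Rightarrow> 'c2) \<Rightarrow> bool" where
  "emor A g h X X' = (case X of (E,i,p) \<Rightarrow> case X' of (E',i',p') \<Rightarrow>
     (\<exists>\<psi>. tmor E E' \<psi> \<and> (\<forall>x\<in>tcar A. \<psi> (i x) = i' (g x)) \<and> (\<forall>y\<in>tcar E. p' (\<psi> y) = h (p y))))"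

abbreviation ext_hom :: "('k,'a) tmod \<Rightarrow> ('k,'e) tmod \<times> ('a \<Rightarrow> 'e) \<times> ('e \<Rightarrow> 'c) \<Rightarrow>
    ('k,'e2) tmod \<times> ('a \<Rightarrow> 'e2) \<times> ('e2 \<Rightarrow> 'c) \<Rightarrow> bool" where
  "ext_hom A \<equiv> emor A (\<lambda>a. a) (\<lambda>c. c)"

lemma ext_po_emor: "ext_po A g X X' = emor A g (\<lambda>c. c) X X'"
  by (simp add: ext_po_def emor_def)

lemma ext_pb_emor: "ext_pb A h X X' = emor A (\<lambda>a. a) h X' X"
  by (simp add: ext_pb_def emor_def split: prod.split)

lemma ext_rel_emor:
  "(X, X') \<in> ext_rel q \<theta> C A \<longleftrightarrow> X \<in> exts q \<theta> C A \<and> X' \<in> exts q \<theta> C A \<and> ext_hom A X X'"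
  by (cases X; cases X') (simp add: ext_rel_def emor_def)

lemma emor_trans:
  assumes "emor A g h X X'" "emor A' g' h' X' X''" and g: "\<And>x. x \<in> tcar A \<Longrightarrow> g x \<in> tcar A'"
  shows "emor A (\<lambda>x. g' (g x)) (\<lambda>x. h' (h x)) X X''"
proof -
  obtain E i p E' i' p' E'' i'' p'' where X: "X = (E,i,p)" "X' = (E',i',p')" "X'' = (E'',i'',p'')"
    by (metis prod_cases3)
  obtain u where u: "tmor E E' u" "\<forall>x\<in>tcar A. u (i x) = i' (g x)" "\<forall>y\<in>tcar E. p' (u y) = h (p y)"
    using assms(1) unfolding X emor_def by auto
  obtain v where v: "tmor E' E'' v" "\<forall>x\<in>tcar A'. v (i' x) = i'' (g' x)" "\<forall>y\<in>tcar E'. p'' (v y) = h' (p' y)"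
    using assms(2) unfolding X emor_def by auto
  have "u y \<in> tcar E'" if "y \<in> tcar E" for y
    using u(1) that by (simp add: tmor_def)
  then show ?thesis
    unfolding X emor_def
    by (auto intro!: exI[of _ "\<lambda>x. v (u x)"] tmor_comp[OF u(1) v(1)] simp: u v g)
qed

text \<open>A morphism of normal forms is triangular, \<open>(a, c) |-> (g a + k c, h c)\<close>,
  and its compatibility with \<open>t\<close> at \<open>(0, c)\<close> is the equation of
  \<open>coh\<close>. Special choices of \<open>g\<close> and \<open>h\<close> give the cocycles of
  pushouts, of pullbacks and of equivalent extensions.\<close>

lemma emor_dX_iff:
  assumes A: "ktsmod q A" and C: "ktsmod q C" and A': "ktsmod q A'" and C': "ktsmod q C'"
    and g: "tmor A A' g" and h: "tmor C C' h" and f: "kslin C A f" and f': "kslin C' A' f'"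
  shows "emor A g h (dX A C f) (dX A' C' f') \<longleftrightarrow> coh C A' (\<lambda>x. g (f x)) (\<lambda>x. f' (h x))"
proof -
  interpret A: ktsmod q A by fact
  interpret C: ktsmod q C by fact
  interpret A': ktsmod q A' by fact
  interpret C': ktsmod q C' by fact
  note gD = kslinD[OF tmor_kslin[OF g]] tmor_T[OF g] kslin_zero[OF A A' tmor_kslin[OF g]]
    and hD = kslinD[OF tmor_kslin[OF h]] tmor_T[OF h] kslin_zero[OF C C' tmor_kslin[OF h]]
    and fD = kslinD[OF f] kslin_zero[OF C A f] and f'D = kslinD[OF f'] kslin_zero[OF C' A' f']
  let ?E = "dext A C f" and ?E' = "dext A' C' f'"
  show ?thesis
  proof
    assume "emor A g h (dX A C f) (dX A' C' f')"
    then obtain u where u: "tmor ?E ?E' u" and ui: "\<And>x. x \<in> tcar A \<Longrightarrow> u (x, tzero C) = (g x, tzero C')"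
      and up: "\<And>y. y \<in> tcar ?E \<Longrightarrow> snd (u y) = h (snd y)"
      unfolding emor_def dX_def by auto
    note uD = kslinD[OF tmor_kslin[OF u]] tmor_T[OF u]
    \<comment> \<open>The corner entry of the triangular morphism; the other entries are
      prescribed.\<close>
    define k where "k = (\<lambda>c. fst (u (tzero A, c)))"
    have k_closed: "k c \<in> tcar A'" if "c \<in> tcar C" for c
      using uD(1)[of "(tzero A, c)"] that unfolding k_def by auto
    have uk: "u (tzero A, c) = (k c, h c)" if "c \<in> tcar C" for c
      using up[of "(tzero A, c)"] that by (simp add: k_def prod_eq_iff)
    have u_eq: "u (a, c) = (tadd A' (g a) (k c), h c)" if "a \<in> tcar A" "c \<in> tcar C" for a c
      using uD(2)[of "(a, tzero C)" "(tzero A, c)"] that by (simp add: ui uk hD)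
    have "kslin C A' k"
      unfolding kslin_def
    proof (intro conjI ballI allI)
      fix x assume x: "x \<in> tcar C"
      show "k x \<in> tcar A'" by (rule k_closed[OF x])
      show "k (tsmul C c x) = tsmul A' c (k x)" for c
        using uD(3)[of "(tzero A, x)" c] x by (simp add: uk)
      show "k (tS C x) = tS A' (k x)"
        using uD(4)[of "(tzero A, x)"] x by (simp add: uk)
      show "k (tadd C x y) = tadd A' (k x) (k y)" if "y \<in> tcar C" for y
        using uD(2)[of "(tzero A, x)" "(tzero A, y)"] x that by (simp add: uk)
    qed
    moreover have "tadd A' (g (f x)) (k (tT C x)) = tadd A' (tT A' (k x)) (f' (h x))" if "x \<in> tcar C" for x
      using uD(5)[of "(tzero A, x)"] that by (simp add: uk u_eq fD gD k_closed)
    ultimately show "coh C A' (\<lambda>x. g (f x)) (\<lambda>x. f' (h x))"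
      unfolding coh_def by auto
  next
    assume "coh C A' (\<lambda>x. g (f x)) (\<lambda>x. f' (h x))"
    then obtain k where k: "kslin C A' k"
      and eq: "\<And>x. x \<in> tcar C \<Longrightarrow> tadd A' (g (f x)) (k (tT C x)) = tadd A' (tT A' (k x)) (f' (h x))"
      unfolding coh_def by auto
    note kD = kslinD[OF k] kslin_zero[OF C A' k]
    define u where "u = (\<lambda>(a, c). (tadd A' (g a) (k c), h c))"
    \<comment> \<open>The first component of compatibility with \<open>t\<close> at a general
      \<open>(a, c)\<close>: the term in \<open>a\<close> is common to both sides, the rest is the
      cocycle equation.\<close>
    have "tadd A' (tadd A' (tT A' (g a)) (g (f c))) (k (tT C c)) =
        tadd A' (tadd A' (tT A' (g a)) (tT A' (k c))) (f' (h c))"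
      if "a \<in> tcar A" "c \<in> tcar C" for a c
      using that by (simp add: A'.assoc gD fD hD kD f'D eq)
    then have "tmor ?E ?E' u"
      unfolding tmor_def u_def
      by (auto simp: gD hD kD fD f'D A'.exch A'.smul_add A'.S_add A'.T_add)
    then show "emor A g h (dX A C f) (dX A' C' f')"
      unfolding emor_def dX_def
      by (auto intro!: exI[of _ u] simp: u_def gD hD kD)
  qed
qed

text \<open>In terms of the \<open>K{\<sigma>}\<close>-splitting \<open>s\<close>, the cocycle is \<open>f = i\<^sup>-\<^sup>1 (t s - s t)\<close>.\<close>
lemma (in motive_base) short_exact_cocycle:
  assumes A: "ktsmod q A" and E: "ktsmod q E" and C: "ktsmod q C" and free: "free_fg_Ksigma C"
    and ses: "short_exact A E C i p"
  obtains s r f where "kslin C E s" "kslin E A r" "\<And>y. y \<in> tcar C \<Longrightarrow> p (s y) = y"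
    "\<And>x. x \<in> tcar A \<Longrightarrow> r (i x) = x" "\<And>y. y \<in> tcar C \<Longrightarrow> r (s y) = tzero A"
    "\<And>x. x \<in> tcar E \<Longrightarrow> tadd E (i (r x)) (s (p x)) = x"
    "f \<in> acar (linM e C A)"
    "\<And>y. y \<in> tcar C \<Longrightarrow> tT E (s y) = tadd E (i (f y)) (s (tT C y))"
    "\<And>x. x \<in> tcar E \<Longrightarrow> r (tT E x) = tadd A (tT A (r x)) (f (p x))"
    "ext_hom A (E,i,p) (dX A C f)" "ext_hom A (dX A C f) (E,i,p)"
proof -
  interpret A: ktsmod q A by fact
  interpret E: ktsmod q E by fact
  interpret C: ktsmod q C by fact
  obtain s r where s: "kslin C E s" and r: "kslin E A r" and ps: "\<And>y. y \<in> tcar C \<Longrightarrow> p (s y) = y"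
    and ri: "\<And>x. x \<in> tcar A \<Longrightarrow> r (i x) = x" and rs: "\<And>y. y \<in> tcar C \<Longrightarrow> r (s y) = tzero A"
    and split: "\<And>x. x \<in> tcar E \<Longrightarrow> tadd E (i (r x)) (s (p x)) = x"
    using short_exact_split[OF A E C free ses frinv_sign(1)] by metis
  have i: "tmor A E i" and p: "tmor E C p" and pi: "\<And>x. x \<in> tcar A \<Longrightarrow> p (i x) = tzero C"
    using ses by (auto simp: short_exact_def)
  note iD = kslinD[OF tmor_kslin[OF i]] tmor_T[OF i] kslin_zero[OF A E tmor_kslin[OF i]]
    and pD = kslinD[OF tmor_kslin[OF p]] tmor_T[OF p] kslin_zero[OF E C tmor_kslin[OF p]]
    and sD = kslinD[OF s] kslin_zero[OF C E s] and rD = kslinD[OF r] kslin_zero[OF E A r]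
  define f where "f = (\<lambda>y\<in>tcar C. r (tT E (s y)))"
  have f: "f \<in> acar (linM e C A)"
    unfolding linM_simps f_def
    by (auto intro!: kslin_restrict[OF C] kslin_comp[OF kslin_comp[OF s kslin_T[OF E]] r])
  then have fD: "f x \<in> tcar A" if "x \<in> tcar C" for x
    using that by (auto simp: linM_simps kslin_def)
  have Ts: "tT E (s y) = tadd E (i (f y)) (s (tT C y))" if "y \<in> tcar C" for y
    using split[of "tT E (s y)"] that by (simp add: sD pD ps f_def)
  have rT: "r (tT E x) = tadd A (tT A (r x)) (f (p x))" if x: "x \<in> tcar E" for x
  proof -
    have "r (tT E x) = r (tT E (tadd E (i (r x)) (s (p x))))"
      using split[OF x] by simp
    also have "\<dots> = tadd A (tT A (r x)) (f (p x))"
      using x by (simp add: E.T_add iD sD pD rD fD flip: iD(5)) (simp add: ri rD pD f_def)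
    finally show ?thesis .
  qed
  have "tmor E (dext A C f) (\<lambda>x. (r x, p x))"
    by (auto simp: tmor_def rD pD rT)
  then have 1: "ext_hom A (E,i,p) (dX A C f)"
    unfolding emor_def dX_def by (auto intro!: exI[of _ "\<lambda>x. (r x, p x)"] simp: ri pi)
  let ?v = "\<lambda>(x, y). tadd E (i x) (s y)"
  have "tadd E (i (tadd A (tT A x) (f y))) (s (tT C y)) = tT E (tadd E (i x) (s y))"
    if "x \<in> tcar A" "y \<in> tcar C" for x y
    using that by (simp add: iD fD sD Ts E.T_add E.assoc)
  then have "tmor (dext A C f) E ?v"
    unfolding tmor_def by (auto simp: iD sD E.exch E.smul_add E.S_add)
  then have 2: "ext_hom A (dX A C f) (E,i,p)"
    unfolding emor_def dX_def by (auto intro!: exI[of _ ?v] simp: iD sD pD pi ps)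
  show ?thesis
    by (rule that[OF s r ps ri rs split f Ts rT 1 2])
qed

context motive_base
begin

lemma coh_sym:
  assumes A: "ktsmod q A" and C: "ktsmod q C"
    and cl: "\<And>x. x \<in> tcar C \<Longrightarrow> f x \<in> tcar A" "\<And>x. x \<in> tcar C \<Longrightarrow> g x \<in> tcar (A :: ('k,'a) tmod)"
    and "coh C A f g"
  shows "coh C A g f"
proof -
  interpret A: ktsmod q A by fact
  interpret C: ktsmod q C by fact
  obtain k where k: "kslin C A k"
    and eq: "\<And>x. x \<in> tcar C \<Longrightarrow> tadd A (f x) (k (tT C x)) = tadd A (tT A (k x)) (g x)"
    using assms(5) unfolding coh_def by auto
  note kD = kslinD(1)[OF k]
  have "tadd A (g x) (tsmul A (- 1) (k (tT C x))) = tadd A (tT A (tsmul A (- 1) (k x))) (f x)"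
    if x: "x \<in> tcar C" for x
  proof -
    have "g x = tadd A (tsmul A (- 1) (tT A (k x))) (tadd A (tT A (k x)) (g x))"
      using x cl kD by simp
    also have "\<dots> = tadd A (tadd A (tsmul A (- 1) (tT A (k x))) (f x)) (k (tT C x))"
      using x cl kD by (simp add: A.assoc flip: eq)
    finally show ?thesis
      using x cl kD by (simp add: A.diff_eq A.T_smul)
  qed
  then show ?thesis
    unfolding coh_def by (intro exI[of _ "\<lambda>x. tsmul A (- 1) (k x)"]) (auto intro!: kslin_neg[OF A k])
qed

text \<open>Since \<open>w * w = 1\<close>, replacing \<open>k\<close> by \<open>w k\<close> absorbs
  the factor in \<open>Dop w\<close>. The coboundaries are therefore the image of
  \<open>Dop w\<close> for either sign.\<close>

lemma coh_zero_iff_Dop: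
  assumes A: "ktsmod q A" and C: "ktsmod q C" and w: "w * w = (1 :: 'k)" "frinv q w = w"
    and f: "f \<in> acar (linM e C A)"
  shows "coh C A f (azero (linM e C A)) \<longleftrightarrow> f \<in> Dop w C A ` acar (linM e C A)"
proof -
  interpret A: ktsmod q A by fact
  interpret C: ktsmod q C by fact
  have ww: "tsmul A w (tsmul A w x) = x" if "x \<in> tcar A" for x
    using that by (simp add: A.smul_smul w)
  have neg_w: "tsmul A (- 1) (tsmul A w x) = tsmul A w (tsmul A (- 1) x)" if "x \<in> tcar A" for x
    using that by (simp add: A.smul_smul)
  have fcl: "f x \<in> tcar A" if "x \<in> tcar C" for x
    using f that by (auto simp: linM_simps kslin_def)
  show ?thesis
  proof
    assume "coh C A f (azero (linM e C A))"
    then obtain k where k: "kslin C A k"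
      and "\<forall>x\<in>tcar C. tadd A (f x) (k (tT C x)) = tadd A (tT A (k x)) (azero (linM e C A) x)"
      unfolding coh_def by auto
    moreover note kD = kslinD(1)[OF k]
    ultimately have eq: "tadd A (f x) (k (tT C x)) = tT A (k x)" if "x \<in> tcar C" for x
      using that by (simp add: linM_simps)
    let ?k = "\<lambda>x\<in>tcar C. tsmul A w (k x)"
    have "Dop w C A ?k x = f x" if x: "x \<in> tcar C" for x
    proof -
      have "Dop w C A ?k x = tadd A (tT A (k x)) (tsmul A (- 1) (k (tT C x)))"
        using x kD by (simp add: Dop_def A.T_smul A.smul_add ww neg_w)
      also have "\<dots> = f x"
        using x kD fcl by (simp add: A.diff_eq eq)
      finally show ?thesis .
    qed
    then have "f = Dop w C A ?k"
      using f by (auto simp: linM_simps Dop_def extensional_def fun_eq_iff)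
    moreover have "?k \<in> acar (linM e C A)"
      using kslin_restrict[OF C kslin_smul_sign[OF A k w(2)]] by (simp add: linM_simps)
    ultimately show "f \<in> Dop w C A ` acar (linM e C A)" by blast
  next
    assume "f \<in> Dop w C A ` acar (linM e C A)"
    then obtain k where fk: "f = Dop w C A k" and k: "kslin C A k"
      by (auto simp: linM_simps)
    note kD = kslinD(1)[OF k]
    have "tadd A (f x) (tsmul A w (k (tT C x))) = tadd A (tT A (tsmul A w (k x))) (azero (linM e C A) x)"
      if "x \<in> tcar C" for x
    proof -
      have "tadd A (f x) (tsmul A w (k (tT C x))) =
          tsmul A w (tadd A (tadd A (tT A (k x)) (tsmul A (- 1) (k (tT C x)))) (k (tT C x)))"
        using that kD by (simp add: fk Dop_def A.smul_add)
      also have "tadd A (tadd A (tT A (k x)) (tsmul A (- 1) (k (tT C x)))) (k (tT C x)) = tT A (k x)"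
        using that kD by (simp add: A.assoc)
      finally show ?thesis
        using that kD by (simp add: linM_simps A.T_smul)
    qed
    then show "coh C A f (azero (linM e C A))"
      unfolding coh_def using kslin_smul_sign[OF A k w(2)] by blast
  qed
qed

end

section \<open>Extension classes\<close>

definition cls :: "nat \<Rightarrow> 'k::field \<Rightarrow> ('k,'c) tmod \<Rightarrow> ('k,'a) tmod \<Rightarrow> ('c \<Rightarrow> 'a) \<Rightarrow> ('k,'a,'c) ext set" where
  "cls q \<theta> C A f = ext_rel q \<theta> C A `` {dX A C f}"

lemma dual_tmotive_ktsmod: "dual_tmotive q \<theta> H \<Longrightarrow> ktsmod q H"
  and dual_tmotive_free: "dual_tmotive q \<theta> H \<Longrightarrow> free_fg_Ksigma H"
  by (simp_all add: dual_tmotive_def ktsmod_def)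

context motive_base
begin

lemma linM_closed: "f \<in> acar (linM e C A) \<Longrightarrow> x \<in> tcar C \<Longrightarrow> f x \<in> tcar A"
  by (auto simp: linM_simps kslin_def)

lemma azero_linM: "ktsmod q H \<Longrightarrow> ktsmod q H' \<Longrightarrow> azero (linM e H H') \<in> acar (linM e H H')"
  by (simp add: linM_simps kslin_restrict kslin_const_zero)

lemma dX_exts:
  assumes "dual_tmotive q \<theta> A" "dual_tmotive q \<theta> C" "f \<in> acar (linM e C A)"
  shows "dX A C f \<in> exts q \<theta> C A"
  using assms dual_tmotive_dext[OF assms(1,2)] short_exact_dext[of q A C f]
  by (simp add: exts_def dX_def linM_simps dual_tmotive_ktsmod)

lemma ext_hom_dX_iff:
  assumes A: "dual_tmotive q \<theta> A" and C: "dual_tmotive q \<theta> C"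
    and f: "f \<in> acar (linM e C A)" and g: "g \<in> acar (linM e C A)"
  shows "ext_hom A (dX A C f) (dX A C g) \<longleftrightarrow> coh C A f g"
  using emor_dX_iff[OF dual_tmotive_ktsmod[OF A] dual_tmotive_ktsmod[OF C] dual_tmotive_ktsmod[OF A]
      dual_tmotive_ktsmod[OF C] tmor_id tmor_id] f g
  by (simp add: linM_simps)

text \<open>Morphisms in both directions are recorded, because the symmetry of
  \<open>ext_hom\<close> is itself derived from this.\<close>

lemma exts_normal:
  assumes A: "dual_tmotive q \<theta> A" and C: "dual_tmotive q \<theta> C" and X: "X \<in> exts q \<theta> C A"
  obtains f where "f \<in> acar (linM e C A)" "ext_hom A X (dX A C f)" "ext_hom A (dX A C f) X"
proof -
  obtain E i p where X': "X = (E,i,p)" "dual_tmotive q \<theta> E" "short_exact A E C i p"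
    using X by (auto simp: exts_def)
  show ?thesis
    using short_exact_cocycle[OF dual_tmotive_ktsmod[OF A] dual_tmotive_ktsmod[OF X'(2)]
        dual_tmotive_ktsmod[OF C] dual_tmotive_free[OF C] X'(3)] that unfolding X' by metis
qed

lemma ext_hom_trans: "\<lbrakk>ext_hom A X Y; ext_hom A Y Z\<rbrakk> \<Longrightarrow> ext_hom A X Z"
  by (drule (1) emor_trans) auto

text \<open>\<open>ext_rel\<close> asks for a morphism, not for an isomorphism. Instead of inverting
  it, the passage to normal forms reduces the claim to \<open>coh_sym\<close>, where
  \<open>k\<close> becomes \<open>- k\<close>.\<close>

lemma ext_hom_sym:
  assumes A: "dual_tmotive q \<theta> A" and C: "dual_tmotive q \<theta> C" and X: "X \<in> exts q \<theta> C A"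
    and Y: "Y \<in> exts q \<theta> C A" and XY: "ext_hom A X Y"
  shows "ext_hom A Y X"
proof -
  obtain f where f: "f \<in> acar (linM e C A)" "ext_hom A X (dX A C f)" "ext_hom A (dX A C f) X"
    by (rule exts_normal[OF A C X])
  obtain g where g: "g \<in> acar (linM e C A)" "ext_hom A Y (dX A C g)" "ext_hom A (dX A C g) Y"
    by (rule exts_normal[OF A C Y])
  have "ext_hom A (dX A C f) (dX A C g)"
    using ext_hom_trans f g XY by blast
  then have "ext_hom A (dX A C g) (dX A C f)"
    using f g by (simp add: ext_hom_dX_iff[OF A C] coh_sym[OF dual_tmotive_ktsmod[OF A]
      dual_tmotive_ktsmod[OF C]] linM_closed)
  then show ?thesis
    using ext_hom_trans f g by blast
qed

lemma ext_hom_refl: "ext_hom A X X"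
  unfolding emor_def by (auto split: prod.split intro!: exI[of _ "\<lambda>x. x"] tmor_id)

lemma equiv_ext_rel:
  assumes A: "dual_tmotive q \<theta> A" and C: "dual_tmotive q \<theta> C"
  shows "equiv (exts q \<theta> C A) (ext_rel q \<theta> C A)"
proof (rule equivI)
  show "ext_rel q \<theta> C A \<subseteq> exts q \<theta> C A \<times> exts q \<theta> C A"
    by (auto simp: ext_rel_def)
  show "refl_on (exts q \<theta> C A) (ext_rel q \<theta> C A)"
    by (auto simp: refl_on_def ext_rel_emor ext_hom_refl)
  show "sym (ext_rel q \<theta> C A)"
    unfolding sym_def ext_rel_emor using ext_hom_sym[OF A C] by blast
  show "trans (ext_rel q \<theta> C A)"
    unfolding trans_def ext_rel_emor using ext_hom_trans by blast
qed

lemma cls_eq_iff: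
  assumes A: "dual_tmotive q \<theta> A" and C: "dual_tmotive q \<theta> C"
    and f: "f \<in> acar (linM e C A)" and g: "g \<in> acar (linM e C A)"
  shows "cls q \<theta> C A f = cls q \<theta> C A g \<longleftrightarrow> coh C A f g"
  unfolding cls_def eq_equiv_class_iff[OF equiv_ext_rel[OF A C] dX_exts[OF A C f] dX_exts[OF A C g]]
  by (simp add: ext_rel_emor dX_exts[OF A C] f g ext_hom_dX_iff[OF A C])

lemma in_cls_iff:
  assumes A: "dual_tmotive q \<theta> A" and C: "dual_tmotive q \<theta> C" and f: "f \<in> acar (linM e C A)"
  shows "X \<in> cls q \<theta> C A f \<longleftrightarrow> X \<in> exts q \<theta> C A \<and> ext_hom A (dX A C f) X"
  by (simp add: cls_def ext_rel_emor dX_exts[OF A C f])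

lemma dX_in_cls:
  assumes A: "dual_tmotive q \<theta> A" and C: "dual_tmotive q \<theta> C" and f: "f \<in> acar (linM e C A)"
  shows "dX A C f \<in> cls q \<theta> C A f"
  by (simp add: in_cls_iff[OF assms] dX_exts[OF A C f] ext_hom_refl)

lemma in_clsD:
  assumes A: "dual_tmotive q \<theta> A" and C: "dual_tmotive q \<theta> C" and f: "f \<in> acar (linM e C A)"
    and X: "X \<in> cls q \<theta> C A f"
  shows "ext_hom A (dX A C f) X" "ext_hom A X (dX A C f)"
  using X dX_exts[OF A C f] ext_hom_sym[OF A C] by (auto simp: in_cls_iff[OF A C f])

lemma Ext1_eq:
  assumes A: "dual_tmotive q \<theta> A" and C: "dual_tmotive q \<theta> C"
  shows "Ext1 q \<theta> C A = cls q \<theta> C A ` acar (linM e C A)"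
proof (intro set_eqI iffI)
  fix c assume "c \<in> Ext1 q \<theta> C A"
  then obtain X where X: "X \<in> exts q \<theta> C A" "c = ext_rel q \<theta> C A `` {X}"
    by (auto simp: Ext1_def elim: quotientE)
  obtain f where f: "f \<in> acar (linM e C A)" "ext_hom A X (dX A C f)"
    by (rule exts_normal[OF A C X(1)])
  have "(X, dX A C f) \<in> ext_rel q \<theta> C A"
    by (simp add: ext_rel_emor X f dX_exts[OF A C])
  then have "c = cls q \<theta> C A f"
    unfolding cls_def X(2) by (rule equiv_class_eq[OF equiv_ext_rel[OF A C]])
  then show "c \<in> cls q \<theta> C A ` acar (linM e C A)"
    using f by blast
qed (auto simp: Ext1_def cls_def intro!: quotientI dX_exts[OF A C])

text \<open>Operations on \<open>Ext1\<close> are definite descriptions of classes. As every class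
  is some \<open>cls q \<theta> C A f\<close>, a description is evaluated by one cocycle with the
  property and uniqueness up to \<open>coh\<close>.\<close>

lemma The_cls:
  assumes A: "dual_tmotive q \<theta> A" and C: "dual_tmotive q \<theta> C" and f: "f \<in> acar (linM e C A)"
    and P: "P (cls q \<theta> C A f)"
    and uniq: "\<And>g. \<lbrakk>g \<in> acar (linM e C A); P (cls q \<theta> C A g)\<rbrakk> \<Longrightarrow> coh C A f g"
  shows "(THE c. c \<in> Ext1 q \<theta> C A \<and> P c) = cls q \<theta> C A f"
proof (rule the_equality)
  fix c assume "c \<in> Ext1 q \<theta> C A \<and> P c"
  then obtain g where "g \<in> acar (linM e C A)" "c = cls q \<theta> C A g" "P c"
    unfolding Ext1_eq[OF A C] by auto
  then show "c = cls q \<theta> C A f"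
    using uniq[of g] cls_eq_iff[OF A C f, of g] by (simp only: simp_thms)
qed (use P f in \<open>simp add: Ext1_eq[OF A C]\<close>)

section \<open>Pushouts, pullbacks and connecting maps on classes\<close>

lemma comp_in_linM:
  assumes "ktsmod q B" "kslin B C h" "kslin C A g"
  shows "(\<lambda>x\<in>tcar B. g (h x)) \<in> acar (linM e B A)"
  using assms kslin_comp[OF assms(2,3)] by (auto simp: linM_simps intro!: kslin_restrict)

text \<open>On cocycles a pushout is composition on the left, by \<open>emor_dX_iff\<close> with the
  identity on \<open>C\<close>.\<close>

lemma ext_push_cls:
  assumes A: "dual_tmotive q \<theta> A" and C: "dual_tmotive q \<theta> C" and A': "dual_tmotive q \<theta> A'"
    and g: "tmor A A' g" and f: "f \<in> acar (linM e C A)"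
  shows "ext_push q \<theta> C A A' g (cls q \<theta> C A f) = cls q \<theta> C A' (\<lambda>x\<in>tcar C. g (f x))"
proof -
  note kA = dual_tmotive_ktsmod[OF A] and kC = dual_tmotive_ktsmod[OF C] and kA' = dual_tmotive_ktsmod[OF A']
  let ?h = "\<lambda>x\<in>tcar C. g (f x)"
  have h: "?h \<in> acar (linM e C A')"
    using f by (intro comp_in_linM[OF kC _ tmor_kslin[OF g]]) (simp add: linM_simps)
  have iff: "emor A g (\<lambda>c. c) (dX A C f) (dX A' C k) \<longleftrightarrow> coh C A' ?h k" if "k \<in> acar (linM e C A')" for k
    using emor_dX_iff[OF kA kC kA' kC g tmor_id, of f k] f that coh_cong[OF kC, of "\<lambda>x. g (f x)" ?h k k]
    by (simp add: linM_simps)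
  show ?thesis
    unfolding ext_push_def ext_po_emor
  proof (rule The_cls[OF A' C h])
    show "\<exists>X\<in>cls q \<theta> C A f. \<exists>X'\<in>cls q \<theta> C A' ?h. emor A g (\<lambda>c. c) X X'"
      using iff[OF h] coh_refl[OF kA'] linM_closed[OF h] dX_in_cls[OF A C f] dX_in_cls[OF A' C h] by blast
    fix k assume k: "k \<in> acar (linM e C A')"
      and "\<exists>X\<in>cls q \<theta> C A f. \<exists>X'\<in>cls q \<theta> C A' k. emor A g (\<lambda>c. c) X X'"
    then obtain X X' where X: "X \<in> cls q \<theta> C A f" "X' \<in> cls q \<theta> C A' k" "emor A g (\<lambda>c. c) X X'"
      by blast
    \<comment> \<open>Composing with equivalences on both sides replaces arbitrary representatives
      by normal forms.\<close>
    have "emor A g (\<lambda>c. c) (dX A C f) X'"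
      using emor_trans[OF in_clsD(1)[OF A C f X(1)] X(3)] by simp
    from emor_trans[OF this in_clsD(2)[OF A' C k X(2)]] show "coh C A' ?h k"
      using g by (simp add: iff[OF k] tmor_def)
  qed
qed

text \<open>A set \<open>Y\<close> of extensions covers two uses at once: a whole class for
  \<open>ext_pull\<close>, and for \<open>delta_cov\<close> the single given sequence, whose middle
  term need not live on the product type.\<close>

lemma ext_pb_cls:
  assumes A: "dual_tmotive q \<theta> A" and C: "dual_tmotive q \<theta> C" and C': "dual_tmotive q \<theta> C'"
    and h: "tmor C' C h" and f: "f \<in> acar (linM e C A)"
    and Y: "Y \<noteq> {}" "\<And>X. X \<in> Y \<Longrightarrow> ext_hom A X (dX A C f)" "\<And>X. X \<in> Y \<Longrightarrow> ext_hom A (dX A C f) X"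
  shows "(THE c'. c' \<in> Ext1 q \<theta> C' A \<and> (\<exists>X\<in>Y. \<exists>X'\<in>c'. ext_pb A h X X'))
    = cls q \<theta> C' A (\<lambda>x\<in>tcar C'. f (h x))"
proof -
  note kA = dual_tmotive_ktsmod[OF A] and kC = dual_tmotive_ktsmod[OF C] and kC' = dual_tmotive_ktsmod[OF C']
  let ?g = "\<lambda>x\<in>tcar C'. f (h x)"
  have g: "?g \<in> acar (linM e C' A)"
    using f by (intro comp_in_linM[OF kC' tmor_kslin[OF h]]) (simp add: linM_simps)
  \<comment> \<open>The arrow of a pullback ends at the old extension, so it gives
    \<open>coh\<close> from \<open>k\<close> to \<open>?g\<close>; symmetry turns this into the form
    that \<open>The_cls\<close> expects.\<close>
  have iff: "emor A (\<lambda>a. a) h (dX A C' k) (dX A C f) \<longleftrightarrow> coh C' A ?g k" if k: "k \<in> acar (linM e C' A)" for k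
  proof -
    have "emor A (\<lambda>a. a) h (dX A C' k) (dX A C f) \<longleftrightarrow> coh C' A k ?g"
      using emor_dX_iff[OF kA kC' kA kC tmor_id h, of k f] f k coh_cong[OF kC', of k k "\<lambda>x. f (h x)" ?g]
      by (simp add: linM_simps)
    then show ?thesis
      using coh_sym[OF kA kC', of k ?g] coh_sym[OF kA kC', of ?g k] linM_closed[OF g] linM_closed[OF k] by blast
  qed
  show ?thesis
    unfolding ext_pb_emor
  proof (rule The_cls[OF A C' g])
    obtain X where X: "X \<in> Y" using Y(1) by blast
    have "emor A (\<lambda>a. a) h (dX A C' ?g) (dX A C f)"
      using iff[OF g] coh_refl[OF kA] linM_closed[OF g] by blast
    from emor_trans[OF this Y(3)[OF X]] have "emor A (\<lambda>a. a) h (dX A C' ?g) X"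
      by simp
    then show "\<exists>X\<in>Y. \<exists>X'\<in>cls q \<theta> C' A ?g. emor A (\<lambda>a. a) h X' X"
      using X dX_in_cls[OF A C' g] by blast
    fix k assume k: "k \<in> acar (linM e C' A)"
      and "\<exists>X\<in>Y. \<exists>X'\<in>cls q \<theta> C' A k. emor A (\<lambda>a. a) h X' X"
    then obtain X X' where X: "X \<in> Y" "X' \<in> cls q \<theta> C' A k" "emor A (\<lambda>a. a) h X' X"
      by blast
    have "emor A (\<lambda>a. a) h (dX A C' k) X"
      using emor_trans[OF in_clsD(1)[OF A C' k X(2)] X(3)] by simp
    from emor_trans[OF this Y(2)[OF X(1)]] show "coh C' A ?g k"
      by (simp add: iff[OF k])
  qed
qed

lemma ext_pull_cls:
  assumes A: "dual_tmotive q \<theta> A" and C: "dual_tmotive q \<theta> C" and C': "dual_tmotive q \<theta> C'"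
    and h: "tmor C' C h" and f: "f \<in> acar (linM e C A)"
  shows "ext_pull q \<theta> C' A h (cls q \<theta> C A f) = cls q \<theta> C' A (\<lambda>x\<in>tcar C'. f (h x))"
  unfolding ext_pull_def
  by (rule ext_pb_cls[OF A C C' h f]) (use dX_in_cls[OF A C f] in_clsD[OF A C f] in auto)

lemma delta_cov_cls:
  assumes A: "dual_tmotive q \<theta> A" and C: "dual_tmotive q \<theta> C" and N: "dual_tmotive q \<theta> N"
    and h: "tmor N C h" and f: "f \<in> acar (linM e C A)"
    and X: "ext_hom A X (dX A C f)" "ext_hom A (dX A C f) X"
  shows "delta_cov q \<theta> N A X h = cls q \<theta> N A (\<lambda>x\<in>tcar N. f (h x))"
  using ext_pb_cls[OF A C N h f, of "{X}"] X unfolding delta_cov_def by simp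

text \<open>The given sequence may have a middle term of another type and so lie in no class.
  Composing with its morphisms to and from the normal form shows that it has the same pushouts as
  the class of \<open>f\<close>.\<close>

lemma delta_con_cls:
  fixes A :: "('k,'a) tmod" and C :: "('k,'c) tmod" and A' :: "('k,'a2) tmod"
  assumes A: "dual_tmotive q \<theta> A" and C: "dual_tmotive q \<theta> C" and A': "dual_tmotive q \<theta> A'"
    and g: "tmor A A' g" and f: "f \<in> acar (linM e C A)"
    and X: "ext_hom A X (dX A C f)" "ext_hom A (dX A C f) X"
  shows "delta_con q \<theta> C A A' X g = cls q \<theta> C A' (\<lambda>x\<in>tcar C. g (f x))"
proof -
  have "(\<exists>X'\<in>c. ext_po A g X X') \<longleftrightarrow> (\<exists>Y\<in>cls q \<theta> C A f. \<exists>X'\<in>c. ext_po A g Y X')"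
    for c :: "('k,'a2,'c) ext set"
  proof
    assume "\<exists>X'\<in>c. ext_po A g X X'"
    then obtain X' where "X' \<in> c" "emor A g (\<lambda>c. c) X X'"
      by (auto simp: ext_po_emor)
    moreover from emor_trans[OF X(2) this(2)] have "ext_po A g (dX A C f) X'"
      by (simp add: ext_po_emor)
    ultimately show "\<exists>Y\<in>cls q \<theta> C A f. \<exists>X'\<in>c. ext_po A g Y X'"
      using dX_in_cls[OF A C f] by blast
  next
    assume "\<exists>Y\<in>cls q \<theta> C A f. \<exists>X'\<in>c. ext_po A g Y X'"
    then obtain Y X' where Y: "Y \<in> cls q \<theta> C A f" "X' \<in> c" "emor A g (\<lambda>c. c) Y X'"
      by (auto simp: ext_po_emor)
    from emor_trans[OF ext_hom_trans[OF X(1) in_clsD(1)[OF A C f Y(1)]] Y(3)]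
    show "\<exists>X'\<in>c. ext_po A g X X'"
      using Y(2) by (auto simp: ext_po_emor)
  qed
  then show ?thesis
    using ext_push_cls[OF A C A' g f] by (simp add: delta_con_def ext_push_def)
qed

section \<open>Baer sum and split extensions\<close>

lemma ext_baer_trans:
  assumes "ext_baer A X1 X2 X3" "ext_hom A Y1 X1" "ext_hom A Y2 X2" "ext_hom A X3 Y3"
    and A: "ktsmod q A"
  shows "ext_baer A Y1 Y2 Y3"
proof -
  interpret ktsmod q A by fact
  obtain E1 i1 p1 E2 i2 p2 E3 i3 p3 where X: "X1 = (E1,i1,p1)" "X2 = (E2,i2,p2)" "X3 = (E3,i3,p3)"
    by (metis prod_cases3)
  obtain F1 j1 r1 F2 j2 r2 F3 j3 r3 where Y: "Y1 = (F1,j1,r1)" "Y2 = (F2,j2,r2)" "Y3 = (F3,j3,r3)"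
    by (metis prod_cases3)
  obtain u where u: "tmor (pbmod E1 p1 E2 p2) E3 u"
      "\<forall>x\<in>tcar A. \<forall>y\<in>tcar A. u (i1 x, i2 y) = i3 (tadd A x y)"
      "\<forall>z\<in>tcar (pbmod E1 p1 E2 p2). p3 (u z) = p1 (fst z)"
    using assms(1) unfolding X ext_baer_def by auto
  obtain v1 where v1: "tmor F1 E1 v1" "\<forall>x\<in>tcar A. v1 (j1 x) = i1 x" "\<forall>y\<in>tcar F1. p1 (v1 y) = r1 y"
    using assms(2) unfolding X Y emor_def by auto
  obtain v2 where v2: "tmor F2 E2 v2" "\<forall>x\<in>tcar A. v2 (j2 x) = i2 x" "\<forall>y\<in>tcar F2. p2 (v2 y) = r2 y"
    using assms(3) unfolding X Y emor_def by auto
  obtain v3 where v3: "tmor E3 F3 v3" "\<forall>x\<in>tcar A. v3 (i3 x) = j3 x" "\<forall>y\<in>tcar E3. r3 (v3 y) = p3 y"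
    using assms(4) unfolding X Y emor_def by auto
  have v: "tmor (pbmod F1 r1 F2 r2) (pbmod E1 p1 E2 p2) (map_prod v1 v2)"
    using v1 v2 by (auto simp: tmor_def pbmod_def)
  note uv = tmor_comp[OF v u(1)]
  have cl: "map_prod v1 v2 z \<in> tcar (pbmod E1 p1 E2 p2)" "u (map_prod v1 v2 z) \<in> tcar E3"
    if "z \<in> tcar (pbmod F1 r1 F2 r2)" for z
    using that v uv by (auto simp: tmor_def)
  have fst: "fst z \<in> tcar F1" if "z \<in> tcar (pbmod F1 r1 F2 r2)" for z
    using that by (auto simp: pbmod_def)
  show ?thesis
    unfolding Y ext_baer_def prod.case
  proof (intro exI conjI ballI)
    show "tmor (pbmod F1 r1 F2 r2) F3 (\<lambda>z. v3 (u (map_prod v1 v2 z)))"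
      by (rule tmor_comp[OF uv v3(1)])
  qed (use cl fst v1 v2 v3 u in \<open>auto simp: add_closed\<close>)
qed

text \<open>A Baer map sends \<open>((a, c), (b, c))\<close> to \<open>(a + b + k c, c)\<close>. Its
  compatibility with \<open>t\<close> on the diagonal copy of \<open>C\<close> says that
  \<open>f + g\<close> and \<open>h\<close> differ by the coboundary of \<open>k\<close>.\<close>

lemma baer_dX_iff:
  fixes A :: "('k,'a) tmod" and C :: "('k,'c) tmod"
  assumes A: "dual_tmotive q \<theta> A" and C: "dual_tmotive q \<theta> C"
    and f: "f \<in> acar (linM e C A)" and g: "g \<in> acar (linM e C A)" and h: "h \<in> acar (linM e C A)"
  shows "ext_baer A (dX A C f) (dX A C g) (dX A C h) \<longleftrightarrow> coh C A (aadd (linM e C A) f g) h"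
proof -
  note kA = dual_tmotive_ktsmod[OF A] and kC = dual_tmotive_ktsmod[OF C]
  interpret A: ktsmod q A by fact
  interpret C: ktsmod q C by fact
  have kf: "kslin C A f" and kg: "kslin C A g" and kh: "kslin C A h"
    using f g h by (auto simp: linM_simps)
  note fD = kslinD[OF kf] kslin_zero[OF kC kA kf] and gD = kslinD[OF kg] kslin_zero[OF kC kA kg]
    and hD = kslinD[OF kh] kslin_zero[OF kC kA kh]
  let ?P = "pbmod (dext A C f) snd (dext A C g) snd" and ?E = "dext A C h"
  have P: "((a,c),(b,c')) \<in> tcar ?P \<longleftrightarrow> a \<in> tcar A \<and> b \<in> tcar A \<and> c \<in> tcar C \<and> c' = c" for a b c c'
    by (auto simp: pbmod_def)
  have Pop: "tadd ?P (x,y) (x',y') = (tadd (dext A C f) x x', tadd (dext A C g) y y')"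
    "tsmul ?P k (x,y) = (tsmul (dext A C f) k x, tsmul (dext A C g) k y)"
    "tT ?P (x,y) = (tT (dext A C f) x, tT (dext A C g) y)"
    "tS ?P (x,y) = (tS (dext A C f) x, tS (dext A C g) y)" for x x' y y' k
    by (simp_all add: pbmod_def)
  show ?thesis
  proof
    assume "ext_baer A (dX A C f) (dX A C g) (dX A C h)"
    then obtain u where u: "tmor ?P ?E u"
      and ui: "\<And>x y. \<lbrakk>x \<in> tcar A; y \<in> tcar A\<rbrakk> \<Longrightarrow> u ((x, tzero C), (y, tzero C)) = (tadd A x y, tzero C)"
      and up: "\<And>z. z \<in> tcar ?P \<Longrightarrow> snd (u z) = snd (fst z)"
      unfolding dX_def ext_baer_def by auto
    note uD = kslinD[OF tmor_kslin[OF u]] tmor_T[OF u]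
    \<comment> \<open>The corner entry again, read off along the diagonal copy of \<open>C\<close>
      in the fibre product.\<close>
    define k where "k = (\<lambda>c. fst (u ((tzero A, c), (tzero A, c))))"
    have k_closed: "k c \<in> tcar A" if "c \<in> tcar C" for c
      using uD(1)[of "((tzero A, c), (tzero A, c))"] that unfolding k_def by (auto simp: P)
    have uk: "u ((tzero A, c), (tzero A, c)) = (k c, c)" if "c \<in> tcar C" for c
      using up[of "((tzero A, c), (tzero A, c))"] that by (simp add: k_def prod_eq_iff P)
    have u_eq: "u ((a, c), (b, c)) = (tadd A (tadd A a b) (k c), c)"
      if "a \<in> tcar A" "b \<in> tcar A" "c \<in> tcar C" for a b c
      using uD(2)[of "((a, tzero C), (b, tzero C))" "((tzero A, c), (tzero A, c))"] that
      by (simp add: ui uk P Pop)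
    have "kslin C A k"
      unfolding kslin_def
    proof (intro conjI ballI allI)
      fix x assume x: "x \<in> tcar C"
      show "k x \<in> tcar A" by (rule k_closed[OF x])
      show "k (tsmul C c x) = tsmul A c (k x)" for c
        using uD(3)[of "((tzero A, x), (tzero A, x))" c] x by (simp add: uk P Pop)
      show "k (tS C x) = tS A (k x)"
        using uD(4)[of "((tzero A, x), (tzero A, x))"] x by (simp add: uk P Pop)
      show "k (tadd C x y) = tadd A (k x) (k y)" if "y \<in> tcar C" for y
        using uD(2)[of "((tzero A, x), (tzero A, x))" "((tzero A, y), (tzero A, y))"] x that
        by (simp add: uk P Pop)
    qed
    moreover have "tadd A (tadd A (f x) (g x)) (k (tT C x)) = tadd A (tT A (k x)) (h x)" if "x \<in> tcar C" for x
      using uD(5)[of "((tzero A, x), (tzero A, x))"] that by (simp add: uk u_eq fD gD k_closed P Pop)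
    ultimately show "coh C A (aadd (linM e C A) f g) h"
      unfolding coh_def by (auto simp: linM_simps)
  next
    assume "coh C A (aadd (linM e C A) f g) h"
    then obtain k where k: "kslin C A k"
      and eq: "\<And>x. x \<in> tcar C \<Longrightarrow> tadd A (tadd A (f x) (g x)) (k (tT C x)) = tadd A (tT A (k x)) (h x)"
      unfolding coh_def by (auto simp: linM_simps)
    note kD = kslinD[OF k] kslin_zero[OF kC kA k]
    \<comment> \<open>On the fibre product \<open>c' = c\<close>, so one copy of the component in
      \<open>C\<close> suffices.\<close>
    define u where "u = (\<lambda>((a, c), (b, c' :: 'c)). (tadd A (tadd A a b) (k c), c :: 'c))"
    have T: "tadd A (tadd A (tadd A (tT A a) (f c)) (tadd A (tT A b) (g c))) (k (tT C c)) =
        tadd A (tadd A (tadd A (tT A a) (tT A b)) (tT A (k c))) (h c)"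
      if "a \<in> tcar A" "b \<in> tcar A" "c \<in> tcar C" for a b c
    proof -
      have "tadd A (tadd A (tadd A (tT A a) (f c)) (tadd A (tT A b) (g c))) (k (tT C c))
        = tadd A (tadd A (tT A a) (tT A b)) (tadd A (tadd A (f c) (g c)) (k (tT C c)))"
        using that fD(1) gD(1) kD(1) by (simp add: A.ac)
      also have "\<dots> = tadd A (tadd A (tT A a) (tT A b)) (tadd A (tT A (k c)) (h c))"
        using that by (simp only: eq)
      also have "\<dots> = tadd A (tadd A (tadd A (tT A a) (tT A b)) (tT A (k c))) (h c)"
        using that hD kD by (simp add: A.assoc)
      finally show ?thesis .
    qed
    have add: "tadd A (tadd A (tadd A a a') (tadd A b b')) (tadd A (k c) (k c')) =
       tadd A (tadd A (tadd A a b) (k c)) (tadd A (tadd A a' b') (k c'))"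
      if "a \<in> tcar A" "b \<in> tcar A" "a' \<in> tcar A" "b' \<in> tcar A" "c \<in> tcar C" "c' \<in> tcar C" for a b a' b' c c'
      using that kD by (simp add: A.exch[of a a'] A.exch[of "tadd A a b" "tadd A a' b'"])
    have "tmor ?P ?E u"
      unfolding tmor_def
      by (auto simp: P Pop u_def kD fD gD A.smul_add A.S_add A.T_add T add)
    then show "ext_baer A (dX A C f) (dX A C g) (dX A C h)"
      unfolding dX_def ext_baer_def prod.case
      by (intro exI[of _ u]) (auto simp: P u_def kD)
  qed
qed

text \<open>A section has the form \<open>y |-> (k y, y)\<close>, and it commutes with
  \<open>t\<close> exactly if \<open>t k + f = k t\<close>, which makes \<open>f\<close> a
  coboundary.\<close>

lemma split_dX_iff:
  assumes A: "dual_tmotive q \<theta> A" and C: "dual_tmotive q \<theta> C" and f: "f \<in> acar (linM e C A)"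
  shows "ext_split C (dX A C f) \<longleftrightarrow> coh C A f (azero (linM e C A))"
proof -
  note kA = dual_tmotive_ktsmod[OF A] and kC = dual_tmotive_ktsmod[OF C]
  interpret A: ktsmod q A by fact
  interpret C: ktsmod q C by fact
  note fcl = linM_closed[OF f]
  have "ext_split C (dX A C f) \<longleftrightarrow> (\<exists>k. kslin C A k \<and>
     (\<forall>x\<in>tcar C. tadd A (tT A (k x)) (f x) = k (tT C x)))"
  proof
    assume "ext_split C (dX A C f)"
    then obtain u where u: "tmor C (dext A C f) u" "\<And>y. y \<in> tcar C \<Longrightarrow> snd (u y) = y"
      unfolding ext_split_def dX_def by auto
    have u_eq: "u y = (fst (u y), y)" if "y \<in> tcar C" for y
      using u(2)[OF that] by (simp add: prod_eq_iff)
    note uD = kslinD[OF tmor_kslin[OF u(1)]] tmor_T[OF u(1)]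
    have "kslin C A (\<lambda>y. fst (u y))"
      unfolding kslin_def
    proof (intro conjI ballI allI)
      fix x assume x: "x \<in> tcar C"
      show "fst (u x) \<in> tcar A" using uD(1)[OF x] by auto
      show "fst (u (tsmul C c x)) = tsmul A c (fst (u x))" for c
        unfolding uD(3)[OF x] by (subst u_eq[OF x]) simp
      show "fst (u (tS C x)) = tS A (fst (u x))"
        unfolding uD(4)[OF x] by (subst u_eq[OF x]) simp
      show "fst (u (tadd C x y)) = tadd A (fst (u x)) (fst (u y))" if y: "y \<in> tcar C" for y
        unfolding uD(2)[OF x y] by (subst u_eq[OF x], subst u_eq[OF y]) simp
    qed
    moreover have "tadd A (tT A (fst (u x))) (f x) = fst (u (tT C x))" if x: "x \<in> tcar C" for x
      unfolding uD(5)[OF x] by (subst (2) u_eq[OF x]) simp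
    ultimately show "\<exists>k. kslin C A k \<and> (\<forall>x\<in>tcar C. tadd A (tT A (k x)) (f x) = k (tT C x))"
      by blast
  next
    assume "\<exists>k. kslin C A k \<and> (\<forall>x\<in>tcar C. tadd A (tT A (k x)) (f x) = k (tT C x))"
    then obtain k where k: "kslin C A k" "\<And>x. x \<in> tcar C \<Longrightarrow> tadd A (tT A (k x)) (f x) = k (tT C x)"
      by blast
    have "tmor C (dext A C f) (\<lambda>x. (k x, x))"
      unfolding tmor_def by (auto simp: kslinD[OF k(1)] k(2))
    then show "ext_split C (dX A C f)"
      unfolding ext_split_def dX_def by auto
  qed
  \<comment> \<open>The section equation is \<open>coh\<close> read from the zero cocycle to
    \<open>f\<close>, hence the use of symmetry afterwards.\<close>
  also have "\<dots> \<longleftrightarrow> coh C A (azero (linM e C A)) f"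
    unfolding coh_def by (intro ex_cong1 conj_cong ball_cong refl)
      (auto simp: linM_simps kslin_def)
  also have "\<dots> \<longleftrightarrow> coh C A f (azero (linM e C A))"
    using coh_sym[OF kA kC, of f "azero (linM e C A)"] coh_sym[OF kA kC, of "azero (linM e C A)" f]
      fcl linM_closed[OF azero_linM[OF kC kA]] by blast
  finally show ?thesis .
qed

lemma ext_split_trans:
  assumes "ext_split C X" "ext_hom A X Y"
  shows "ext_split C Y"
proof -
  obtain E i p E' i' p' where X: "X = (E,i,p)" "Y = (E',i',p')"
    by (metis prod_cases3)
  obtain s where s: "tmor C E s" "\<forall>y\<in>tcar C. p (s y) = y"
    using assms(1) unfolding X ext_split_def by auto
  obtain u where u: "tmor E E' u" "\<forall>y\<in>tcar E. p' (u y) = p y"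
    using assms(2) unfolding X emor_def by auto
  have "s y \<in> tcar E" if "y \<in> tcar C" for y
    using s that by (auto simp: tmor_def)
  then show ?thesis
    unfolding X ext_split_def using tmor_comp[OF s(1) u(1)] s u by auto
qed

text \<open>\<open>amod_lin\<close> asks only that the operations correspond; that
  \<open>extM\<close> is a module is deduced from this afterwards.\<close>

lemma amod_lin_cls:
  assumes A: "dual_tmotive q \<theta> A" and C: "dual_tmotive q \<theta> C"
  shows "amod_lin (linM e C A) (extM q \<theta> e C A) (cls q \<theta> C A)"
  unfolding amod_lin_def
proof (intro conjI ballI allI)
  note kA = dual_tmotive_ktsmod[OF A] and kC = dual_tmotive_ktsmod[OF C]
  fix f assume f: "f \<in> acar (linM e C A)"
  show "cls q \<theta> C A f \<in> acar (extM q \<theta> e C A)"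
    using f by (simp add: extM_def Ext1_eq[OF A C])
  \<comment> \<open>The action of \<open>a\<close> on classes is the pushout along multiplication by
    \<open>a\<close> on \<open>A\<close>.\<close>
  show "cls q \<theta> C A (ascal (linM e C A) a f) = ascal (extM q \<theta> e C A) a (cls q \<theta> C A f)" for a
    using ext_push_cls[OF A C A tmor_polyact[OF kA] f] by (simp add: extM_def ext_push_def linM_simps)
  fix g assume g: "g \<in> acar (linM e C A)"
  have fg: "aadd (linM e C A) f g \<in> acar (linM e C A)"
    using f g by (simp add: linM_simps kslin_restrict[OF kC] kslin_add[OF kC kA])
  have "(THE c. c \<in> Ext1 q \<theta> C A \<and>
      (\<exists>X1\<in>cls q \<theta> C A f. \<exists>X2\<in>cls q \<theta> C A g. \<exists>X3\<in>c. ext_baer A X1 X2 X3))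
    = cls q \<theta> C A (aadd (linM e C A) f g)"
  proof (rule The_cls[OF A C fg])
    have "ext_baer A (dX A C f) (dX A C g) (dX A C (aadd (linM e C A) f g))"
      using baer_dX_iff[OF A C f g fg] coh_refl[OF kA, of C "aadd (linM e C A) f g"] linM_closed[OF fg] by blast
    then show "\<exists>X1\<in>cls q \<theta> C A f. \<exists>X2\<in>cls q \<theta> C A g.
        \<exists>X3\<in>cls q \<theta> C A (aadd (linM e C A) f g). ext_baer A X1 X2 X3"
      using dX_in_cls[OF A C f] dX_in_cls[OF A C g] dX_in_cls[OF A C fg] by blast
    fix k assume k: "k \<in> acar (linM e C A)"
      and "\<exists>X1\<in>cls q \<theta> C A f. \<exists>X2\<in>cls q \<theta> C A g. \<exists>X3\<in>cls q \<theta> C A k. ext_baer A X1 X2 X3"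
    then obtain X1 X2 X3 where X: "X1 \<in> cls q \<theta> C A f" "X2 \<in> cls q \<theta> C A g" "X3 \<in> cls q \<theta> C A k"
      "ext_baer A X1 X2 X3"
      by blast
    have "ext_baer A (dX A C f) (dX A C g) (dX A C k)"
      by (rule ext_baer_trans[OF X(4) in_clsD(1)[OF A C f X(1)] in_clsD(1)[OF A C g X(2)]
            in_clsD(2)[OF A C k X(3)] kA])
    then show "coh C A (aadd (linM e C A) f g) k"
      by (simp add: baer_dX_iff[OF A C f g k])
  qed
  then show "cls q \<theta> C A (aadd (linM e C A) f g) = aadd (extM q \<theta> e C A) (cls q \<theta> C A f) (cls q \<theta> C A g)"
    by (simp add: extM_def)
qed

lemma azero_extM:
  assumes A: "dual_tmotive q \<theta> A" and C: "dual_tmotive q \<theta> C"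
  shows "azero (extM q \<theta> e C A) = cls q \<theta> C A (azero (linM e C A))"
proof -
  note kA = dual_tmotive_ktsmod[OF A] and kC = dual_tmotive_ktsmod[OF C]
  note z = azero_linM[OF kC kA]
  have "(THE c. c \<in> Ext1 q \<theta> C A \<and> (\<exists>X\<in>c. ext_split C X)) = cls q \<theta> C A (azero (linM e C A))"
  proof (rule The_cls[OF A C z])
    show "\<exists>X\<in>cls q \<theta> C A (azero (linM e C A)). ext_split C X"
      using split_dX_iff[OF A C z] coh_refl[OF kA, of C "azero (linM e C A)"] linM_closed[OF z] dX_in_cls[OF A C z] by blast
    fix k assume k: "k \<in> acar (linM e C A)" and "\<exists>X\<in>cls q \<theta> C A k. ext_split C X"
    then have "ext_split C (dX A C k)"
      using in_clsD(2)[OF A C k] ext_split_trans by blast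
    then show "coh C A (azero (linM e C A)) k"
      using split_dX_iff[OF A C k] coh_sym[OF kA kC, of k "azero (linM e C A)"] linM_closed[OF k] linM_closed[OF z] by blast
  qed
  then show ?thesis
    by (simp add: extM_def)
qed

lemma cls_eq_zero_iff:
  assumes A: "dual_tmotive q \<theta> A" and C: "dual_tmotive q \<theta> C" and f: "f \<in> acar (linM e C A)"
    and w: "w * w = (1 :: 'k)" "frinv q w = w"
  shows "cls q \<theta> C A f = azero (extM q \<theta> e C A) \<longleftrightarrow> f \<in> Dop w C A ` acar (linM e C A)"
  using coh_zero_iff_Dop[OF dual_tmotive_ktsmod[OF A] dual_tmotive_ktsmod[OF C] w f]
    cls_eq_iff[OF A C f azero_linM[OF dual_tmotive_ktsmod[OF C] dual_tmotive_ktsmod[OF A]]]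
  by (simp add: azero_extM[OF A C])

end

section \<open>The snake lemma\<close>

locale amodule =
  fixes X :: "('q::field poly, 'x) amod"
  assumes amod: "is_amod X"
begin

lemma scal_closed [simp, intro]: "x \<in> acar X \<Longrightarrow> ascal X a x \<in> acar X"
  and scal_add: "\<lbrakk>x \<in> acar X; y \<in> acar X\<rbrakk> \<Longrightarrow> ascal X a (aadd X x y) = aadd X (ascal X a x) (ascal X a y)"
  and add_scal: "x \<in> acar X \<Longrightarrow> ascal X (a + b) x = aadd X (ascal X a x) (ascal X b x)"
  and mult_scal: "x \<in> acar X \<Longrightarrow> ascal X (a * b) x = ascal X a (ascal X b x)"
  and scal_one [simp]: "x \<in> acar X \<Longrightarrow> ascal X 1 x = x"
  using amod unfolding is_amod_def Let_def by auto

sublocale abgroup "acar X" "aadd X" "azero X" "ascal X (- 1)"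
proof (rule abgroupI)
  fix x assume x: "x \<in> acar X"
  have "aadd X x (ascal X (- 1) x) = ascal X 0 x"
    using add_scal[OF x, of 1 "- 1"] x by simp
  then show "aadd X (aadd X x (ascal X (- 1) x)) (aadd X x (ascal X (- 1) x)) = aadd X x (ascal X (- 1) x)"
    using add_scal[OF x, of 0 0] by simp
qed (use amod in \<open>auto simp: is_amod_def Let_def\<close>)

lemma scal_zero [simp]: "ascal X a (azero X) = azero X"
  by (rule idem_zero) (auto simp flip: scal_add)

end

lemma amod_linD:
  assumes "amod_lin X Y f"
  shows "x \<in> acar X \<Longrightarrow> f x \<in> acar Y"
    and "\<lbrakk>x \<in> acar X; y \<in> acar X\<rbrakk> \<Longrightarrow> f (aadd X x y) = aadd Y (f x) (f y)"
    and "x \<in> acar X \<Longrightarrow> f (ascal X a x) = ascal Y a (f x)"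
  using assms by (auto simp: amod_lin_def)

lemma amod_lin_zero:
  assumes "amodule X" "amodule Y" and f: "amod_lin X Y f"
  shows "f (azero X) = azero Y"
proof -
  interpret X: amodule X by fact
  interpret Y: amodule Y by fact
  have "f (aadd X (azero X) (azero X)) = aadd Y (f (azero X)) (f (azero X))"
    by (rule amod_linD(2)[OF f]) auto
  then show ?thesis
    by (intro Y.idem_zero) (simp_all add: amod_linD(1)[OF f])
qed

text \<open>A presentation of the cokernel of \<open>D\<close>. The module axioms of
  \<open>Y\<close> pass from \<open>X\<close> along the surjection \<open>c\<close>, which replaces
  a direct check of, say, associativity of the Baer sum.\<close>

locale amod_coker = amodule X for X :: "('q::field poly, 'x) amod" +
  fixes D :: "'x \<Rightarrow> 'x" and c :: "'x \<Rightarrow> 'y" and Y :: "('q poly, 'y) amod"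
  assumes D: "amod_lin X X D" and c: "amod_lin X Y c" and onto: "acar Y = c ` acar X"
    and c_zero: "azero Y = c (azero X)"
    and ker: "x \<in> acar X \<Longrightarrow> c x = azero Y \<longleftrightarrow> x \<in> D ` acar X"
begin

abbreviation Z :: "('q poly, 'x) amod" where
  "Z \<equiv> X\<lparr>acar := {x\<in>acar X. D x = azero X}\<rparr>"

lemma D_zero: "D (azero X) = azero X"
  by (rule amod_lin_zero[OF amodule_axioms amodule_axioms D])

lemma is_amod_ker: "is_amod Z"
proof -
  have neg: "\<exists>y. y \<in> acar X \<and> D y = azero X \<and> aadd X x y = azero X"
    if "x \<in> acar X" "D x = azero X" for x
    using that amod_linD[OF D] by (intro exI[of _ "ascal X (- 1) x"]) simp
  show ?thesis
    using neg
    by (auto simp: is_amod_def Let_def amod_linD[OF D] D_zero ac scal_add add_scal mult_scal)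
qed

lemma is_amod_coker: "is_amod Y"
proof -
  have Yeq: "aadd Y (c x) (c y) = c (aadd X x y)" "ascal Y a (c x) = c (ascal X a x)"
    if "x \<in> acar X" "y \<in> acar X" for x y a
    using that amod_linD[OF c] by auto
  have neg: "\<exists>y\<in>acar X. c (aadd X x y) = c (azero X)" if "x \<in> acar X" for x
    using that by (intro bexI[of _ "ascal X (- 1) x"]) auto
  show ?thesis
    using neg
    by (auto simp: is_amod_def Let_def onto c_zero Yeq ac scal_add add_scal mult_scal)
qed

lemma c_add_D: "\<lbrakk>x \<in> acar X; w \<in> acar X\<rbrakk> \<Longrightarrow> c (aadd X x (D w)) = c x"
proof -
  assume x: "x \<in> acar X" and w: "w \<in> acar X"
  have "c (D w) = c (azero X)"
    using ker[of "D w"] w amod_linD[OF D] c_zero by auto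
  then have "c (aadd X x (D w)) = aadd Y (c x) (c (azero X))"
    using x w amod_linD(1)[OF D] amod_linD(2)[OF c] by simp
  also have "\<dots> = c (aadd X x (azero X))"
    using x by (intro amod_linD(2)[OF c, symmetric]) auto
  finally show ?thesis using x by simp
qed

text \<open>Maps between \<open>Ext\<close> modules are known by their values on classes
  \<open>c x\<close>; as \<open>c\<close> is onto, linearity can be checked upstairs.\<close>

lemma amod_lin_descend:
  assumes k: "amod_lin X W k" and f: "\<And>x. x \<in> acar X \<Longrightarrow> f (c x) = k x"
  shows "amod_lin Y W f"
  unfolding amod_lin_def
proof (intro conjI ballI allI)
  fix y assume "y \<in> acar Y"
  then obtain x where x: "x \<in> acar X" "y = c x"
    unfolding onto by (rule imageE)
  show "f y \<in> acar W"
    using x f amod_linD(1)[OF k] by simp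
  show "f (ascal Y a y) = ascal W a (f y)" for a
    using f[of "ascal X a x"] x f amod_linD(3)[OF c] amod_linD(3)[OF k] by simp
  fix y' assume "y' \<in> acar Y"
  then obtain x' where x': "x' \<in> acar X" "y' = c x'"
    unfolding onto by (rule imageE)
  show "f (aadd Y y y') = aadd W (f y) (f y')"
    using f[of "aadd X x x'"] x x' f amod_linD(2)[OF c] amod_linD(2)[OF k] by simp
qed

end

lemma amod_lin_comp: "\<lbrakk>amod_lin X Y f; amod_lin Y Z g\<rbrakk> \<Longrightarrow> amod_lin X Z (\<lambda>x. g (f x))"
  by (auto simp: amod_lin_def)

lemma amod_lin_restrict:
  assumes "amod_lin X Y f" "S \<subseteq> acar X" "f ` S \<subseteq> T"
  shows "amod_lin (X\<lparr>acar := S\<rparr>) (Y\<lparr>acar := T\<rparr>) f"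
  using assms by (auto simp: amod_lin_def subset_iff)

text \<open>The connecting map \<open>d\<close> comes from outside, as a description of an extension
  class. The hypothesis \<open>delta\<close> identifies it for every lift \<open>x2\<close> and
  every \<open>x1\<close> with \<open>u x1 = D2 x2\<close>, which includes independence of these
  choices.\<close>

lemma snake:
  assumes "amod_coker X1 D1 c1 Y1" "amod_coker X2 D2 c2 Y2" "amod_coker X3 D3 c3 Y3"
    and u: "amod_lin X1 X2 u" and v: "amod_lin X2 X3 v"
    and inj: "inj_on u (acar X1)" and mid: "u ` acar X1 = {y\<in>acar X2. v y = azero X3}"
    and surj: "v ` acar X2 = acar X3"
    and uD: "\<And>x. x \<in> acar X1 \<Longrightarrow> u (D1 x) = D2 (u x)"
    and vD: "\<And>x. x \<in> acar X2 \<Longrightarrow> v (D2 x) = D3 (v x)"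
    and delta: "\<And>x1 x2. \<lbrakk>x1 \<in> acar X1; x2 \<in> acar X2; u x1 = D2 x2; D3 (v x2) = azero X3\<rbrakk>
      \<Longrightarrow> d (v x2) = c1 x1"
    and f: "\<And>x. x \<in> acar X1 \<Longrightarrow> f (c1 x) = c2 (u x)"
    and g: "\<And>x. x \<in> acar X2 \<Longrightarrow> g (c2 x) = c3 (v x)"
  shows "exact6 (X1\<lparr>acar := {x\<in>acar X1. D1 x = azero X1}\<rparr>) (X2\<lparr>acar := {x\<in>acar X2. D2 x = azero X2}\<rparr>)
    (X3\<lparr>acar := {x\<in>acar X3. D3 x = azero X3}\<rparr>) Y1 Y2 Y3 u v d f g"
proof -
  interpret X1: amod_coker X1 D1 c1 Y1 by fact
  interpret X2: amod_coker X2 D2 c2 Y2 by fact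
  interpret X3: amod_coker X3 D3 c3 Y3 by fact
  note ul = amod_linD[OF u] amod_lin_zero[OF X1.amodule_axioms X2.amodule_axioms u]
  note vl = amod_linD[OF v] amod_lin_zero[OF X2.amodule_axioms X3.amodule_axioms v]
  note D1l = amod_linD[OF X1.D] and D2l = amod_linD[OF X2.D] and D3l = amod_linD[OF X3.D]
  note c1l = amod_linD[OF X1.c] and c2l = amod_linD[OF X2.c] and c3l = amod_linD[OF X3.c]
  have vu: "v (u x) = azero X3" if "x \<in> acar X1" for x
    using mid that by auto
  \<comment> \<open>The premise on \<open>D3\<close> is discharged by
    \<open>D3 (v x2) = v (D2 x2) = v (u x1)\<close> and \<open>v u = 0\<close>.\<close>
  have d: "d (v x2) = c1 x1" if "x1 \<in> acar X1" "x2 \<in> acar X2" "u x1 = D2 x2" for x1 x2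
    using delta[OF that] that vu[of x1] vD[of x2] by simp
  have vu': "\<exists>x\<in>acar X1. y = u x" if "y \<in> acar X2" "v y = azero X3" for y
    using mid that by (metis (mono_tags, lifting) imageE mem_Collect_eq)
  have u0: "x = azero X1" if "x \<in> acar X1" "u x = azero X2" for x
    using inj that ul(4) by (metis X1.zero_closed inj_onD)
  \<comment> \<open>The usual chase: lift \<open>z\<close> along \<open>v\<close>; then
    \<open>D2\<close> of the lift is killed by \<open>v\<close>, hence comes from
    \<open>X1\<close>.\<close>
  have lift: "\<exists>x2\<in>acar X2. \<exists>x1\<in>acar X1. z = v x2 \<and> u x1 = D2 x2 \<and> d z = c1 x1"
    if "z \<in> acar X3.Z" for z
  proof -
    have z: "z \<in> acar X3" "D3 z = azero X3"
      using that by auto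
    obtain x2 where x2: "x2 \<in> acar X2" "z = v x2"
      using surj z(1) by blast
    then obtain x1 where "x1 \<in> acar X1" "D2 x2 = u x1"
      using vu'[of "D2 x2"] vD z(2) D2l(1) by metis
    then show ?thesis
      using x2 d[of x1 x2] by (intro bexI[of _ x2] bexI[of _ x1]) auto
  qed
  have lin_d: "amod_lin X3.Z Y1 d"
    unfolding amod_lin_def
  proof (intro conjI ballI allI)
    fix z assume "z \<in> acar X3.Z"
    from lift[OF this] obtain x2 x1 where x: "x2 \<in> acar X2" "x1 \<in> acar X1" "z = v x2" "u x1 = D2 x2"
      "d z = c1 x1"
      by blast
    show "d z \<in> acar Y1"
      using x c1l by simp
    show "d (ascal X3.Z a z) = ascal Y1 a (d z)" for a
      using d[of "ascal X1 a x1" "ascal X2 a x2"] x by (simp add: ul vl D2l c1l)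
    fix z' assume "z' \<in> acar X3.Z"
    from lift[OF this] obtain x2' x1' where x': "x2' \<in> acar X2" "x1' \<in> acar X1" "z' = v x2'"
      "u x1' = D2 x2'" "d z' = c1 x1'"
      by blast
    show "d (aadd X3.Z z z') = aadd Y1 (d z) (d z')"
      using d[of "aadd X1 x1 x1'" "aadd X2 x2 x2'"] x x' by (simp add: ul vl D2l c1l)
  qed
  have lin_f: "amod_lin Y1 Y2 f"
    by (rule X1.amod_lin_descend[OF amod_lin_comp[OF u X2.c] f])
  have lin_g: "amod_lin Y2 Y3 g"
    by (rule X2.amod_lin_descend[OF amod_lin_comp[OF v X3.c] g])
  have lin_u: "amod_lin X1.Z X2.Z u"
    using u by (intro amod_lin_restrict) (auto simp: ul simp flip: uD)
  have lin_v: "amod_lin X2.Z X3.Z v"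
    using v by (intro amod_lin_restrict) (auto simp: vl simp flip: vD)
  have ex2: "u ` acar X1.Z = {y\<in>acar X2.Z. v y = azero X3.Z}"
  proof (intro set_eqI iffI)
    fix y assume "y \<in> {y\<in>acar X2.Z. v y = azero X3.Z}"
    then have y: "y \<in> acar X2" "D2 y = azero X2" "v y = azero X3" by auto
    then obtain x where x: "x \<in> acar X1" "y = u x"
      using vu' by blast
    then have "D1 x = azero X1"
      using y by (intro u0) (auto simp: D1l uD)
    then show "y \<in> u ` acar X1.Z"
      using x by auto
  qed (auto simp: ul vu simp flip: uD)
  have ex3: "v ` acar X2.Z = {z\<in>acar X3.Z. d z = azero Y1}"
  proof (intro set_eqI iffI)
    fix z assume "z \<in> v ` acar X2.Z"
    then obtain y where y: "y \<in> acar X2" "D2 y = azero X2" "z = v y" by auto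
    then show "z \<in> {z\<in>acar X3.Z. d z = azero Y1}"
      using d[of "azero X1" y] vD[of y] by (simp add: ul vl X1.c_zero)
  next
    fix z assume "z \<in> {z\<in>acar X3.Z. d z = azero Y1}"
    then have z: "z \<in> acar X3.Z" "d z = azero Y1" by auto
    from lift[OF z(1)] obtain x2 x1 where x: "x2 \<in> acar X2" "x1 \<in> acar X1" "z = v x2" "u x1 = D2 x2"
      "d z = c1 x1"
      by blast
    then obtain w where w: "w \<in> acar X1" "x1 = D1 w"
      using X1.ker z(2) by auto
    \<comment> \<open>The lift is corrected by an element from \<open>X1\<close> so that
      \<open>D2\<close> kills it; its image under \<open>v\<close> stays the same.\<close>
    let ?y = "aadd X2 x2 (ascal X2 (- 1) (u w))"
    have "D2 (u w) = D2 x2"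
      using w x by (simp flip: uD)
    then have "D2 ?y = azero X2"
      using x w by (simp add: D2l ul)
    moreover have "v ?y = z"
      using x w by (simp add: vl ul vu)
    ultimately show "z \<in> v ` acar X2.Z"
      using x w by (intro image_eqI[of _ _ ?y]) (auto simp: ul)
  qed
  have ex4: "d ` acar X3.Z = {y\<in>acar Y1. f y = azero Y2}"
  proof (intro set_eqI iffI)
    fix y assume "y \<in> d ` acar X3.Z"
    then obtain z where z: "z \<in> acar X3.Z" "y = d z" by (rule imageE)
    from lift[OF z(1)] z(2) obtain x2 x1 where x: "x2 \<in> acar X2" "x1 \<in> acar X1" "u x1 = D2 x2" "y = c1 x1"
      by auto
    then have "f y = azero Y2"
      using X2.ker[of "D2 x2"] by (simp add: f D2l)
    then show "y \<in> {y\<in>acar Y1. f y = azero Y2}"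
      using x c1l by simp
  next
    fix y assume "y \<in> {y\<in>acar Y1. f y = azero Y2}"
    then obtain x1 where x1: "x1 \<in> acar X1" "y = c1 x1" "c2 (u x1) = azero Y2"
      unfolding X1.onto using f by auto
    then obtain x2 where x2: "x2 \<in> acar X2" "u x1 = D2 x2"
      using X2.ker[of "u x1"] ul by auto
    have "D3 (v x2) = azero X3"
      using x1 x2 vu[of x1] vD[of x2] by simp
    then show "y \<in> d ` acar X3.Z"
      using x1 x2 d[of x1 x2] by (intro image_eqI[of _ _ "v x2"]) (auto simp: vl)
  qed
  have ex5: "f ` acar Y1 = {y\<in>acar Y2. g y = azero Y3}"
  proof (intro set_eqI iffI)
    fix y assume "y \<in> f ` acar Y1"
    then obtain x where x: "x \<in> acar X1" "y = c2 (u x)"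
      unfolding X1.onto using f by auto
    then show "y \<in> {y\<in>acar Y2. g y = azero Y3}"
      using c2l(1) ul(1) by (simp add: g vu X3.c_zero)
  next
    fix y assume "y \<in> {y\<in>acar Y2. g y = azero Y3}"
    then obtain x where x: "x \<in> acar X2" "y = c2 x" "c3 (v x) = azero Y3"
      unfolding X2.onto using g by auto
    then obtain z where z: "z \<in> acar X3" "v x = D3 z"
      using X3.ker[of "v x"] vl by auto
    then obtain w where w: "w \<in> acar X2" "z = v w"
      using surj by auto
    \<comment> \<open>Subtracting \<open>D2 w\<close> moves \<open>x\<close> into the kernel of
      \<open>v\<close> without changing its class.\<close>
    have "v (aadd X2 x (D2 (ascal X2 (- 1) w))) = azero X3"
      using x z w D3l(1)[of "v w"] by (simp add: vl D2l vD)
    then obtain x1 where x1: "x1 \<in> acar X1" "aadd X2 x (D2 (ascal X2 (- 1) w)) = u x1"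
      using vu' x w D2l by (metis X2.add_closed X2.neg_closed)
    have "y = f (c1 x1)"
      using X2.c_add_D[of x "ascal X2 (- 1) w"] x w x1 by (simp add: f)
    then show "y \<in> f ` acar Y1"
      using x1 c1l by blast
  qed
  have ex6: "g ` acar Y2 = acar Y3"
    unfolding X2.onto X3.onto surj[symmetric] image_image using g by (intro image_cong) auto
  show ?thesis
    unfolding exact6_def
    using X1.is_amod_ker X2.is_amod_ker X3.is_amod_ker X1.is_amod_coker X2.is_amod_coker X3.is_amod_coker
      lin_d lin_f lin_g lin_u lin_v ex2 ex3 ex4 ex5 ex6 inj
    by (auto intro: inj_on_subset)
qed

section \<open>The long exact sequences\<close>

context motive_base
begin

lemma amod_coker_cls:
  assumes A: "dual_tmotive q \<theta> A" and C: "dual_tmotive q \<theta> C" and w: "w * w = (1 :: 'k)" "frinv q w = w"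
  shows "amod_coker (linM e C A) (Dop w C A) (cls q \<theta> C A) (extM q \<theta> e C A)"
proof
  note kA = dual_tmotive_ktsmod[OF A] and kC = dual_tmotive_ktsmod[OF C]
  show "is_amod (linM e C A)"
    by (rule is_amod_linM[OF kC kA])
  show "amod_lin (linM e C A) (linM e C A) (Dop w C A)"
    by (rule amod_lin_Dop[OF kC kA w(2)])
  show "amod_lin (linM e C A) (extM q \<theta> e C A) (cls q \<theta> C A)"
    by (rule amod_lin_cls[OF A C])
  show "acar (extM q \<theta> e C A) = cls q \<theta> C A ` acar (linM e C A)"
    by (simp add: extM_def Ext1_eq[OF A C])
  show "azero (extM q \<theta> e C A) = cls q \<theta> C A (azero (linM e C A))"
    by (rule azero_extM[OF A C])
  show "cls q \<theta> C A f = azero (extM q \<theta> e C A) \<longleftrightarrow> f \<in> Dop w C A ` acar (linM e C A)"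
    if "f \<in> acar (linM e C A)" for f
    by (rule cls_eq_zero_iff[OF A C that w])
qed

section \<open>Composition with morphisms and its compatibility with the commutator\<close>

lemma amod_lin_postcomp:
  assumes N: "ktsmod q N" and A: "ktsmod q A" and B: "ktsmod q B" and g: "tmor A B g"
  shows "amod_lin (linM e N A) (linM e N B) (\<lambda>f. \<lambda>x\<in>tcar N. g (f x))"
  unfolding amod_lin_def
  by (auto simp: linM_simps fun_eq_iff kslinD kslinD[OF tmor_kslin[OF g]] polyact_tmor[OF A g B]
      intro!: kslin_restrict[OF N] kslin_comp[OF _ tmor_kslin[OF g]])

lemma amod_lin_precomp:
  assumes N: "ktsmod q N" and A: "ktsmod q A" and B: "ktsmod q B" and g: "tmor A B g"
  shows "amod_lin (linM e B N) (linM e A N) (\<lambda>f. \<lambda>x\<in>tcar A. f (g x))"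
  unfolding amod_lin_def
  by (auto simp: linM_simps fun_eq_iff kslinD[OF tmor_kslin[OF g]]
      intro!: kslin_restrict[OF A] kslin_comp[OF tmor_kslin[OF g]])

lemma Dop_postcomp:
  assumes N: "ktsmod q N" and A: "ktsmod q A" and B: "ktsmod q B" and g: "tmor A B g"
    and f: "f \<in> acar (linM e N A)"
  shows "(\<lambda>x\<in>tcar N. g (Dop w N A f x)) = Dop w N B (\<lambda>x\<in>tcar N. g (f x))"
proof -
  interpret N: ktsmod q N by fact
  interpret A: ktsmod q A by fact
  interpret B: ktsmod q B by fact
  show ?thesis
    by (simp add: Dop_def fun_eq_iff kslinD[OF tmor_kslin[OF g]] tmor_T[OF g] linM_closed[OF f] restrict_def)
qed

lemma Dop_precomp:
  assumes A: "ktsmod q A" and g: "tmor A B g"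
  shows "(\<lambda>x\<in>tcar A. Dop w B N f (g x)) = Dop w A N (\<lambda>x\<in>tcar A. f (g x))"
proof -
  interpret A: ktsmod q A by fact
  show ?thesis
    by (simp add: Dop_def fun_eq_iff kslinD[OF tmor_kslin[OF g]] tmor_T[OF g] restrict_def)
qed

text \<open>\<open>L(N, -)\<close> is exact on the sequence since \<open>i\<close> and
  \<open>p\<close> have the one-sided inverses \<open>r\<close> and \<open>s\<close>. With
  \<open>w = 1\<close> the snake sends \<open>z\<close> to the class of \<open>f z\<close>, where
  \<open>f\<close> is the cocycle of the sequence; this is its pullback along
  \<open>z\<close>.\<close>

lemma ext_hom_sequence_covariant:
  fixes M1 :: "('k,'a) tmod" and M :: "('k,'m) tmod" and M2 :: "('k,'b) tmod" and N :: "('k,'n) tmod"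
  assumes M1: "dual_tmotive q \<theta> M1" and M: "dual_tmotive q \<theta> M" and M2: "dual_tmotive q \<theta> M2"
    and N: "dual_tmotive q \<theta> N" and ses: "short_exact M1 M M2 i p"
  shows "exact6 (homM e N M1) (homM e N M) (homM e N M2)
     (extM q \<theta> e N M1) (extM q \<theta> e N M) (extM q \<theta> e N M2)
     (\<lambda>f. restrict (i \<circ> f) (tcar N)) (\<lambda>f. restrict (p \<circ> f) (tcar N))
     (delta_cov q \<theta> N M1 (M, i, p)) (ext_push q \<theta> N M1 M i) (ext_push q \<theta> N M M2 p)"
proof -
  note k1 = dual_tmotive_ktsmod[OF M1] and k = dual_tmotive_ktsmod[OF M]
    and k2 = dual_tmotive_ktsmod[OF M2] and kN = dual_tmotive_ktsmod[OF N]
  interpret M1: ktsmod q M1 by fact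
  interpret M: ktsmod q M by fact
  interpret M2: ktsmod q M2 by fact
  interpret N: ktsmod q N by fact
  obtain s r f where s: "kslin M2 M s" and r: "kslin M M1 r" and ps: "\<And>y. y \<in> tcar M2 \<Longrightarrow> p (s y) = y"
    and ri: "\<And>x. x \<in> tcar M1 \<Longrightarrow> r (i x) = x" and rs: "\<And>y. y \<in> tcar M2 \<Longrightarrow> r (s y) = tzero M1"
    and split: "\<And>x. x \<in> tcar M \<Longrightarrow> tadd M (i (r x)) (s (p x)) = x"
    and f: "f \<in> acar (linM e M2 M1)"
    and rT: "\<And>x. x \<in> tcar M \<Longrightarrow> r (tT M x) = tadd M1 (tT M1 (r x)) (f (p x))"
    and X: "ext_hom M1 (M,i,p) (dX M1 M2 f)" "ext_hom M1 (dX M1 M2 f) (M,i,p)"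
    using short_exact_cocycle[OF k1 k k2 dual_tmotive_free[OF M2] ses] by metis
  have i: "tmor M1 M i" and p: "tmor M M2 p" and pi: "\<And>x. x \<in> tcar M1 \<Longrightarrow> p (i x) = tzero M2"
    and inj: "inj_on i (tcar M1)"
    using ses by (auto simp: short_exact_def)
  note iD = kslinD[OF tmor_kslin[OF i]] and pD = kslinD[OF tmor_kslin[OF p]] and sD = kslinD[OF s]
    and rD = kslinD[OF r]
  have "exact6 ((linM e N M1)\<lparr>acar := {h\<in>acar (linM e N M1). Dop 1 N M1 h = azero (linM e N M1)}\<rparr>)
     ((linM e N M)\<lparr>acar := {h\<in>acar (linM e N M). Dop 1 N M h = azero (linM e N M)}\<rparr>)
     ((linM e N M2)\<lparr>acar := {h\<in>acar (linM e N M2). Dop 1 N M2 h = azero (linM e N M2)}\<rparr>)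
     (extM q \<theta> e N M1) (extM q \<theta> e N M) (extM q \<theta> e N M2)
     (\<lambda>h. \<lambda>x\<in>tcar N. i (h x)) (\<lambda>h. \<lambda>x\<in>tcar N. p (h x))
     (delta_cov q \<theta> N M1 (M, i, p)) (ext_push q \<theta> N M1 M i) (ext_push q \<theta> N M M2 p)"
  proof (rule snake)
    show "amod_coker (linM e N M1) (Dop 1 N M1) (cls q \<theta> N M1) (extM q \<theta> e N M1)"
      "amod_coker (linM e N M) (Dop 1 N M) (cls q \<theta> N M) (extM q \<theta> e N M)"
      "amod_coker (linM e N M2) (Dop 1 N M2) (cls q \<theta> N M2) (extM q \<theta> e N M2)"
      by (simp_all add: amod_coker_cls M1 M M2 N frinv_sign)
    show "amod_lin (linM e N M1) (linM e N M) (\<lambda>h. \<lambda>x\<in>tcar N. i (h x))"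
      by (rule amod_lin_postcomp[OF kN k1 k i])
    show "amod_lin (linM e N M) (linM e N M2) (\<lambda>h. \<lambda>x\<in>tcar N. p (h x))"
      by (rule amod_lin_postcomp[OF kN k k2 p])
    show "inj_on (\<lambda>h. \<lambda>x\<in>tcar N. i (h x)) (acar (linM e N M1))"
    proof (rule inj_onI)
      fix g h assume g: "g \<in> acar (linM e N M1)" and h: "h \<in> acar (linM e N M1)"
        and eq: "(\<lambda>x\<in>tcar N. i (g x)) = (\<lambda>x\<in>tcar N. i (h x))"
      have "g x = h x" if "x \<in> tcar N" for x
        using fun_cong[OF eq, of x] that linM_closed[OF g] linM_closed[OF h] inj by (simp add: inj_on_eq_iff)
      then show "g = h"
        using g h by (auto simp: linM_simps intro: extensionalityI)
    qed
    show "(\<lambda>h. \<lambda>x\<in>tcar N. i (h x)) ` acar (linM e N M1)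
      = {h\<in>acar (linM e N M). (\<lambda>x\<in>tcar N. p (h x)) = azero (linM e N M2)}"
    proof (intro set_eqI iffI)
      fix h assume "h \<in> (\<lambda>h. \<lambda>x\<in>tcar N. i (h x)) ` acar (linM e N M1)"
      then obtain g where g: "g \<in> acar (linM e N M1)" "h = (\<lambda>x\<in>tcar N. i (g x))"
        by (rule imageE)
      have "h \<in> acar (linM e N M)"
        unfolding g(2) by (rule amod_linD(1)[OF amod_lin_postcomp[OF kN k1 k i] g(1)])
      moreover have "(\<lambda>x\<in>tcar N. p (h x)) = azero (linM e N M2)"
        using linM_closed[OF g(1)] by (auto simp: g(2) linM_simps(3) pi)
      ultimately show "h \<in> {h\<in>acar (linM e N M). (\<lambda>x\<in>tcar N. p (h x)) = azero (linM e N M2)}"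
        by simp
    next
      fix h assume "h \<in> {h\<in>acar (linM e N M). (\<lambda>x\<in>tcar N. p (h x)) = azero (linM e N M2)}"
      then have h: "h \<in> acar (linM e N M)" and eq: "(\<lambda>x\<in>tcar N. p (h x)) = azero (linM e N M2)"
        by auto
      have "p (h x) = tzero M2" if "x \<in> tcar N" for x
        using fun_cong[OF eq, of x] that by (simp add: linM_simps)
      \<comment> \<open>In the decomposition \<open>h = i r h + s p h\<close> the second term
        vanishes, so \<open>r h\<close> is a preimage.\<close>
      then have "i (r (h x)) = h x" if "x \<in> tcar N" for x
        using split[of "h x"] that linM_closed[OF h that] by (simp add: kslin_zero[OF k2 k s] iD rD)
      then have "h = (\<lambda>x\<in>tcar N. i ((\<lambda>x\<in>tcar N. r (h x)) x))"
        using h by (auto simp: linM_simps intro!: extensionalityI[of _ "tcar N"])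
      moreover have "(\<lambda>x\<in>tcar N. r (h x)) \<in> acar (linM e N M1)"
        using h by (intro comp_in_linM[OF kN _ r]) (simp add: linM_simps)
      ultimately show "h \<in> (\<lambda>h. \<lambda>x\<in>tcar N. i (h x)) ` acar (linM e N M1)"
        by blast
    qed
    show "(\<lambda>h. \<lambda>x\<in>tcar N. p (h x)) ` acar (linM e N M) = acar (linM e N M2)"
    proof (intro set_eqI iffI)
      fix h assume h: "h \<in> acar (linM e N M2)"
      \<comment> \<open>The map \<open>s h\<close> is a \<open>K{\<sigma>}\<close>-linear lift of
        \<open>h\<close>.\<close>
      then have "h = (\<lambda>x\<in>tcar N. p ((\<lambda>x\<in>tcar N. s (h x)) x))"
        using linM_closed[OF h] by (auto simp: linM_simps ps intro!: extensionalityI[of _ "tcar N"])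
      moreover have "(\<lambda>x\<in>tcar N. s (h x)) \<in> acar (linM e N M)"
        using h by (intro comp_in_linM[OF kN _ s]) (simp add: linM_simps)
      ultimately show "h \<in> (\<lambda>h. \<lambda>x\<in>tcar N. p (h x)) ` acar (linM e N M)"
        by blast
    qed (use amod_linD(1)[OF amod_lin_postcomp[OF kN k k2 p]] in blast)
    show "(\<lambda>x\<in>tcar N. i (Dop 1 N M1 h x)) = Dop 1 N M (\<lambda>x\<in>tcar N. i (h x))"
      if "h \<in> acar (linM e N M1)" for h
      by (rule Dop_postcomp[OF kN k1 k i that])
    show "(\<lambda>x\<in>tcar N. p (Dop 1 N M h x)) = Dop 1 N M2 (\<lambda>x\<in>tcar N. p (h x))"
      if "h \<in> acar (linM e N M)" for h
      by (rule Dop_postcomp[OF kN k k2 p that])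
    show "ext_push q \<theta> N M1 M i (cls q \<theta> N M1 h) = cls q \<theta> N M (\<lambda>x\<in>tcar N. i (h x))"
      if "h \<in> acar (linM e N M1)" for h
      by (rule ext_push_cls[OF M1 N M i that])
    show "ext_push q \<theta> N M M2 p (cls q \<theta> N M h) = cls q \<theta> N M2 (\<lambda>x\<in>tcar N. p (h x))"
      if "h \<in> acar (linM e N M)" for h
      by (rule ext_push_cls[OF M N M2 p that])
    show "delta_cov q \<theta> N M1 (M, i, p) (\<lambda>x\<in>tcar N. p (h x)) = cls q \<theta> N M1 g"
      if g: "g \<in> acar (linM e N M1)" and h: "h \<in> acar (linM e N M)"
        and eq: "(\<lambda>x\<in>tcar N. i (g x)) = Dop 1 N M h" and z: "Dop 1 N M2 (\<lambda>x\<in>tcar N. p (h x)) = azero (linM e N M2)" for g h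
    proof -
      let ?z = "\<lambda>x\<in>tcar N. p (h x)"
      have "?z \<in> acar (linM e N M2)"
        using amod_linD(1)[OF amod_lin_postcomp[OF kN k k2 p] h] .
      then have zm: "tmor N M2 ?z"
        using z Dop_eq_zero_iff[OF kN k2, of 1] by simp
      have fz: "(\<lambda>x\<in>tcar N. f (?z x)) \<in> acar (linM e N M1)"
        using f by (intro comp_in_linM[OF kN tmor_kslin[OF zm]]) (simp add: linM_simps)
      note hD = linM_closed[OF h] and gD = linM_closed[OF g]
      have "coh N M1 g (\<lambda>x\<in>tcar N. f (?z x))"
        unfolding coh_def
      proof (intro exI conjI ballI)
        \<comment> \<open>The witness is \<open>k = r h\<close>. Applying \<open>r\<close> to
          \<open>i g + h t = t h\<close> and using \<open>r t = t r + f p\<close> gives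
          \<open>g + k t = t k + f z\<close>.\<close>
        show "kslin N M1 (\<lambda>x. r (h x))"
          using h by (intro kslin_comp[OF _ r]) (simp add: linM_simps)
        fix x assume x: "x \<in> tcar N"
        have "i (g x) = tadd M (tT M (h x)) (tsmul M (- 1) (h (tT N x)))"
          using fun_cong[OF eq, of x] x hD by (simp add: Dop_def)
        then have "tadd M (i (g x)) (h (tT N x)) = tT M (h x)"
          using x hD gD iD by (simp add: M.eq_diff)
        then have "r (tadd M (i (g x)) (h (tT N x))) = r (tT M (h x))"
          by simp
        then show "tadd M1 (g x) (r (h (tT N x))) = tadd M1 (tT M1 (r (h x))) ((\<lambda>x\<in>tcar N. f (?z x)) x)"
          using x hD gD iD rD by (simp add: rT ri)
      qed
      then show ?thesis
        unfolding delta_cov_cls[OF M1 M2 N zm f X] using cls_eq_iff[OF M1 N g fz] by simp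
    qed
  qed
  then show ?thesis
    using homM_eq_ker[OF kN k1, of 1] homM_eq_ker[OF kN k, of 1] homM_eq_ker[OF kN k2, of 1]
    by (simp add: comp_def)
qed

text \<open>Precomposition with \<open>r\<close> and \<open>s\<close> makes \<open>L(-, N)\<close>
  exact on the sequence. The cocycle now sits on the other side: for \<open>z = h i\<close>,
  evaluating \<open>t h - h t\<close> on \<open>s\<close> gives \<open>- z f\<close> up to a
  coboundary. The choice \<open>w = - 1\<close> cancels this sign, and the snake map is the pushout
  along \<open>z\<close>.\<close>

lemma ext_hom_sequence_contravariant:
  fixes M1 :: "('k,'a) tmod" and M :: "('k,'m) tmod" and M2 :: "('k,'b) tmod" and N :: "('k,'n) tmod"
  assumes M1: "dual_tmotive q \<theta> M1" and M: "dual_tmotive q \<theta> M" and M2: "dual_tmotive q \<theta> M2"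
    and N: "dual_tmotive q \<theta> N" and ses: "short_exact M1 M M2 i p"
  shows "exact6 (homM e M2 N) (homM e M N) (homM e M1 N)
     (extM q \<theta> e M2 N) (extM q \<theta> e M N) (extM q \<theta> e M1 N)
     (\<lambda>f. restrict (f \<circ> p) (tcar M)) (\<lambda>f. restrict (f \<circ> i) (tcar M1))
     (delta_con q \<theta> M2 M1 N (M, i, p)) (ext_pull q \<theta> M N p) (ext_pull q \<theta> M1 N i)"
proof -
  note k1 = dual_tmotive_ktsmod[OF M1] and k = dual_tmotive_ktsmod[OF M]
    and k2 = dual_tmotive_ktsmod[OF M2] and kN = dual_tmotive_ktsmod[OF N]
  interpret M1: ktsmod q M1 by fact
  interpret M: ktsmod q M by fact
  interpret M2: ktsmod q M2 by fact
  interpret N: ktsmod q N by fact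
  obtain s r f where s: "kslin M2 M s" and r: "kslin M M1 r" and ps: "\<And>y. y \<in> tcar M2 \<Longrightarrow> p (s y) = y"
    and ri: "\<And>x. x \<in> tcar M1 \<Longrightarrow> r (i x) = x" and rs: "\<And>y. y \<in> tcar M2 \<Longrightarrow> r (s y) = tzero M1"
    and split: "\<And>x. x \<in> tcar M \<Longrightarrow> tadd M (i (r x)) (s (p x)) = x"
    and f: "f \<in> acar (linM e M2 M1)"
    and Ts: "\<And>y. y \<in> tcar M2 \<Longrightarrow> tT M (s y) = tadd M (i (f y)) (s (tT M2 y))"
    and X: "ext_hom M1 (M,i,p) (dX M1 M2 f)" "ext_hom M1 (dX M1 M2 f) (M,i,p)"
    using short_exact_cocycle[OF k1 k k2 dual_tmotive_free[OF M2] ses] by metis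
  have i: "tmor M1 M i" and p: "tmor M M2 p" and pi: "\<And>x. x \<in> tcar M1 \<Longrightarrow> p (i x) = tzero M2"
    using ses by (auto simp: short_exact_def)
  note iD = kslinD[OF tmor_kslin[OF i]] and pD = kslinD[OF tmor_kslin[OF p]] and sD = kslinD[OF s]
    and rD = kslinD[OF r]
  have "exact6 ((linM e M2 N)\<lparr>acar := {h\<in>acar (linM e M2 N). Dop (- 1) M2 N h = azero (linM e M2 N)}\<rparr>)
     ((linM e M N)\<lparr>acar := {h\<in>acar (linM e M N). Dop (- 1) M N h = azero (linM e M N)}\<rparr>)
     ((linM e M1 N)\<lparr>acar := {h\<in>acar (linM e M1 N). Dop (- 1) M1 N h = azero (linM e M1 N)}\<rparr>)
     (extM q \<theta> e M2 N) (extM q \<theta> e M N) (extM q \<theta> e M1 N)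
     (\<lambda>h. \<lambda>x\<in>tcar M. h (p x)) (\<lambda>h. \<lambda>x\<in>tcar M1. h (i x))
     (delta_con q \<theta> M2 M1 N (M, i, p)) (ext_pull q \<theta> M N p) (ext_pull q \<theta> M1 N i)"
  proof (rule snake)
    show "amod_coker (linM e M2 N) (Dop (- 1) M2 N) (cls q \<theta> M2 N) (extM q \<theta> e M2 N)"
      "amod_coker (linM e M N) (Dop (- 1) M N) (cls q \<theta> M N) (extM q \<theta> e M N)"
      "amod_coker (linM e M1 N) (Dop (- 1) M1 N) (cls q \<theta> M1 N) (extM q \<theta> e M1 N)"
      by (simp_all add: amod_coker_cls M1 M M2 N frinv_sign)
    show "amod_lin (linM e M2 N) (linM e M N) (\<lambda>h. \<lambda>x\<in>tcar M. h (p x))"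
      by (rule amod_lin_precomp[OF kN k k2 p])
    show "amod_lin (linM e M N) (linM e M1 N) (\<lambda>h. \<lambda>x\<in>tcar M1. h (i x))"
      by (rule amod_lin_precomp[OF kN k1 k i])
    show "inj_on (\<lambda>h. \<lambda>x\<in>tcar M. h (p x)) (acar (linM e M2 N))"
    proof (rule inj_onI)
      fix g h assume g: "g \<in> acar (linM e M2 N)" and h: "h \<in> acar (linM e M2 N)"
        and eq: "(\<lambda>x\<in>tcar M. g (p x)) = (\<lambda>x\<in>tcar M. h (p x))"
      have "g y = h y" if "y \<in> tcar M2" for y
        using fun_cong[OF eq, of "s y"] that by (simp add: sD ps)
      then show "g = h"
        using g h by (auto simp: linM_simps intro: extensionalityI)
    qed
    show "(\<lambda>h. \<lambda>x\<in>tcar M. h (p x)) ` acar (linM e M2 N)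
      = {h\<in>acar (linM e M N). (\<lambda>x\<in>tcar M1. h (i x)) = azero (linM e M1 N)}"
    proof (intro set_eqI iffI)
      fix h assume "h \<in> (\<lambda>h. \<lambda>x\<in>tcar M. h (p x)) ` acar (linM e M2 N)"
      then obtain g where g: "g \<in> acar (linM e M2 N)" "h = (\<lambda>x\<in>tcar M. g (p x))"
        by (rule imageE)
      have "g (tzero M2) = tzero N"
        using g(1) kslin_zero[OF k2 kN] by (simp add: linM_simps)
      then have "(\<lambda>x\<in>tcar M1. h (i x)) = azero (linM e M1 N)"
        by (auto simp: g(2) linM_simps(3) pi iD)
      moreover have "h \<in> acar (linM e M N)"
        unfolding g(2) by (rule amod_linD(1)[OF amod_lin_precomp[OF kN k k2 p] g(1)])
      ultimately show "h \<in> {h\<in>acar (linM e M N). (\<lambda>x\<in>tcar M1. h (i x)) = azero (linM e M1 N)}"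
        by simp
    next
      fix h assume "h \<in> {h\<in>acar (linM e M N). (\<lambda>x\<in>tcar M1. h (i x)) = azero (linM e M1 N)}"
      then have h: "h \<in> acar (linM e M N)" and eq: "(\<lambda>x\<in>tcar M1. h (i x)) = azero (linM e M1 N)"
        by auto
      have hk: "kslin M N h" using h by (simp add: linM_simps)
      have hi: "h (i x) = tzero N" if "x \<in> tcar M1" for x
        using fun_cong[OF eq, of x] that by (simp add: linM_simps)
      \<comment> \<open>As \<open>h\<close> vanishes on the image of \<open>i\<close>, it factors
        through \<open>p\<close>, namely as \<open>h s\<close> after \<open>p\<close>.\<close>
      have "h x = h (s (p x))" if "x \<in> tcar M" for x
      proof -
        have "h x = h (tadd M (i (r x)) (s (p x)))"
          using split[OF that] by simp
        then show ?thesis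
          using that by (simp add: kslinD[OF hk] iD rD sD pD hi)
      qed
      then have "h = (\<lambda>x\<in>tcar M. (\<lambda>y\<in>tcar M2. h (s y)) (p x))"
        using h pD(1) by (auto simp: linM_simps intro!: extensionalityI[of _ "tcar M"])
      moreover have "(\<lambda>y\<in>tcar M2. h (s y)) \<in> acar (linM e M2 N)"
        by (rule comp_in_linM[OF k2 s hk])
      ultimately show "h \<in> (\<lambda>h. \<lambda>x\<in>tcar M. h (p x)) ` acar (linM e M2 N)"
        by blast
    qed
    show "(\<lambda>h. \<lambda>x\<in>tcar M1. h (i x)) ` acar (linM e M N) = acar (linM e M1 N)"
    proof (intro set_eqI iffI)
      fix h assume h: "h \<in> acar (linM e M1 N)"
      \<comment> \<open>Precomposition with the retraction extends \<open>h\<close> from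
        \<open>M1\<close> to \<open>M\<close>.\<close>
      then have "h = (\<lambda>x\<in>tcar M1. (\<lambda>x\<in>tcar M. h (r x)) (i x))"
        by (auto simp: linM_simps ri iD intro!: extensionalityI[of _ "tcar M1"])
      moreover have "(\<lambda>x\<in>tcar M. h (r x)) \<in> acar (linM e M N)"
        using h by (intro comp_in_linM[OF k r]) (simp add: linM_simps)
      ultimately show "h \<in> (\<lambda>h. \<lambda>x\<in>tcar M1. h (i x)) ` acar (linM e M N)"
        by blast
    qed (use amod_linD(1)[OF amod_lin_precomp[OF kN k1 k i]] in blast)
    show "(\<lambda>x\<in>tcar M. Dop (- 1) M2 N h (p x)) = Dop (- 1) M N (\<lambda>x\<in>tcar M. h (p x))" for h
      by (rule Dop_precomp[OF k p])
    show "(\<lambda>x\<in>tcar M1. Dop (- 1) M N h (i x)) = Dop (- 1) M1 N (\<lambda>x\<in>tcar M1. h (i x))" for h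
      by (rule Dop_precomp[OF k1 i])
    show "ext_pull q \<theta> M N p (cls q \<theta> M2 N h) = cls q \<theta> M N (\<lambda>x\<in>tcar M. h (p x))"
      if "h \<in> acar (linM e M2 N)" for h
      by (rule ext_pull_cls[OF N M2 M p that])
    show "ext_pull q \<theta> M1 N i (cls q \<theta> M N h) = cls q \<theta> M1 N (\<lambda>x\<in>tcar M1. h (i x))"
      if "h \<in> acar (linM e M N)" for h
      by (rule ext_pull_cls[OF N M M1 i that])
    show "delta_con q \<theta> M2 M1 N (M, i, p) (\<lambda>x\<in>tcar M1. h (i x)) = cls q \<theta> M2 N g"
      if g: "g \<in> acar (linM e M2 N)" and h: "h \<in> acar (linM e M N)"
        and eq: "(\<lambda>x\<in>tcar M. g (p x)) = Dop (- 1) M N h"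
        and z: "Dop (- 1) M1 N (\<lambda>x\<in>tcar M1. h (i x)) = azero (linM e M1 N)" for g h
    proof -
      let ?z = "\<lambda>x\<in>tcar M1. h (i x)"
      have "?z \<in> acar (linM e M1 N)"
        using amod_linD(1)[OF amod_lin_precomp[OF kN k1 k i] h] .
      then have zm: "tmor M1 N ?z"
        using z Dop_eq_zero_iff[OF k1 kN, of "- 1"] by simp
      have zf: "(\<lambda>x\<in>tcar M2. ?z (f x)) \<in> acar (linM e M2 N)"
        using f by (intro comp_in_linM[OF k2 _ tmor_kslin[OF zm]]) (simp add: linM_simps)
      have hk: "kslin M N h" using h by (simp add: linM_simps)
      note hD = kslinD[OF hk] and gD = linM_closed[OF g] and fD = linM_closed[OF f]
      have "coh M2 N (\<lambda>x\<in>tcar M2. ?z (f x)) g"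
        unfolding coh_def
      proof (intro exI conjI ballI)
        \<comment> \<open>The witness is \<open>k = h s\<close>; the identity
          \<open>t s = i f + s t\<close> brings in the cocycle.\<close>
        show "kslin M2 N (\<lambda>x. h (s x))"
          by (rule kslin_comp[OF s hk])
        fix y assume y: "y \<in> tcar M2"
        \<comment> \<open>Evaluation at \<open>s y\<close> isolates \<open>g y\<close>, because
          \<open>p (s y) = y\<close>.\<close>
        have "g y = tsmul N (- 1) (tadd N (tT N (h (s y))) (tsmul N (- 1) (h (tT M (s y)))))"
          using fun_cong[OF eq, of "s y"] y by (simp add: Dop_def sD ps)
        also have "\<dots> = tadd N (h (tT M (s y))) (tsmul N (- 1) (tT N (h (s y))))"
          using y by (simp add: N.neg_add N.comm hD sD)
        finally have "tadd N (tT N (h (s y))) (g y) = h (tT M (s y))"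
          using y by (simp add: N.eq_diff N.comm hD sD gD)
        then show "tadd N ((\<lambda>x\<in>tcar M2. ?z (f x)) y) (h (s (tT M2 y))) = tadd N (tT N (h (s y))) (g y)"
          using y by (simp add: Ts hD iD sD fD)
      qed
      then show ?thesis
        unfolding delta_con_cls[OF M1 M2 N zm f X] using cls_eq_iff[OF N M2 zf g] by simp
    qed
  qed
  then show ?thesis
    using homM_eq_ker[OF k2 kN, of "- 1"] homM_eq_ker[OF k kN, of "- 1"] homM_eq_ker[OF k1 kN, of "- 1"]
    by (simp add: comp_def)
qed

end

theorem theorem11p5:
  fixes e :: "'q::{finite,field} \<Rightarrow> 'k::field"
    and \<theta> :: 'k
    and M1 :: "('k,'a) tmod" and M :: "('k,'m) tmod" and M2 :: "('k,'b) tmod"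
    and N :: "('k,'n) tmod"
    and i :: "'a \<Rightarrow> 'm" and p :: "'m \<Rightarrow> 'b"
  defines "q \<equiv> card (UNIV :: 'q set)"
  assumes perfect: "perfect_field TYPE('k)"
    and hom: "is_ring_hom_fun e"
    and mot1: "dual_tmotive q \<theta> M1" and mot: "dual_tmotive q \<theta> M"
    and mot2: "dual_tmotive q \<theta> M2" and motN: "dual_tmotive q \<theta> N"
    and ses: "short_exact M1 M M2 i p"
  shows
   "exact6 (homM e N M1) (homM e N M) (homM e N M2)
           (extM q \<theta> e N M1) (extM q \<theta> e N M) (extM q \<theta> e N M2)
           (\<lambda>f. restrict (i \<circ> f) (tcar N))
           (\<lambda>f. restrict (p \<circ> f) (tcar N))
           (delta_cov q \<theta> N M1 (M, i, p))
           (ext_push q \<theta> N M1 M i)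
           (ext_push q \<theta> N M M2 p)
    \<and>
    exact6 (homM e M2 N) (homM e M N) (homM e M1 N)
           (extM q \<theta> e M2 N) (extM q \<theta> e M N) (extM q \<theta> e M1 N)
           (\<lambda>f. restrict (f \<circ> p) (tcar M))
           (\<lambda>f. restrict (f \<circ> i) (tcar M1))
           (delta_con q \<theta> M2 M1 N (M, i, p))
           (ext_pull q \<theta> M N p)
           (ext_pull q \<theta> M1 N i)"
proof -
  interpret motive_base e \<theta> q
    by unfold_locales (simp_all add: hom q_def)
  show ?thesis
    using ext_hom_sequence_covariant[OF mot1 mot mot2 motN ses]
      ext_hom_sequence_contravariant[OF mot1 mot mot2 motN ses] by blast
qed

end
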